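(* The value function $u:\mathbb{R}^n\times[0,T]\to\mathbb{R}$, \[u(\bm{x},t)=\sup_{\bm{d}\in\mathcal{M}_t}\max\Big\{\max_{i\in\{1,\dots,n_{\mathtt{TR}}\}}l_i(\bm{\phi}_{\bm{x},t}^{\bm{d}}(T)),\ \max_{i\in\{1,\dots,n_{\mathcal{X}}\}}\max_{s\in[t,T]}g_i(\bm{\phi}_{\bm{x},t}^{\bm{d}}(s),s)\Big\},\] is the unique Lipschitz continuous viscosity solution to the Hamilton-Jacobi equation \[\max\Big\{\partial_t u(\bm{x},t)+H(\bm{x},\nabla_{\bm{x}}u),\ \max_{i\in\{1,\dots,n_{\mathcal{X}}\}}g_i(\bm{x},t)-u(\bm{x},t)\Big\}=0,\qquad H(\bm{x},\bm{p})=\max_{\bm{d}\in\mathcal{D}}\bm{p}\cdot\bm{F}(\bm{x},\bm{d}),\] with terminal condition \[u(\bm{x},T)=\max\Big\{\max_{i\in\{1,\dots,n_{\mathtt{TR}}\}}l_i(\bm{x}),\ \max_{i\in\{1,\dots,n_{\mathcal{X}}\}}g_i(\bm{x},T)\Big\}.\]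
   Context: Setting. $n,m$ are positive integers, $T>0$. $\bm{f}$ is a vector field with polynomial components $f_i\in\mathbb{R}[\bm{x},\bm{d}]$, $i=1,\dots,n$, $\bm{x}\in\mathbb{R}^n$, $\bm{d}\in\mathbb{R}^m$. $\mathcal{D}=\{\bm{d}\in\mathbb{R}^m\mid h_i(\bm{d})\ge0,\ i=1,\dots,n_{\mathcal{D}}\}$ is compact, with $h_i\in\mathbb{R}[\bm{d}]$. For $t\in[0,T]$, $\mathcal{X}_t=\{\bm{x}\in\mathbb{R}^n\mid g_i(\bm{x},t)\le0,\ i=1,\dots,n_{\mathcal{X}}\}$ is compact, with $g_i\in\mathbb{R}[\bm{x},t]$ and $\partial\mathcal{X}_t=\bigcup_{i}\{\bm{x}\in\mathcal{X}_t\mid g_i(\bm{x},t)=0\}$. The target region is $\mathtt{TR}=\{\bm{x}\in\mathbb{R}^n\mid l_i(\bm{x})\le0,\ i=1,\dots,n_{\mathtt{TR}}\}$ with $l_i\in\mathbb{R}[\bm{x}]$ and $\partial\mathtt{TR}=\bigcup_i\{\bm{x}\in\mathtt{TR}\mid l_i(\bm{x})=0\}$. $R>0$ is a number and $B(\bm{0},R)=\{\bm{x}\in\mathbb{R}^n\mid R-\sum_{i=1}^n x_i^2\ge0\}$, chosen so that for all $t\in[0,T]$: $\mathcal{X}_t\subseteq B(\bm{0},R)$ and $\partial\mathcal{X}_t\cap\partial B(\bm{0},R)=\emptyset$. $\bm{F}:\mathbb{R}^n\times\mathcal{D}\to\mathbb{R}^n$ is a continuous map, globally Lipschitz in $\bm{x}\in\mathbb{R}^n$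 uniformly in $\bm{d}\in\mathcal{D}$, with $\bm{F}=\bm{f}$ on $B(\bm{0},R)\times\mathcal{D}$. $\mathcal{M}_t$ is the set of measurable functions $\bm{d}:[t,T]\to\mathcal{D}$; for $\bm{d}\in\mathcal{M}_t$, $\bm{\phi}_{\bm{x},t}^{\bm{d}}:[t,T]\to\mathbb{R}^n$ is the unique absolutely continuous solution of $\dot{\bm{x}}(s)=\bm{F}(\bm{x}(s),\bm{d}(s))$ a.e. with value $\bm{x}$ at time $t$. $C^\infty(X)$ is the space of infinitely differentiable functions on $X$. A lower semi-continuous function $w$ on $\mathbb{R}^n\times[0,T]$ is a viscosity super-solution of the equation if for every test function $\psi\in C^\infty(\mathbb{R}^n\times[0,T])$ such that $w-\psi$ attains a local minimum at $(\bm{y}_0,t_0)\in\mathbb{R}^n\times[0,T]$, \[\max\Big\{\partial_t\psi(\bm{y}_0,t_0)+H(\bm{y}_0,\nabla_{\bm{x}}\psi(\bm{y}_0,t_0)),\ \max_{i\in\{1,\dots,n_{\mathcal{X}}\}} g_i(\bm{y}_0,t_0)-w(\bm{y}_0,t_0)\Big\}\le0.\] An upper semi-continuous function $w$ on $\mathbb{R}^n\times[0,T]$ is a viscosity sub-solution if for every test function $\psi\in C^\infty(\mathbb{R}^n\times[0,T])$ such that $w-\psi$ attains a local maximum at $(\bm{y}_0,t_0)\in\mathbb{R}^n\times[0,T]$, the same expression is $\ge0$. A continuous function on $\mathbb{R}^n\times[0,T]$ is a viscosity solution if it is both a viscosity super-solution and a viscosity sub-solution.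
   Formalization: Viscosity inequalities are tested only at times t_0 in [0,T), since at t_0=T no Lipschitz function can satisfy them; "Lipschitz continuous" is read as Lipschitz on bounded sets, since polynomial data rule out a global constant; D is nonempty and n_X, n_TR >= 1. *)

theory Defs
  imports "HOL-Analysis.Analysis"
begin

section \<open>Semialgebraic data\<close>

definition disturbance_set :: "(nat \<Rightarrow> (real^'m) \<Rightarrow> real) \<Rightarrow> nat \<Rightarrow> (real^'m) set" where
  "disturbance_set h nD = {d. \<forall>i\<in>{1..nD}. h i d \<ge> 0}"

definition state_set :: "(nat \<Rightarrow> (real^'n) \<times> real \<Rightarrow> real) \<Rightarrow> nat \<Rightarrow> real \<Rightarrow> (real^'n) set" where
  "state_set g nX t = {x. \<forall>i\<in>{1..nX}. g i (x, t) \<le> 0}"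

definition target_set :: "(nat \<Rightarrow> (real^'n) \<Rightarrow> real) \<Rightarrow> nat \<Rightarrow> (real^'n) set" where
  "target_set l nTR = {x. \<forall>i\<in>{1..nTR}. l i x \<le> 0}"

(* R is the square of the radius. *)
definition bounding_ball :: "real \<Rightarrow> (real^'n) set" where
  "bounding_ball R = {x. R - (\<Sum>i\<in>UNIV. (x $ i)\<^sup>2) \<ge> 0}"

section \<open>Controls, trajectories and the value function\<close>

definition controls :: "(real^'m) set \<Rightarrow> real \<Rightarrow> real \<Rightarrow> (real \<Rightarrow> (real^'m)) set" where
  "controls D t T = {d \<in> {t..T} \<rightarrow>\<^sub>E D. d \<in> borel_measurable (lebesgue_on {t..T})}"

definition abs_continuous_on_interval :: "real \<Rightarrow> real \<Rightarrow> (real \<Rightarrow> (real^'n)) \<Rightarrow> bool" where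
  "abs_continuous_on_interval a b \<phi> \<longleftrightarrow>
    (\<forall>\<epsilon>>0. \<exists>\<delta>>0. \<forall>(N::nat) (p :: nat \<Rightarrow> real) (q :: nat \<Rightarrow> real).
       (\<forall>i<N. a \<le> p i \<and> p i \<le> q i \<and> q i \<le> b) \<and>
       disjoint_family_on (\<lambda>i. {p i<..<q i}) {..<N} \<and>
       (\<Sum>i<N. q i - p i) < \<delta> \<longrightarrow>
       (\<Sum>i<N. norm (\<phi> (q i) - \<phi> (p i))) < \<epsilon>)"

definition is_trajectory ::
  "((real^'n) \<times> (real^'m) \<Rightarrow> (real^'n)) \<Rightarrow> real \<Rightarrow> (real^'n) \<Rightarrow> real \<Rightarrow> (real \<Rightarrow> (real^'m))
    \<Rightarrow> (real \<Rightarrow> (real^'n)) \<Rightarrow> bool" where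
  "is_trajectory F T x t d \<phi> \<longleftrightarrow>
     abs_continuous_on_interval t T \<phi> \<and> \<phi> t = x \<and>
     (AE s in lebesgue_on {t..T}.
        (\<phi> has_vector_derivative F (\<phi> s, d s)) (at s within {t..T}))"

(* Trajectories are functions on [t, T] only; extensionality makes the solution unique
   as a total function. *)
definition trajectory ::
  "((real^'n) \<times> (real^'m) \<Rightarrow> (real^'n)) \<Rightarrow> real \<Rightarrow> (real^'n) \<Rightarrow> real \<Rightarrow> (real \<Rightarrow> (real^'m))
    \<Rightarrow> real \<Rightarrow> (real^'n)" where
  "trajectory F T x t d = (THE \<phi>. \<phi> \<in> extensional {t..T} \<and> is_trajectory F T x t d \<phi>)"

(* The inner supremum over s is a maximum, trajectories being continuous on [t, T]. *)
definition value_function ::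
  "((real^'n) \<times> (real^'m) \<Rightarrow> (real^'n)) \<Rightarrow> (real^'m) set \<Rightarrow> real
    \<Rightarrow> (nat \<Rightarrow> (real^'n) \<Rightarrow> real) \<Rightarrow> nat \<Rightarrow> (nat \<Rightarrow> (real^'n) \<times> real \<Rightarrow> real) \<Rightarrow> nat
    \<Rightarrow> (real^'n) \<times> real \<Rightarrow> real" where
  "value_function F D T l nTR g nX = (\<lambda>(x, t).
     SUP d\<in>controls D t T.
       max (MAX i\<in>{1..nTR}. l i (trajectory F T x t d T))
           (MAX i\<in>{1..nX}. SUP s\<in>{t..T}. g i (trajectory F T x t d s, s)))"

(* The supremum is a maximum when D is compact and nonempty and F is continuous. *)
definition hamiltonian ::
  "((real^'n) \<times> (real^'m) \<Rightarrow> (real^'n)) \<Rightarrow> (real^'m) set \<Rightarrow> (real^'n) \<Rightarrow> (real^'n) \<Rightarrow> real" where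
  "hamiltonian F D x p = (SUP d\<in>D. p \<bullet> F (x, d))"

section \<open>Viscosity solutions\<close>

abbreviation space_time :: "real \<Rightarrow> ((real^'n) \<times> real) set" where
  "space_time T \<equiv> UNIV \<times> {0..T}"

(* The derivative is taken within S, so it is one-sided at the faces of S. It is unique for
   convex S with nonempty interior, in particular for space_time T with T > 0. *)
primrec C_k_on :: "nat \<Rightarrow> 'a::real_normed_vector set \<Rightarrow> ('a \<Rightarrow> real) \<Rightarrow> bool" where
  "C_k_on 0 S \<psi> \<longleftrightarrow> continuous_on S \<psi>"
| "C_k_on (Suc k) S \<psi> \<longleftrightarrow>
     (\<exists>\<psi>'. (\<forall>z\<in>S. (\<psi> has_derivative \<psi>' z) (at z within S)) \<and>
           (\<forall>v. C_k_on k S (\<lambda>z. \<psi>' z v)))"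

definition C_infinity_on :: "'a::real_normed_vector set \<Rightarrow> ('a \<Rightarrow> real) \<Rightarrow> bool" where
  "C_infinity_on S \<psi> \<longleftrightarrow> (\<forall>k. C_k_on k S \<psi>)"

definition time_deriv :: "real \<Rightarrow> ((real^'n) \<times> real \<Rightarrow> real) \<Rightarrow> (real^'n) \<times> real \<Rightarrow> real" where
  "time_deriv T \<psi> = (\<lambda>(y, t). vector_derivative (\<lambda>s. \<psi> (y, s)) (at t within {0..T}))"

definition space_grad :: "((real^'n) \<times> real \<Rightarrow> real) \<Rightarrow> (real^'n) \<times> real \<Rightarrow> (real^'n)" where
  "space_grad \<psi> = (\<lambda>(y, t). THE p. GDERIV (\<lambda>x. \<psi> (x, t)) y :> p)"

definition local_min_on :: "'a::topological_space set \<Rightarrow> ('a \<Rightarrow> real) \<Rightarrow> 'a \<Rightarrow> bool" where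
  "local_min_on S v z0 \<longleftrightarrow> (\<forall>\<^sub>F z in at z0 within S. v z0 \<le> v z)"

definition local_max_on :: "'a::topological_space set \<Rightarrow> ('a \<Rightarrow> real) \<Rightarrow> 'a \<Rightarrow> bool" where
  "local_max_on S v z0 \<longleftrightarrow> (\<forall>\<^sub>F z in at z0 within S. v z \<le> v z0)"

definition lower_semicontinuous_on :: "'a::topological_space set \<Rightarrow> ('a \<Rightarrow> real) \<Rightarrow> bool" where
  "lower_semicontinuous_on S w \<longleftrightarrow> (\<forall>z0\<in>S. \<forall>c<w z0. \<forall>\<^sub>F z in at z0 within S. c < w z)"

definition upper_semicontinuous_on :: "'a::topological_space set \<Rightarrow> ('a \<Rightarrow> real) \<Rightarrow> bool" where
  "upper_semicontinuous_on S w \<longleftrightarrow> (\<forall>z0\<in>S. \<forall>c>w z0. \<forall>\<^sub>F z in at z0 within S. w z < c)"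

definition HJ_expr ::
  "((real^'n) \<times> (real^'m) \<Rightarrow> (real^'n)) \<Rightarrow> (real^'m) set \<Rightarrow> real
    \<Rightarrow> (nat \<Rightarrow> (real^'n) \<times> real \<Rightarrow> real) \<Rightarrow> nat
    \<Rightarrow> ((real^'n) \<times> real \<Rightarrow> real) \<Rightarrow> ((real^'n) \<times> real \<Rightarrow> real) \<Rightarrow> (real^'n) \<times> real \<Rightarrow> real" where
  "HJ_expr F D T g nX w \<psi> z =
     max (time_deriv T \<psi> z + hamiltonian F D (fst z) (space_grad \<psi> z))
         ((MAX i\<in>{1..nX}. g i z) - w z)"

(* Test points have t0 < T. At t0 = T the terminal condition takes over: there a local minimum
   of w - \<psi> survives replacing \<psi> by \<psi> + c * (t - T), c > 0, which makes the time derivative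
   arbitrarily large, so the inequality could not hold at any point of the final time slice
   that admits a test function. The initial face t0 = 0 is included. *)
definition viscosity_supersolution ::
  "((real^'n) \<times> (real^'m) \<Rightarrow> (real^'n)) \<Rightarrow> (real^'m) set \<Rightarrow> real
    \<Rightarrow> (nat \<Rightarrow> (real^'n) \<times> real \<Rightarrow> real) \<Rightarrow> nat \<Rightarrow> ((real^'n) \<times> real \<Rightarrow> real) \<Rightarrow> bool" where
  "viscosity_supersolution F D T g nX w \<longleftrightarrow>
     lower_semicontinuous_on (space_time T) w \<and>
     (\<forall>\<psi>. C_infinity_on (space_time T) \<psi> \<longrightarrow>
        (\<forall>z0 \<in> UNIV \<times> {0..<T}. local_min_on (space_time T) (\<lambda>z. w z - \<psi> z) z0 \<longrightarrow>
           HJ_expr F D T g nX w \<psi> z0 \<le> 0))"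

definition viscosity_subsolution ::
  "((real^'n) \<times> (real^'m) \<Rightarrow> (real^'n)) \<Rightarrow> (real^'m) set \<Rightarrow> real
    \<Rightarrow> (nat \<Rightarrow> (real^'n) \<times> real \<Rightarrow> real) \<Rightarrow> nat \<Rightarrow> ((real^'n) \<times> real \<Rightarrow> real) \<Rightarrow> bool" where
  "viscosity_subsolution F D T g nX w \<longleftrightarrow>
     upper_semicontinuous_on (space_time T) w \<and>
     (\<forall>\<psi>. C_infinity_on (space_time T) \<psi> \<longrightarrow>
        (\<forall>z0 \<in> UNIV \<times> {0..<T}. local_max_on (space_time T) (\<lambda>z. w z - \<psi> z) z0 \<longrightarrow>
           HJ_expr F D T g nX w \<psi> z0 \<ge> 0))"

definition viscosity_solution ::
  "((real^'n) \<times> (real^'m) \<Rightarrow> (real^'n)) \<Rightarrow> (real^'m) set \<Rightarrow> real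
    \<Rightarrow> (nat \<Rightarrow> (real^'n) \<times> real \<Rightarrow> real) \<Rightarrow> nat \<Rightarrow> ((real^'n) \<times> real \<Rightarrow> real) \<Rightarrow> bool" where
  "viscosity_solution F D T g nX w \<longleftrightarrow>
     continuous_on (space_time T) w \<and>
     viscosity_supersolution F D T g nX w \<and> viscosity_subsolution F D T g nX w"

definition terminal_condition ::
  "real \<Rightarrow> (nat \<Rightarrow> (real^'n) \<Rightarrow> real) \<Rightarrow> nat \<Rightarrow> (nat \<Rightarrow> (real^'n) \<times> real \<Rightarrow> real) \<Rightarrow> nat
    \<Rightarrow> ((real^'n) \<times> real \<Rightarrow> real) \<Rightarrow> bool" where
  "terminal_condition T l nTR g nX w \<longleftrightarrow>
     (\<forall>x. w (x, T) = max (MAX i\<in>{1..nTR}. l i x) (MAX i\<in>{1..nX}. g i (x, T)))"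

(* The data l, g are polynomials on the whole space, so a single global Lipschitz constant is
   not available; for zero dynamics and g = x^2 - 1, l = x^2 - 1/2 the value function is l. *)
definition lipschitz_on_bounded :: "'a::metric_space set \<Rightarrow> ('a \<Rightarrow> real) \<Rightarrow> bool" where
  "lipschitz_on_bounded S w \<longleftrightarrow> (\<forall>B\<subseteq>S. bounded B \<longrightarrow> (\<exists>L. L-lipschitz_on B w))"

end

theory Submission
  imports Defs
begin

text \<open>A trajectory is the same thing as a solution of the integral equation
  \<open>\<phi> s = x + integral {t..s} (\<lambda>r. F (\<phi> r, d r))\<close>: one direction is the fundamental theorem of
  calculus for absolutely continuous functions, the other is Lebesgue differentiation. The value
  function \<open>u\<close> enters only through the description of \<open>u (x, t) \<le> c\<close> by a condition on every control;
  concatenating and restricting controls gives the dynamic programming principle, hence local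
  Lipschitz continuity and, by a first-order expansion of the test function along short
  trajectories, both viscosity inequalities. Uniqueness is a comparison principle proved by doubling
  the variables. Since \<open>F\<close> grows linearly, information travels with finite speed, and a polynomial
  penalty that decreases along trajectories confines the doubled maximum to a bounded region,
  whatever the growth of the two solutions; all test functions in this part are polynomials.\<close>

section \<open>Absolutely continuous functions\<close>

text \<open>For the integral equation, uniqueness, dependence on the initial point and growth bounds
  all come from one Gronwall estimate; its constant is not sharp, but only finiteness matters. The
  supremum over controls need not be attained, and working with upper bounds valid for every control
  avoids the choice of near-optimal ones. In the comparison argument the penalty must beat both
  solutions on a sphere, yet their size there is known only once the radius is fixed. The radius
  must therefore be independent of the required height of the penalty; raising one fixed function to
  a high power resolves this circularity. The final face is excluded by the terminal values and the
  Lipschitz bounds. The latter also bring the doubled points within a distance of order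
  \<open>\<epsilon>\<close>, which makes the Hamiltonian error vanish with
  \<open>\<epsilon>\<close>.\<close>

lemma has_integral_derivative_abs_continuous:
  fixes \<phi> :: "real \<Rightarrow> real^'n"
  assumes "a \<le> b" and ac: "abs_continuous_on_interval a b \<phi>" and N: "negligible N"
    and der: "\<And>s. s \<in> {a..b} - N \<Longrightarrow> (\<phi> has_vector_derivative \<phi>' s) (at s within {a..b})"
  shows "(\<phi>' has_integral \<phi> b - \<phi> a) {a..b}"
proof -
  \<comment> \<open>With the integrand set to 0 on \<open>N\<close>, tags in \<open>N\<close>
    contribute nothing to a Riemann sum, and only the increments of \<open>\<phi>\<close> over their
    cells must be small. Absolute continuity gives this when these cells lie in an open
    \<open>U \<supseteq> N\<close> of measure below \<open>\<delta>\<close>. At the other tags the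
    derivative controls the error cell by cell.\<close>
  define f where "f s = (if s \<in> N then 0 else \<phi>' s)" for s
  have "(f has_integral \<phi> b - \<phi> a) (cbox a b)"
    unfolding has_integral
  proof (intro allI impI)
    fix e :: real assume "e > 0"
    then obtain \<delta> where \<delta>: "\<delta> > 0" and
      ac\<delta>: "\<And>(m::nat) p q. (\<forall>i<m. a \<le> p i \<and> p i \<le> q i \<and> q i \<le> b) \<Longrightarrow>
       disjoint_family_on (\<lambda>i. {p i<..<q i}) {..<m} \<Longrightarrow>
       (\<Sum>i<m. q i - p i) < \<delta> \<Longrightarrow> (\<Sum>i<m. norm (\<phi> (q i) - \<phi> (p i))) < e/2"
      using ac[unfolded abs_continuous_on_interval_def, rule_format, of "e/2"] by auto
    obtain U where U: "open U" "N \<subseteq> U" "U - N \<in> lmeasurable" "emeasure lebesgue (U - N) < ennreal \<delta>"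
      using sets_lebesgue_outer_open[of N \<delta>] N \<delta> negligible_imp_sets by blast
    have Um: "U \<in> lmeasurable"
      using U N by (metis Diff_partition fmeasurable.Un negligible_imp_measurable)
    have Ud: "measure lebesgue U < \<delta>"
    proof -
      have "measure lebesgue U = measure lebesgue (U - N)"
        using N by (intro measure_negligible_symdiff[symmetric] negligible_subset[OF N]) (use Um in auto)
      then show ?thesis using U \<delta>
        by (simp add: emeasure_eq_measure2 ennreal_less_iff)
    qed
    \<comment> \<open>The \<open>+ 1\<close> keeps the denominator positive when
      \<open>a = b\<close> and makes \<open>e2 * (b - a) < e / 2\<close> strict.\<close>
    define e2 where "e2 = e / (2 * (b - a + 1))"
    have "e2 > 0" and e2: "e2 * (b - a) < e / 2"
      using \<open>e > 0\<close> \<open>a \<le> b\<close> by (auto simp: e2_def field_simps intro!: divide_pos_pos)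
    have "\<forall>x. \<exists>d>0. x \<in> {a..b} - N \<longrightarrow>
         (\<forall>y\<in>{a..b}. norm (y-x) < d \<longrightarrow> norm (\<phi> y - \<phi> x - (y-x) *\<^sub>R \<phi>' x) \<le> e2 * norm (y-x))"
      using der[unfolded has_vector_derivative_def has_derivative_within_alt] \<open>e2 > 0\<close> by (metis zero_less_one)
    then obtain d where d: "\<And>x. 0 < d x"
                 "\<And>x y. \<lbrakk>x \<in> {a..b} - N; y \<in> {a..b}; norm (y-x) < d x\<rbrakk>
                        \<Longrightarrow> norm (\<phi> y - \<phi> x - (y-x) *\<^sub>R \<phi>' x) \<le> e2 * norm (y-x)"
      by metis
    define \<gamma> where "\<gamma> x = (if x \<in> N then U else ball x (d x))" for x
    show "\<exists>\<gamma>. gauge \<gamma> \<and> (\<forall>p. p tagged_division_of cbox a b \<and> \<gamma> fine p \<longrightarrow>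
            norm ((\<Sum>(x,k)\<in>p. measure lborel k *\<^sub>R f x) - (\<phi> b - \<phi> a)) < e)"
    proof (intro exI[of _ \<gamma>] conjI allI impI; (elim conjE)?)
      show "gauge \<gamma>" using U d by (auto simp: gauge_def \<gamma>_def)
      fix p assume p: "p tagged_division_of cbox a b" and fine: "\<gamma> fine p"
      note pD = tagged_division_ofD[OF p]
      have ba: "b - a = (\<Sum>(x,K)\<in>p. Sup K - Inf K)" "\<phi> b - \<phi> a = (\<Sum>(x,K)\<in>p. \<phi>(Sup K) - \<phi>(Inf K))"
        using additive_tagged_division_1[where f= "\<lambda>x. x"] additive_tagged_division_1[where f= \<phi>]
            \<open>a \<le> b\<close> p by auto
      have box: "\<exists>u v. K = {u..v} \<and> u \<le> v \<and> a \<le> u \<and> v \<le> b \<and> u \<le> x \<and> x \<le> v" if xKp: "(x,K) \<in> p" for x K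
      proof -
        obtain u v where "K = cbox u v" using pD(4)[OF xKp] by blast
        with pD(2,3)[OF xKp] show ?thesis by auto
      qed
      define pN where "pN = {z\<in>p. fst z \<in> N}"
      have fin: "finite p" "finite pN" using pD(1) by (auto simp: pN_def)
      have out: "norm (\<Sum>(x,K)\<in>p - pN. measure lborel K *\<^sub>R f x - (\<phi>(Sup K) - \<phi>(Inf K))) \<le> e2 * (b - a)"
      proof -
        have "norm (\<Sum>(x,K)\<in>p - pN. measure lborel K *\<^sub>R f x - (\<phi>(Sup K) - \<phi>(Inf K)))
              \<le> (\<Sum>(x,K)\<in>p - pN. e2 * (Sup K - Inf K))"
        proof (rule sum_norm_le, clarify)
          fix x K assume "(x,K) \<in> p" "(x,K) \<notin> pN"
          then have xN: "x \<notin> N" by (simp add: pN_def)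
          obtain u v where K: "K = {u..v}" "u \<le> v" "a \<le> u" "v \<le> b" "u \<le> x" "x \<le> v"
            using box[OF \<open>(x,K) \<in> p\<close>] by blast
          have sub: "K \<subseteq> ball x (d x)" using fineD[OF fine \<open>(x,K)\<in>p\<close>] xN by (simp add: \<gamma>_def)
          have uv: "u \<in> ball x (d x)" "v \<in> ball x (d x)" using subsetD[OF sub, of u] subsetD[OF sub, of v] K by auto
          \<comment> \<open>Straddle estimate: the tag \<open>x\<close> lies between
            \<open>u\<close> and \<open>v\<close>, so the errors on its two sides add up to
            \<open>e2\<close> times the length of the cell.\<close>
          have "norm ((v - u) *\<^sub>R \<phi>' x - (\<phi> v - \<phi> u)) = norm (\<phi> u - \<phi> x - (u - x) *\<^sub>R \<phi>' x - (\<phi> v - \<phi> x - (v - x) *\<^sub>R \<phi>' x))"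
            by (auto simp: algebra_simps)
          also have "\<dots> \<le> norm (\<phi> u - \<phi> x - (u - x) *\<^sub>R \<phi>' x) + norm (\<phi> v - \<phi> x - (v - x) *\<^sub>R \<phi>' x)"
            by (rule norm_triangle_ineq4)
          also have "\<dots> \<le> e2 * norm (u - x) + e2 * norm (v - x)"
            using K xN uv by (intro add_mono d(2)) (auto simp: dist_real_def)
          also have "\<dots> = e2 * (v - u)" using K by (simp add: algebra_simps)
          finally show "norm (measure lborel K *\<^sub>R f x - (\<phi>(Sup K) - \<phi>(Inf K))) \<le> e2 * (Sup K - Inf K)"
            using K xN by (simp add: f_def)
        qed
        also have "\<dots> \<le> (\<Sum>(x,K)\<in>p. e2 * (Sup K - Inf K))"
        proof (rule sum_mono2[OF fin(1)])
          show "0 \<le> (case z of (x, K) \<Rightarrow> e2 * (Sup K - Inf K))" if "z \<in> p - (p - pN)" for z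
          proof -
            obtain x K where z: "z = (x,K)" "(x,K) \<in> p" using \<open>z \<in> p - (p - pN)\<close> by (cases z) auto
            then obtain u v where "K = {u..v}" "u \<le> v" using box by blast
            then show ?thesis using \<open>e2 > 0\<close> z by simp
          qed
        qed auto
        also have "\<dots> = e2 * (b - a)" unfolding ba sum_distrib_left by (auto intro: sum.cong)
        finally show ?thesis .
      qed
      have inn: "norm (\<Sum>(x,K)\<in>pN. measure lborel K *\<^sub>R f x - (\<phi>(Sup K) - \<phi>(Inf K))) < e/2"
      proof -
        \<comment> \<open>Absolute continuity speaks of families indexed by an initial segment of
          the naturals, so the cells tagged in \<open>N\<close> are enumerated.\<close>
        obtain h where h: "bij_betw h {..<card pN} pN"
          using ex_bij_betw_nat_finite[OF fin(2)] by (auto simp: atLeast0LessThan)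
        define P Q where "P i = Inf (snd (h i))" and "Q i = Sup (snd (h i))" for i
        have hi: "P i \<le> Q i \<and> a \<le> P i \<and> Q i \<le> b \<and> snd (h i) = {P i..Q i} \<and> {P i..Q i} \<subseteq> U \<and> h i \<in> p"
          if "i < card pN" for i
        proof -
          have m: "h i \<in> pN" using h that by (auto simp: bij_betw_def)
          then obtain x K where xK: "h i = (x,K)" "(x,K) \<in> p" "x \<in> N" by (cases "h i") (auto simp: pN_def)
          then show ?thesis using box[OF xK(2)] fineD[OF fine xK(2)] by (auto simp: P_def Q_def \<gamma>_def)
        qed
        have disj: "disjoint_family_on (\<lambda>i. {P i<..<Q i}) {..<card pN}"
          unfolding disjoint_family_on_def
        proof (intro ballI impI)
          fix i j assume ij: "i \<in> {..<card pN}" "j \<in> {..<card pN}" "i \<noteq> j"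
          then have ne: "h i \<noteq> h j" using h by (auto simp: bij_betw_def inj_on_def)
          have "interior (snd (h i)) \<inter> interior (snd (h j)) = {}"
            using pD(5)[of "fst (h i)" "snd (h i)" "fst (h j)" "snd (h j)"] hi[of i] hi[of j] ij ne by auto
          then show "{P i<..<Q i} \<inter> {P j<..<Q j} = {}"
            using hi[of i] hi[of j] ij by simp
        qed
        have "(\<Sum>i<card pN. Q i - P i) = (\<Sum>i<card pN. measure lebesgue {P i<..<Q i})"
          using hi by (intro sum.cong) auto
        also have "\<dots> = measure lebesgue (\<Union>i<card pN. {P i<..<Q i})"
          using disj hi by (intro measure_finite_Union[symmetric]) auto
        also have "\<dots> \<le> measure lebesgue U"
        proof (rule measure_mono_fmeasurable[OF _ _ Um])
          have "{P i<..<Q i} \<subseteq> U" if "i < card pN" for i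
            using hi[OF that] greaterThanLessThan_subseteq_atLeastAtMost_iff[of "P i" "Q i" "P i" "Q i"] by auto
          then show "(\<Union>i<card pN. {P i<..<Q i}) \<subseteq> U" by blast
        qed simp
        also have "\<dots> < \<delta>" by (rule Ud)
        finally have "(\<Sum>i<card pN. norm (\<phi> (Q i) - \<phi> (P i))) < e/2"
          using hi disj by (intro ac\<delta>) auto
        also have "(\<Sum>i<card pN. norm (\<phi> (Q i) - \<phi> (P i))) = (\<Sum>(x,K)\<in>pN. norm (\<phi>(Sup K) - \<phi>(Inf K)))"
          using sum.reindex_bij_betw[OF h, of "\<lambda>(x,K). norm (\<phi>(Sup K) - \<phi>(Inf K))"]
          by (simp add: P_def Q_def case_prod_unfold)
        finally have A: "(\<Sum>(x,K)\<in>pN. norm (\<phi>(Sup K) - \<phi>(Inf K))) < e/2" .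
        have "norm (\<Sum>(x,K)\<in>pN. measure lborel K *\<^sub>R f x - (\<phi>(Sup K) - \<phi>(Inf K))) \<le> (\<Sum>(x,K)\<in>pN. norm (\<phi>(Sup K) - \<phi>(Inf K)))"
          by (rule sum_norm_le) (auto simp: pN_def f_def norm_minus_commute)
        with A show ?thesis by simp
      qed
      have "(\<Sum>(x,k)\<in>p. measure lborel k *\<^sub>R f x) - (\<phi> b - \<phi> a) = (\<Sum>(x,K)\<in>p. measure lborel K *\<^sub>R f x - (\<phi>(Sup K) - \<phi>(Inf K)))"
        unfolding ba by (simp add: sum_subtractf case_prod_unfold)
      also have "\<dots> = (\<Sum>(x,K)\<in>p - pN. measure lborel K *\<^sub>R f x - (\<phi>(Sup K) - \<phi>(Inf K))) + (\<Sum>(x,K)\<in>pN. measure lborel K *\<^sub>R f x - (\<phi>(Sup K) - \<phi>(Inf K)))"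
        by (rule sum.subset_diff[OF _ fin(1)]) (auto simp: pN_def)
      finally have eq: "(\<Sum>(x,k)\<in>p. measure lborel k *\<^sub>R f x) - (\<phi> b - \<phi> a) =
          (\<Sum>(x,K)\<in>p - pN. measure lborel K *\<^sub>R f x - (\<phi>(Sup K) - \<phi>(Inf K))) +
          (\<Sum>(x,K)\<in>pN. measure lborel K *\<^sub>R f x - (\<phi>(Sup K) - \<phi>(Inf K)))" .
      show "norm ((\<Sum>(x,k)\<in>p. measure lborel k *\<^sub>R f x) - (\<phi> b - \<phi> a)) < e"
        unfolding eq by (rule order.strict_trans1[OF norm_triangle_ineq]) (use out inn e2 in linarith)
    qed
  qed
  then have "(f has_integral \<phi> b - \<phi> a) {a..b}" by simp
  then show ?thesis
    by (rule has_integral_spike[OF N, rotated]) (auto simp: f_def)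
qed

lemma abs_continuous_imp_continuous:
  assumes "abs_continuous_on_interval a b \<phi>"
  shows "continuous_on {a..b} \<phi>"
  unfolding continuous_on_iff
proof (intro ballI allI impI)
  fix x e :: real assume x: "x \<in> {a..b}" and "e > 0"
  then obtain \<delta> where "\<delta> > 0" and
    \<delta>: "\<And>(m::nat) p q. (\<forall>i<m. a \<le> p i \<and> p i \<le> q i \<and> q i \<le> b) \<Longrightarrow>
       disjoint_family_on (\<lambda>i. {p i<..<q i}) {..<m} \<Longrightarrow>
       (\<Sum>i<m. q i - p i) < \<delta> \<Longrightarrow> (\<Sum>i<m. norm (\<phi> (q i) - \<phi> (p i))) < e"
    using assms[unfolded abs_continuous_on_interval_def, rule_format, of e] by auto
  have D: "dist (\<phi> u) (\<phi> v) < e" if "u \<in> {a..b}" "v \<in> {a..b}" "u \<le> v" "v - u < \<delta>" for u v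
    using \<delta>[of "Suc 0" "\<lambda>_. u" "\<lambda>_. v"] that
    by (simp add: disjoint_family_on_def dist_norm norm_minus_commute)
  show "\<exists>d>0. \<forall>x'\<in>{a..b}. dist x' x < d \<longrightarrow> dist (\<phi> x') (\<phi> x) < e"
  proof (intro exI[of _ \<delta>] conjI ballI impI)
    fix x' assume x': "x' \<in> {a..b}" "dist x' x < \<delta>"
    show "dist (\<phi> x') (\<phi> x) < e"
    proof (cases "x' \<le> x")
      case True then show ?thesis using D[of x' x] x x' by (simp add: dist_real_def)
    next
      case False then show ?thesis using D[of x x'] x x' by (simp add: dist_real_def dist_commute)
    qed
  qed fact
qed

lemma abs_continuous_mono:
  assumes "abs_continuous_on_interval a b \<phi>" "a \<le> c" "d \<le> b"
  shows "abs_continuous_on_interval c d \<phi>"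
  unfolding abs_continuous_on_interval_def
proof (intro allI impI)
  fix e :: real assume "e > 0"
  then obtain \<delta> where "\<delta> > 0" and
    \<delta>: "\<And>(m::nat) p q. (\<forall>i<m. a \<le> p i \<and> p i \<le> q i \<and> q i \<le> b) \<Longrightarrow>
       disjoint_family_on (\<lambda>i. {p i<..<q i}) {..<m} \<Longrightarrow>
       (\<Sum>i<m. q i - p i) < \<delta> \<Longrightarrow> (\<Sum>i<m. norm (\<phi> (q i) - \<phi> (p i))) < e"
    using assms(1)[unfolded abs_continuous_on_interval_def, rule_format, of e] by auto
  then show "\<exists>\<delta>>0. \<forall>(N::nat) p q. (\<forall>i<N. c \<le> p i \<and> p i \<le> q i \<and> q i \<le> d) \<and>
      disjoint_family_on (\<lambda>i. {p i<..<q i}) {..<N} \<and> (\<Sum>i<N. q i - p i) < \<delta> \<longrightarrow>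
      (\<Sum>i<N. norm (\<phi> (q i) - \<phi> (p i))) < e"
    using assms(2,3) by (intro exI[of _ \<delta>]) (meson order_trans)
qed

lemma lipschitz_imp_abs_continuous:
  assumes "\<And>p q. a \<le> p \<Longrightarrow> p \<le> q \<Longrightarrow> q \<le> b \<Longrightarrow> norm (\<phi> q - \<phi> p) \<le> C * (q - p)"
  shows "abs_continuous_on_interval a b \<phi>"
  unfolding abs_continuous_on_interval_def
proof (intro allI impI)
  fix e :: real assume "e > 0"
  \<comment> \<open>\<open>C\<close> may be zero or negative; \<open>\<bar>C\<bar> + 1\<close> is a
    positive constant that dominates it.\<close>
  define \<delta> where "\<delta> = e / (\<bar>C\<bar> + 1)"
  have "\<delta> > 0" using \<open>e > 0\<close> by (simp add: \<delta>_def add_nonneg_pos)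
  moreover have "(\<Sum>i<N. norm (\<phi> (q i) - \<phi> (p i))) < e"
    if pq: "\<forall>i<N. a \<le> p i \<and> p i \<le> q i \<and> q i \<le> b" and s: "(\<Sum>i<N. q i - p i) < \<delta>" for N :: nat and p q
  proof -
    have "(\<Sum>i<N. norm (\<phi> (q i) - \<phi> (p i))) \<le> (\<Sum>i<N. (\<bar>C\<bar> + 1) * (q i - p i))"
    proof (rule sum_mono)
      fix i assume "i \<in> {..<N}"
      then have "norm (\<phi> (q i) - \<phi> (p i)) \<le> C * (q i - p i)" "p i \<le> q i" using pq assms by auto
      moreover have "C * (q i - p i) \<le> (\<bar>C\<bar> + 1) * (q i - p i)"
        using \<open>p i \<le> q i\<close> by (intro mult_right_mono) auto
      ultimately show "norm (\<phi> (q i) - \<phi> (p i)) \<le> (\<bar>C\<bar> + 1) * (q i - p i)" by linarith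
    qed
    also have "\<dots> = (\<bar>C\<bar> + 1) * (\<Sum>i<N. q i - p i)" by (rule sum_distrib_left[symmetric])
    also have "\<dots> < (\<bar>C\<bar> + 1) * \<delta>" using s by (intro mult_strict_left_mono) auto
    also have "\<dots> = e" by (simp add: \<delta>_def)
    finally show ?thesis .
  qed
  ultimately show "\<exists>\<delta>>0. \<forall>(N::nat) p q. (\<forall>i<N. a \<le> p i \<and> p i \<le> q i \<and> q i \<le> b) \<and>
      disjoint_family_on (\<lambda>i. {p i<..<q i}) {..<N} \<and> (\<Sum>i<N. q i - p i) < \<delta> \<longrightarrow>
      (\<Sum>i<N. norm (\<phi> (q i) - \<phi> (p i))) < e" by blast
qed

text \<open>Lebesgue differentiation in terms of averages over \<open>{x..x+h}\<close> concerns
  right-hand derivatives only. Clearing the quotient gives the increment form in which a two-sided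
  derivative can be assembled.\<close>

lemma right_derivative_integral:
  fixes f :: "real \<Rightarrow> real^'n"
  assumes "\<And>u v. f integrable_on {u..v}"
  obtains N where "negligible N"
    "\<And>x e. x \<notin> N \<Longrightarrow> 0 < e \<Longrightarrow> \<exists>d>0. \<forall>h. 0 < h \<and> h < d \<longrightarrow>
       norm (integral {x..x+h} f - h *\<^sub>R f x) \<le> e * h"
proof -
  obtain N where N: "negligible N" and
    D: "\<And>x e. x \<notin> N \<Longrightarrow> 0 < e \<Longrightarrow> \<exists>d>0. \<forall>h. 0 < h \<and> h < d \<longrightarrow>
         norm (integral (cbox x (x + h *\<^sub>R One)) f /\<^sub>R h ^ DIM(real) - f x) < e"
    using integrable_ccontinuous_explicit[of f] assms by (metis box_real(2))
  have "\<exists>d>0. \<forall>h. 0 < h \<and> h < d \<longrightarrow> norm (integral {x..x+h} f - h *\<^sub>R f x) \<le> e * h"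
    if x: "x \<notin> N" "0 < e" for x e
  proof -
    obtain d where d: "d > 0" "\<And>h. 0 < h \<Longrightarrow> h < d \<Longrightarrow> norm (integral {x..x+h} f /\<^sub>R h - f x) < e"
      using D[OF x] by auto
    have "norm (integral {x..x+h} f - h *\<^sub>R f x) \<le> e * h" if h: "0 < h" "h < d" for h
    proof -
      have "integral {x..x+h} f - h *\<^sub>R f x = h *\<^sub>R (integral {x..x+h} f /\<^sub>R h - f x)"
        using h by (simp add: scaleR_diff_right)
      then have "norm (integral {x..x+h} f - h *\<^sub>R f x) = h * norm (integral {x..x+h} f /\<^sub>R h - f x)"
        using h by (metis abs_of_pos norm_scaleR)
      then show ?thesis using d(2)[OF h] h by (simp add: mult.commute less_imp_le)
    qed
    with d(1) show ?thesis by blast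
  qed
  with N show thesis by (rule that)
qed

text \<open>The left-hand derivative at \<open>s\<close> is the right-hand derivative at
  \<open>- s\<close> for the reflected integrand. The exceptional set is therefore \<open>N1\<close>
  together with the mirror image of \<open>N2\<close>, which is again negligible.\<close>

lemma ae_has_vector_derivative_integral:
  fixes f :: "real \<Rightarrow> real^'n"
  assumes f: "f integrable_on {a..b}"
  shows "\<exists>N. negligible N \<and>
    (\<forall>s\<in>{a..b} - N. ((\<lambda>u. integral {a..u} f) has_vector_derivative f s) (at s within {a..b}))"
proof -
  \<comment> \<open>Extension by 0 makes the integrand integrable on every interval, including those
    that leave \<open>{a..b}\<close>.\<close>
  define g where "g r = (if r \<in> {a..b} then f r else 0)" for r
  have gi: "g integrable_on {u..v}" for u v
  proof -
    have "g integrable_on UNIV" using f unfolding g_def[abs_def] by (simp only: integrable_restrict_UNIV)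
    then show ?thesis using integrable_on_subinterval[of g UNIV u v] by simp
  qed
  have gmi: "(\<lambda>r. g (- r)) integrable_on {u..v}" for u v
    using Henstock_Kurzweil_Integration.integrable_reflect_real[of g "-u" "-v"] gi by simp
  obtain N1 where N1: "negligible N1" and
    R: "\<And>x e. x \<notin> N1 \<Longrightarrow> 0 < e \<Longrightarrow> \<exists>d>0. \<forall>h. 0 < h \<and> h < d \<longrightarrow>
       norm (integral {x..x+h} g - h *\<^sub>R g x) \<le> e * h"
    using right_derivative_integral[OF gi] by metis
  obtain N2 where N2: "negligible N2" and
    Lf: "\<And>x e. x \<notin> N2 \<Longrightarrow> 0 < e \<Longrightarrow> \<exists>d>0. \<forall>h. 0 < h \<and> h < d \<longrightarrow>
       norm (integral {x..x+h} (\<lambda>r. g (-r)) - h *\<^sub>R g (-x)) \<le> e * h"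
    using right_derivative_integral[OF gmi] by metis
  have "negligible (uminus ` N2)"
    using N2 by (intro negligible_differentiable_image_negligible linear_imp_differentiable_on) (auto simp: bounded_linear_minus[OF bounded_linear_ident, THEN bounded_linear.linear])
  then have N: "negligible (N1 \<union> uminus ` N2)" using N1 by simp
  have "((\<lambda>u. integral {a..u} f) has_vector_derivative f s) (at s within {a..b})"
    if s: "s \<in> {a..b} - (N1 \<union> uminus ` N2)" for s
    unfolding has_vector_derivative_def has_derivative_within_alt
  proof (intro conjI allI impI)
    show "bounded_linear (\<lambda>x. x *\<^sub>R f s)" by (rule bounded_linear_scaleR_left)
    fix e :: real assume "e > 0"
    have sN: "s \<notin> N1" "- s \<notin> N2" using s by force+
    obtain d1 where d1: "d1 > 0" "\<And>h. 0 < h \<Longrightarrow> h < d1 \<Longrightarrow> norm (integral {s..s+h} g - h *\<^sub>R g s) \<le> e * h"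
      using R[OF sN(1) \<open>e > 0\<close>] by auto
    obtain d2 where d2: "d2 > 0" "\<And>h. 0 < h \<Longrightarrow> h < d2 \<Longrightarrow> norm (integral {-s..-s+h} (\<lambda>r. g (-r)) - h *\<^sub>R g (s)) \<le> e * h"
      using Lf[OF sN(2) \<open>e > 0\<close>] by auto
    have gf: "integral {u..v} g = integral {u..v} f" if "a \<le> u" "v \<le> b" for u v
      using that by (intro integral_cong) (auto simp: g_def)
    have sub: "f integrable_on {u..v}" if "a \<le> u" "v \<le> b" for u v
      using integrable_on_subinterval[OF f, of u v] that by auto
    show "\<exists>d>0. \<forall>y\<in>{a..b}. norm (y - s) < d \<longrightarrow>
        norm (integral {a..y} f - integral {a..s} f - (y - s) *\<^sub>R f s) \<le> e * norm (y - s)"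
    proof (intro exI[of _ "min d1 d2"] conjI ballI impI)
      show "0 < min d1 d2" using d1 d2 by simp
      fix y assume y: "y \<in> {a..b}" "norm (y - s) < min d1 d2"
      consider "y = s" | "y > s" | "y < s" by linarith
      then show "norm (integral {a..y} f - integral {a..s} f - (y - s) *\<^sub>R f s) \<le> e * norm (y - s)"
      proof cases
        case 2
        have "integral {a..y} f = integral {a..s} f + integral {s..y} f"
          using Henstock_Kurzweil_Integration.integral_combine[of a s y f] sub[of a y] s y 2 by simp
        then show ?thesis using d1(2)[of "y - s"] 2 y s gf[of s y] by (simp add: g_def)
      next
        case 3
        have e1: "integral {a..s} f = integral {a..y} f + integral {y..s} f"
          using Henstock_Kurzweil_Integration.integral_combine[of a y s f] sub[of a s] s y 3 by simp
        have "integral {-s..-y} (\<lambda>r. g (-r)) = integral {y..s} g"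
          by (simp add: Henstock_Kurzweil_Integration.integral_reflect_real)
        then have "norm (integral {y..s} f - (s - y) *\<^sub>R f s) \<le> e * (s - y)"
          using d2(2)[of "s - y"] 3 y s gf[of y s] by (simp add: g_def)
        moreover have "integral {a..y} f - integral {a..s} f - (y - s) *\<^sub>R f s = - (integral {y..s} f - (s - y) *\<^sub>R f s)"
          unfolding e1 by (simp add: algebra_simps)
        moreover have "norm (y - s) = s - y" using 3 by simp
        ultimately show ?thesis by (simp only: norm_minus_cancel)
      qed simp
    qed
  qed
  with N show ?thesis by blast
qed

lemma AE_lebesgue_on_iff_negligible:
  "(AE s in lebesgue_on {a..b::real}. P s) \<longleftrightarrow> (\<exists>N. negligible N \<and> (\<forall>s\<in>{a..b} - N. P s))"
proof -
  have "(AE s in lebesgue_on {a..b}. P s) \<longleftrightarrow> (\<exists>N\<in>null_sets lebesgue. {s. \<not> (s \<in> {a..b} \<longrightarrow> P s)} \<subseteq> N)"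
    by (subst AE_restrict_space_iff) (simp_all add: eventually_ae_filter)
  also have "\<dots> \<longleftrightarrow> (\<exists>N. negligible N \<and> (\<forall>s\<in>{a..b} - N. P s))"
    unfolding negligible_iff_null_sets by blast
  finally show ?thesis .
qed

section \<open>Exponential weights and the Gronwall estimate\<close>

lemma exp_has_integral:
  fixes a c s :: real
  assumes "c \<noteq> 0" "a \<le> s"
  shows "((\<lambda>r. exp (c * (r - a))) has_integral (exp (c * (s - a)) - 1) / c) {a..s}"
proof -
  have "((\<lambda>r. exp (c * (r - a)) / c) has_vector_derivative exp (c * (r - a))) (at r within {a..s})" for r
    unfolding has_real_derivative_iff_has_vector_derivative[symmetric] using assms
    by (auto intro!: derivative_eq_intros)
  from fundamental_theorem_of_calculus[OF assms(2) this]
  show ?thesis by (simp only: diff_self mult_zero_right exp_zero diff_divide_distrib)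
qed

text \<open>Gronwall's inequality up to a factor of 2: evaluating the hypothesis where
  \<open>exp (- 2 * L * (s - a)) * e s\<close> is maximal, the integral term absorbs half of the maximum.\<close>

lemma gronwall_weak:
  fixes e :: "real \<Rightarrow> real"
  assumes L: "L > 0" and "A \<ge> 0" and e: "continuous_on {a..b} e"
    and le: "\<And>s. s \<in> {a..b} \<Longrightarrow> e s \<le> A + L * integral {a..s} e"
    and s: "s \<in> {a..b}"
  shows "e s \<le> 2 * A * exp (2 * L * (s - a))"
proof -
  define v where "v s = exp (- 2 * L * (s - a)) * e s" for s
  have "continuous_on {a..b} v" unfolding v_def by (intro continuous_intros e)
  then obtain s0 where s0: "s0 \<in> {a..b}" "\<And>r. r \<in> {a..b} \<Longrightarrow> v r \<le> v s0"
    using continuous_attains_sup[of "{a..b}" v] s by auto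
  define M where "M = v s0"
  have eM: "e r \<le> M * exp (2 * L * (r - a))" if "r \<in> {a..b}" for r
  proof -
    have "e r = v r * exp (2 * L * (r - a))" by (simp add: v_def exp_minus flip: exp_add)
    with s0(2)[OF that] show ?thesis by (simp add: M_def)
  qed
  have "integral {a..s0} e \<le> integral {a..s0} (\<lambda>r. M * exp (2 * L * (r - a)))"
  proof (rule integral_le)
    show "e integrable_on {a..s0}"
      using s0 by (intro integrable_continuous_interval continuous_on_subset[OF e]) auto
  qed (use s0 eM in \<open>auto intro!: integrable_continuous_interval continuous_intros\<close>)
  also have "\<dots> = M * ((exp (2 * L * (s0 - a)) - 1) / (2 * L))"
    using exp_has_integral[of "2*L" a s0] L s0 by (auto simp: integral_unique)
  finally have "e s0 \<le> A + M * (exp (2 * L * (s0 - a)) - 1) / 2"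
    using le[OF s0(1)] L by (auto simp: field_simps)
  moreover have "e s0 = M * exp (2 * L * (s0 - a))"
    by (simp add: M_def v_def exp_minus flip: exp_add)
  ultimately have *: "M * exp (2 * L * (s0 - a)) \<le> 2 * A - M"
    using right_diff_distrib[of M "exp (2 * L * (s0 - a))" 1] by linarith
  have "M \<le> 2 * A"
  proof (rule ccontr)
    assume "\<not> M \<le> 2 * A"
    then have "M > 0" using \<open>A \<ge> 0\<close> by simp
    then have "M * exp (2 * L * (s0 - a)) > 0" by simp
    with * \<open>\<not> M \<le> 2 * A\<close> show False by simp
  qed
  then have "M * exp (2 * L * (s - a)) \<le> 2 * A * exp (2 * L * (s - a))" by (intro mult_right_mono) auto
  with eM[OF s] show ?thesis by linarith
qed

section \<open>Controlled trajectories\<close>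

text \<open>Unlike \<open>controls\<close>, this imposes nothing outside the interval, so a control
  stays admissible on subintervals without being restricted.\<close>

definition admissible :: "(real^'m) set \<Rightarrow> real \<Rightarrow> real \<Rightarrow> (real \<Rightarrow> real^'m) \<Rightarrow> bool" where
  "admissible D a b d \<longleftrightarrow> d ` {a..b} \<subseteq> D \<and> d \<in> borel_measurable (lebesgue_on {a..b})"

text \<open>The right end point is a separate parameter, so that heads and tails of a solution are
  solutions again. Continuity of \<open>\<phi>\<close> is enough for the integral to exist under an
  admissible control, because the integrand is then bounded and measurable.\<close>

definition integral_solution ::
  "((real^'n) \<times> (real^'m) \<Rightarrow> (real^'n)) \<Rightarrow> real \<Rightarrow> real \<Rightarrow> (real \<Rightarrow> (real^'m)) \<Rightarrow> (real^'n) \<Rightarrow> (real \<Rightarrow> (real^'n)) \<Rightarrow> bool" where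
  "integral_solution F a b d x \<phi> \<longleftrightarrow> continuous_on {a..b} \<phi> \<and>
     (\<forall>s\<in>{a..b}. \<phi> s = x + integral {a..s} (\<lambda>r. F (\<phi> r, d r)))"

lemma admissible_mono:
  assumes "admissible D a b d" "{c..e} \<subseteq> {a..b}"
  shows "admissible D c e d"
  using assms measurable_restrict_mono[OF _ assms(2), of d lebesgue borel]
  unfolding admissible_def by blast

lemma controls_admissible: "d \<in> controls D t T \<Longrightarrow> admissible D t T d"
  by (auto simp: controls_def admissible_def)

lemma admissibleD: "admissible D a b d \<Longrightarrow> r \<in> {a..b} \<Longrightarrow> d r \<in> D"
  by (auto simp: admissible_def)

lemma integral_solution_start: "integral_solution F a b d x \<phi> \<Longrightarrow> a \<le> b \<Longrightarrow> \<phi> a = x"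
  by (auto simp: integral_solution_def)

text \<open>The integral does not see a null set of times. This absorbs the switching instant of a
  concatenated control.\<close>

lemma integral_solution_cong:
  assumes "integral_solution F a b d x \<phi>"
    and "\<And>s. s \<in> {a..b} \<Longrightarrow> \<phi> s = \<psi> s" and "negligible N" "\<And>s. s \<in> {a..b} - N \<Longrightarrow> d s = e s"
  shows "integral_solution F a b e x \<psi>"
  unfolding integral_solution_def
proof (intro conjI ballI)
  show "continuous_on {a..b} \<psi>"
    using assms(1,2) unfolding integral_solution_def by (blast intro: continuous_on_eq)
  fix s assume s: "s \<in> {a..b}"
  have "integral {a..s} (\<lambda>r. F (\<phi> r, d r)) = integral {a..s} (\<lambda>r. F (\<psi> r, e r))"
    using s assms(2,4) by (intro integral_spike[OF assms(3)]) auto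
  then show "\<psi> s = x + integral {a..s} (\<lambda>r. F (\<psi> r, e r))"
    using assms(1,2) s by (auto simp: integral_solution_def)
qed

text \<open>\<open>K\<close> and \<open>L\<close> together give the growth bound
  \<open>K + L * norm x\<close>. Strict positivity of \<open>L\<close> allows division by it and its
  use as the rate of exponential weights.\<close>

locale control_system =
  fixes F :: "(real^'n) \<times> (real^'m) \<Rightarrow> (real^'n)" and D :: "(real^'m) set" and L K :: real
  assumes D_compact: "compact D" and D_nonempty: "D \<noteq> {}"
    and F_continuous: "continuous_on (UNIV \<times> D) F"
    and L_pos: "L > 0" and K_nonneg: "K \<ge> 0"
    and F_lipschitz: "\<And>d x y. d \<in> D \<Longrightarrow> norm (F (x, d) - F (y, d)) \<le> L * norm (x - y)"
    and F_origin: "\<And>d. d \<in> D \<Longrightarrow> norm (F (0, d)) \<le> K"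
begin

section \<open>A priori estimates for solutions of the integral equation\<close>

lemma F_growth: "d \<in> D \<Longrightarrow> norm (F (x, d)) \<le> K + L * norm x"
  using F_lipschitz[of d x 0] F_origin[of d] norm_triangle_sub[of "F (x, d)" "F (0, d)"] by simp

text \<open>\<open>F\<close> is continuous only on \<open>UNIV \<times> D\<close>, so the
  composition passes through the Borel sets restricted to that product; an admissible control keeps
  the pair inside it.\<close>

lemma F_measurable:
  assumes "continuous_on {a..b} \<phi>" "admissible D a b d"
  shows "(\<lambda>r. F (\<phi> r, d r)) \<in> borel_measurable (lebesgue_on {a..b})"
proof -
  have phi: "\<phi> \<in> borel_measurable (lebesgue_on {a..b})"
    using assms(1) by (intro continuous_imp_measurable_on_sets_lebesgue) auto
  have "(\<lambda>r. (\<phi> r, d r)) \<in> borel_measurable (lebesgue_on {a..b})"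
    using phi assms(2) by (intro borel_measurable_Pair) (auto simp: admissible_def)
  then have "(\<lambda>r. (\<phi> r, d r)) \<in> measurable (lebesgue_on {a..b}) (restrict_space borel (UNIV \<times> D))"
    using assms(2) by (intro measurable_restrict_space2) (auto simp: admissible_def)
  moreover have "F \<in> borel_measurable (restrict_space borel (UNIV \<times> D))"
    by (rule borel_measurable_continuous_on_restrict[OF F_continuous])
  ultimately show ?thesis by (rule measurable_compose)
qed

lemma F_integrable:
  assumes "continuous_on {a..b} \<phi>" "admissible D a b d"
  shows "(\<lambda>r. F (\<phi> r, d r)) integrable_on {a..b}"
proof -
  have "bounded (\<phi> ` {a..b})" using assms(1) by (intro compact_imp_bounded compact_continuous_image) auto
  then obtain B where B: "\<And>r. r \<in> {a..b} \<Longrightarrow> norm (\<phi> r) \<le> B" by (metis bounded_iff imageI)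
  have "norm (F (\<phi> r, d r)) \<le> K + L * B" if "r \<in> {a..b}" for r
  proof -
    have "d r \<in> D" using assms(2) that by (auto simp: admissible_def)
    moreover have "L * norm (\<phi> r) \<le> L * B" using B[OF that] L_pos by simp
    ultimately show ?thesis using F_growth[of "d r" "\<phi> r"] by linarith
  qed
  then show ?thesis
    by (intro measurable_bounded_by_integrable_imp_integrable[OF F_measurable[OF assms], of "\<lambda>_. K + L * B"]) auto
qed

lemma F_integrable_sub:
  assumes "continuous_on {a..b} \<phi>" "admissible D a b d" "a \<le> u" "v \<le> b"
  shows "(\<lambda>r. F (\<phi> r, d r)) integrable_on {u..v}"
  using integrable_on_subinterval[OF F_integrable[OF assms(1,2)], of u v] assms(3,4) by auto

lemma integral_solution_increment:
  assumes sol: "integral_solution F a b d x \<phi>" and d: "admissible D a b d" and "a \<le> u" "u \<le> v" "v \<le> b"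
  shows "\<phi> v - \<phi> u = integral {u..v} (\<lambda>r. F (\<phi> r, d r))"
proof -
  have "continuous_on {a..b} \<phi>" using sol by (simp add: integral_solution_def)
  then have "integral {a..v} (\<lambda>r. F (\<phi> r, d r)) = integral {a..u} (\<lambda>r. F (\<phi> r, d r)) + integral {u..v} (\<lambda>r. F (\<phi> r, d r))"
    using Henstock_Kurzweil_Integration.integral_combine[of a u v "\<lambda>r. F (\<phi> r, d r)"] F_integrable_sub[OF _ d, of \<phi> a v] assms by simp
  moreover have "\<phi> u = x + integral {a..u} (\<lambda>r. F (\<phi> r, d r))" "\<phi> v = x + integral {a..v} (\<lambda>r. F (\<phi> r, d r))"
    using sol assms(3-5) by (auto simp: integral_solution_def)
  ultimately show ?thesis by simp
qed

lemma integral_solution_tail: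
  assumes sol: "integral_solution F a b d x \<phi>" and d: "admissible D a b d" and "a \<le> c"
  shows "integral_solution F c b d (\<phi> c) \<phi>"
  unfolding integral_solution_def
proof (intro conjI ballI)
  show "continuous_on {c..b} \<phi>"
    using sol assms(3) by (auto simp: integral_solution_def intro: continuous_on_subset)
  show "\<phi> s = \<phi> c + integral {c..s} (\<lambda>r. F (\<phi> r, d r))" if "s \<in> {c..b}" for s
    using integral_solution_increment[OF sol d, of c s] assms(3) that by (simp add: algebra_simps)
qed

lemma integral_solution_head:
  assumes "integral_solution F a b d x \<phi>" "c \<le> b"
  shows "integral_solution F a c d x \<phi>"
  using assms by (auto simp: integral_solution_def intro: continuous_on_subset)

text \<open>Both solutions follow the same control, so the Lipschitz bound in the state applies at
  each time and Gronwall finishes. For \<open>x = y\<close> the bound is 0, which is uniqueness; the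
  factor 2 costs nothing there.\<close>

lemma integral_solution_dist:
  assumes sx: "integral_solution F a b d x \<phi>" and sy: "integral_solution F a b d y \<psi>"
    and d: "admissible D a b d" and s: "s \<in> {a..b}"
  shows "norm (\<phi> s - \<psi> s) \<le> 2 * norm (x - y) * exp (2 * L * (s - a))"
proof (rule gronwall_weak[OF L_pos _ _ _ s])
  have c: "continuous_on {a..b} \<phi>" "continuous_on {a..b} \<psi>" using sx sy by (auto simp: integral_solution_def)
  then show ce: "continuous_on {a..b} (\<lambda>s. norm (\<phi> s - \<psi> s))" by (intro continuous_intros)
  fix s assume s: "s \<in> {a..b}"
  have i: "(\<lambda>r. F (\<phi> r, d r)) integrable_on {a..s}" "(\<lambda>r. F (\<psi> r, d r)) integrable_on {a..s}"
    using F_integrable_sub[OF _ d] c s by auto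
  have "\<phi> s - \<psi> s = x - y + integral {a..s} (\<lambda>r. F (\<phi> r, d r) - F (\<psi> r, d r))"
    using sx sy s i by (auto simp: integral_solution_def Henstock_Kurzweil_Integration.integral_diff)
  then have "norm (\<phi> s - \<psi> s) \<le> norm (x - y) + norm (integral {a..s} (\<lambda>r. F (\<phi> r, d r) - F (\<psi> r, d r)))"
    by (simp only: norm_triangle_ineq)
  also have "norm (integral {a..s} (\<lambda>r. F (\<phi> r, d r) - F (\<psi> r, d r))) \<le> integral {a..s} (\<lambda>r. L * norm (\<phi> r - \<psi> r))"
  proof (rule integral_norm_bound_integral)
    show "(\<lambda>r. F (\<phi> r, d r) - F (\<psi> r, d r)) integrable_on {a..s}" using i by (rule Henstock_Kurzweil_Integration.integrable_diff)
    show "(\<lambda>r. L * norm (\<phi> r - \<psi> r)) integrable_on {a..s}"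
      using s by (intro integrable_continuous_interval continuous_on_mult_left continuous_on_subset[OF ce]) auto
    show "norm (F (\<phi> r, d r) - F (\<psi> r, d r)) \<le> L * norm (\<phi> r - \<psi> r)" if "r \<in> {a..s}" for r
      using that s by (intro F_lipschitz admissibleD[OF d]) auto
  qed
  finally show "norm (\<phi> s - \<psi> s) \<le> norm (x - y) + L * integral {a..s} (\<lambda>r. norm (\<phi> r - \<psi> r))" by simp
qed simp

lemma integral_solution_unique:
  assumes "integral_solution F a b d x \<phi>" "integral_solution F a b d x \<psi>" "admissible D a b d" "s \<in> {a..b}"
  shows "\<phi> s = \<psi> s"
  using integral_solution_dist[OF assms] by simp

text \<open>Linear growth is fed into Gronwall. The inhomogeneous part \<open>K * (s - a)\<close> is
  majorized by \<open>K * (b - a)\<close>, because the constant there must not depend on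
  \<open>s\<close>.\<close>

lemma integral_solution_bound:
  assumes sx: "integral_solution F a b d x \<phi>" and d: "admissible D a b d" and s: "s \<in> {a..b}"
  shows "norm (\<phi> s) \<le> 2 * (norm x + K * (b - a)) * exp (2 * L * (s - a))"
proof (rule gronwall_weak[OF L_pos _ _ _ s])
  have c: "continuous_on {a..b} \<phi>" using sx by (auto simp: integral_solution_def)
  then show ce: "continuous_on {a..b} (\<lambda>s. norm (\<phi> s))" by (intro continuous_intros)
  show "norm x + K * (b - a) \<ge> 0" using s K_nonneg by simp
  fix s assume s: "s \<in> {a..b}"
  have ci: "(\<lambda>r. norm (\<phi> r)) integrable_on {a..s}"
    using s ce by (intro integrable_continuous_interval) (auto intro: continuous_on_subset)
  have "norm (\<phi> s) \<le> norm x + norm (integral {a..s} (\<lambda>r. F (\<phi> r, d r)))"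
    using sx s by (auto simp: integral_solution_def intro: norm_triangle_ineq)
  also have "norm (integral {a..s} (\<lambda>r. F (\<phi> r, d r))) \<le> integral {a..s} (\<lambda>r. K + L * norm (\<phi> r))"
  proof (rule integral_norm_bound_integral)
    show "(\<lambda>r. F (\<phi> r, d r)) integrable_on {a..s}" using F_integrable_sub[OF c d] s by auto
    show "(\<lambda>r. K + L * norm (\<phi> r)) integrable_on {a..s}"
      using s by (intro integrable_continuous_interval continuous_on_add continuous_on_const
        continuous_on_mult_left continuous_on_subset[OF ce]) auto
    show "norm (F (\<phi> r, d r)) \<le> K + L * norm (\<phi> r)" if "r \<in> {a..s}" for r
      using that s by (intro F_growth admissibleD[OF d]) auto
  qed
  also have "\<dots> = K * (s - a) + L * integral {a..s} (\<lambda>r. norm (\<phi> r))"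
    using s ci by (subst Henstock_Kurzweil_Integration.integral_add) (auto simp: mult.commute intro: integrable_on_mult_right)
  also have "K * (s - a) \<le> K * (b - a)" using s K_nonneg by (intro mult_left_mono) auto
  finally show "norm (\<phi> s) \<le> norm x + K * (b - a) + L * integral {a..s} (\<lambda>r. norm (\<phi> r))" by simp
qed

text \<open>A bound on the states bounds the velocity. This yields both absolute continuity of
  solutions and finite speed of propagation.\<close>

lemma integral_solution_speed:
  assumes sx: "integral_solution F a b d x \<phi>" and d: "admissible D a b d" and uv: "a \<le> u" "u \<le> v" "v \<le> b"
    and C: "\<And>r. r \<in> {u..v} \<Longrightarrow> norm (\<phi> r) \<le> B"
  shows "norm (\<phi> v - \<phi> u) \<le> (K + L * B) * (v - u)"
proof -
  have c: "continuous_on {a..b} \<phi>" using sx by (auto simp: integral_solution_def)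
  have "norm (integral {u..v} (\<lambda>r. F (\<phi> r, d r))) \<le> integral {u..v} (\<lambda>r. K + L * B)"
  proof (rule integral_norm_bound_integral)
    show "(\<lambda>r. F (\<phi> r, d r)) integrable_on {u..v}" using F_integrable_sub[OF c d] uv by auto
    fix r assume r: "r \<in> {u..v}"
    have "norm (F (\<phi> r, d r)) \<le> K + L * norm (\<phi> r)"
      using r uv by (intro F_growth admissibleD[OF d]) auto
    moreover have "L * norm (\<phi> r) \<le> L * B" using C[OF r] L_pos by simp
    ultimately show "norm (F (\<phi> r, d r)) \<le> K + L * B" by linarith
  qed auto
  then show ?thesis using integral_solution_increment[OF sx d uv] uv by (simp add: mult.commute)
qed

lemma integral_solution_iff_trajectory:
  assumes "t \<le> T" and d: "admissible D t T d"
  shows "is_trajectory F T x t d \<phi> \<longleftrightarrow> integral_solution F t T d x \<phi>"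
proof
  assume tr: "is_trajectory F T x t d \<phi>"
  then have ac: "abs_continuous_on_interval t T \<phi>" and x: "\<phi> t = x" by (auto simp: is_trajectory_def)
  obtain N where neg: "negligible N"
    and N: "\<And>s. s \<in> {t..T} - N \<Longrightarrow> (\<phi> has_vector_derivative F (\<phi> s, d s)) (at s within {t..T})"
    using tr unfolding is_trajectory_def AE_lebesgue_on_iff_negligible by blast
  show "integral_solution F t T d x \<phi>"
    unfolding integral_solution_def
  proof (intro conjI ballI)
    show "continuous_on {t..T} \<phi>" using ac by (rule abs_continuous_imp_continuous)
    fix s assume s: "s \<in> {t..T}"
    have "((\<lambda>r. F (\<phi> r, d r)) has_integral \<phi> s - \<phi> t) {t..s}"
    proof (rule has_integral_derivative_abs_continuous[OF _ _ neg])
      show "abs_continuous_on_interval t s \<phi>" using abs_continuous_mono[OF ac] s by auto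
      show "(\<phi> has_vector_derivative F (\<phi> r, d r)) (at r within {t..s})" if "r \<in> {t..s} - N" for r
        using N[of r] s that by (auto intro: has_vector_derivative_within_subset)
    qed (use s in auto)
    then show "\<phi> s = x + integral {t..s} (\<lambda>r. F (\<phi> r, d r))" using x by (simp add: integral_unique)
  qed
next
  assume sol: "integral_solution F t T d x \<phi>"
  then have c: "continuous_on {t..T} \<phi>" by (simp add: integral_solution_def)
  then have "bounded (\<phi> ` {t..T})" by (intro compact_imp_bounded compact_continuous_image) auto
  then obtain B where B: "\<And>r. r \<in> {t..T} \<Longrightarrow> norm (\<phi> r) \<le> B" by (metis bounded_iff imageI)
  have ac: "abs_continuous_on_interval t T \<phi>"
    by (rule lipschitz_imp_abs_continuous[of _ _ _ "K + L * B"], rule integral_solution_speed[OF sol d]) (auto intro: B)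
  obtain N where N: "negligible N"
    "\<And>s. s \<in> {t..T} - N \<Longrightarrow> ((\<lambda>u. integral {t..u} (\<lambda>r. F (\<phi> r, d r))) has_vector_derivative F (\<phi> s, d s)) (at s within {t..T})"
    using ae_has_vector_derivative_integral[OF F_integrable[OF c d]] by blast
  have "(\<phi> has_vector_derivative F (\<phi> s, d s)) (at s within {t..T})" if s: "s \<in> {t..T} - N" for s
  proof -
    have "((\<lambda>u. x + integral {t..u} (\<lambda>r. F (\<phi> r, d r))) has_vector_derivative 0 + F (\<phi> s, d s)) (at s within {t..T})"
      by (intro has_vector_derivative_add N(2)[OF s] has_vector_derivative_const)
    then have "((\<lambda>u. x + integral {t..u} (\<lambda>r. F (\<phi> r, d r))) has_vector_derivative F (\<phi> s, d s)) (at s within {t..T})"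
      by simp
    then show ?thesis
      by (rule has_vector_derivative_transform[rotated 2]) (use s sol in \<open>auto simp: integral_solution_def\<close>)
  qed
  then show "is_trajectory F T x t d \<phi>"
    using ac integral_solution_start[OF sol \<open>t \<le> T\<close>] N(1)
    unfolding is_trajectory_def AE_lebesgue_on_iff_negligible by blast
qed

section \<open>Existence of trajectories by a contraction argument\<close>

lemma integral_solution_exists:
  assumes ab: "a \<le> b" and d: "admissible D a b d"
  obtains \<phi> where "integral_solution F a b d x \<phi>"
proof -
  \<comment> \<open>Bounded continuous functions are taken on the whole line; clamping the time to
    \<open>{a..b}\<close> extends the image of the Picard operator by constants.\<close>
  define c where "c s = max a (min b s)" for s
  have c: "c s \<in> {a..b}" "s \<in> {a..b} \<Longrightarrow> c s = s" for s using ab by (auto simp: c_def)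
  text \<open>The weight \<open>exp (- 2 * L * (s - a))\<close> makes the Picard operator a contraction on the whole interval.\<close>
  define I where "I (\<psi> :: real \<Rightarrow>\<^sub>C (real^'n)) s = integral {a..s} (\<lambda>r. F (exp (2 * L * (r - a)) *\<^sub>R \<psi> r, d r))" for \<psi> s
  define P where "P \<psi> s = exp (- (2 * L * (s - a))) *\<^sub>R (x + I \<psi> s)" for \<psi> s
  have cont: "continuous_on {a..b} (\<lambda>r. exp (2 * L * (r - a)) *\<^sub>R apply_bcontfun \<psi> r)" for \<psi> :: "real \<Rightarrow>\<^sub>C (real^'n)"
  proof (rule continuous_on_scaleR)
    show "continuous_on {a..b} (\<lambda>r. exp (2 * L * (r - a)))" by (intro continuous_intros)
    show "continuous_on {a..b} (\<lambda>r. apply_bcontfun \<psi> r)" by (rule continuous_on_apply_bcontfun)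
  qed
  have int: "(\<lambda>r. F (exp (2 * L * (r - a)) *\<^sub>R apply_bcontfun \<psi> r, d r)) integrable_on {a..s}" if "s \<le> b" for \<psi> s
    using F_integrable_sub[OF cont d, of a s] that by simp
  have Pc: "continuous_on {a..b} (P \<psi>)" for \<psi>
    unfolding P_def I_def
    by (intro continuous_intros indefinite_integral_continuous_1 int order_refl)
  have Pb: "(\<lambda>s. P \<psi> (c s)) \<in> bcontfun" for \<psi>
  proof -
    have "continuous_on UNIV c" unfolding c_def by (intro continuous_intros)
    then have "continuous_on UNIV (\<lambda>s. P \<psi> (c s))"
      using c(1) by (intro continuous_on_compose2[OF Pc]) auto
    moreover have "bounded (range (\<lambda>s. P \<psi> (c s)))"
    proof (rule bounded_subset)
      show "bounded (P \<psi> ` {a..b})" using Pc by (intro compact_imp_bounded compact_continuous_image) auto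
      show "range (\<lambda>s. P \<psi> (c s)) \<subseteq> P \<psi> ` {a..b}" using c(1) by blast
    qed
    ultimately show ?thesis by (simp add: bcontfun_def)
  qed
  define Q where "Q \<psi> = Bcontfun (\<lambda>s. P \<psi> (c s))" for \<psi>
  have Q: "apply_bcontfun (Q \<psi>) s = P \<psi> (c s)" for \<psi> s
    unfolding Q_def using Bcontfun_inverse[OF Pb] by simp
  \<comment> \<open>The unknown \<open>\<psi>\<close> is the solution divided by the weight, so the
    plain supremum norm acts as a weighted one. The factor \<open>1/2\<close> is
    \<open>L / (2 * L)\<close>: integrating the weight gains \<open>1 / (2 * L)\<close> against the
    Lipschitz constant.\<close>
  have contr: "dist (P \<psi> s) (P \<xi> s) \<le> 1/2 * dist \<psi> \<xi>" if s: "s \<in> {a..b}" for \<psi> \<xi> s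
  proof -
    have "norm (I \<psi> s - I \<xi> s) = norm (integral {a..s} (\<lambda>r. F (exp (2 * L * (r - a)) *\<^sub>R \<psi> r, d r) - F (exp (2 * L * (r - a)) *\<^sub>R \<xi> r, d r)))"
      unfolding I_def using int s by (subst Henstock_Kurzweil_Integration.integral_diff) auto
    also have "\<dots> \<le> integral {a..s} (\<lambda>r. (L * dist \<psi> \<xi>) * exp (2 * L * (r - a)))"
    proof (rule integral_norm_bound_integral)
      show "(\<lambda>r. F (exp (2 * L * (r - a)) *\<^sub>R \<psi> r, d r) - F (exp (2 * L * (r - a)) *\<^sub>R \<xi> r, d r)) integrable_on {a..s}"
        using int s by (intro Henstock_Kurzweil_Integration.integrable_diff) auto
      show "(\<lambda>r. (L * dist \<psi> \<xi>) * exp (2 * L * (r - a))) integrable_on {a..s}"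
        by (intro integrable_continuous_interval continuous_intros)
      fix r assume r: "r \<in> {a..s}"
      have "norm (F (exp (2 * L * (r - a)) *\<^sub>R \<psi> r, d r) - F (exp (2 * L * (r - a)) *\<^sub>R \<xi> r, d r))
        \<le> L * norm (exp (2 * L * (r - a)) *\<^sub>R \<psi> r - exp (2 * L * (r - a)) *\<^sub>R \<xi> r)"
        using r s by (intro F_lipschitz admissibleD[OF d]) auto
      also have "\<dots> = L * (exp (2 * L * (r - a)) * norm (\<psi> r - \<xi> r))"
        by (simp flip: scaleR_diff_right)
      also have "\<dots> \<le> L * (exp (2 * L * (r - a)) * dist \<psi> \<xi>)"
        using L_pos dist_bounded[of \<psi> r \<xi>] by (intro mult_left_mono) (auto simp: dist_norm)
      finally show "norm (F (exp (2 * L * (r - a)) *\<^sub>R \<psi> r, d r) - F (exp (2 * L * (r - a)) *\<^sub>R \<xi> r, d r))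
        \<le> (L * dist \<psi> \<xi>) * exp (2 * L * (r - a))" by (simp add: mult_ac)
    qed
    also have "\<dots> = L * dist \<psi> \<xi> * ((exp (2 * L * (s - a)) - 1) / (2 * L))"
      using exp_has_integral[of "2 * L" a s] L_pos s by (auto simp: integral_unique)
    also have "\<dots> = dist \<psi> \<xi> * (exp (2 * L * (s - a)) - 1) / 2" using L_pos by simp
    also have "\<dots> \<le> dist \<psi> \<xi> / 2 * exp (2 * L * (s - a))" by (simp add: field_simps)
    finally have I: "norm (I \<psi> s - I \<xi> s) \<le> dist \<psi> \<xi> / 2 * exp (2 * L * (s - a))" .
    have "dist (P \<psi> s) (P \<xi> s) = exp (- (2 * L * (s - a))) * norm (I \<psi> s - I \<xi> s)"
      by (simp add: P_def dist_norm flip: scaleR_diff_right)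
    also have "\<dots> \<le> exp (- (2 * L * (s - a))) * (dist \<psi> \<xi> / 2 * exp (2 * L * (s - a)))"
      using I by (intro mult_left_mono) auto
    also have "\<dots> = 1/2 * dist \<psi> \<xi>" by (simp add: exp_minus)
    finally show ?thesis .
  qed
  have "\<exists>!\<psi>. Q \<psi> = \<psi>"
  proof (rule banach_fix_type)
    show "\<forall>\<psi> \<xi>. dist (Q \<psi>) (Q \<xi>) \<le> 1/2 * dist \<psi> \<xi>"
      using contr c(1) by (intro allI dist_bound) (simp only: Q)
  qed auto
  then obtain \<psi> where \<psi>: "Q \<psi> = \<psi>" by blast
  have "integral_solution F a b d x (\<lambda>r. exp (2 * L * (r - a)) *\<^sub>R \<psi> r)"
    unfolding integral_solution_def
  proof (intro conjI ballI)
    show "continuous_on {a..b} (\<lambda>r. exp (2 * L * (r - a)) *\<^sub>R apply_bcontfun \<psi> r)" by (rule cont)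
    fix s assume s: "s \<in> {a..b}"
    have "apply_bcontfun \<psi> s = P \<psi> s" using Q[of \<psi> s] \<psi> c(2)[OF s] by simp
    then show "exp (2 * L * (s - a)) *\<^sub>R \<psi> s = x + integral {a..s} (\<lambda>r. F (exp (2 * L * (r - a)) *\<^sub>R \<psi> r, d r))"
      by (simp add: P_def I_def flip: exp_add)
  qed
  then show thesis by (rule that)
qed

text \<open>The definite description denotes: uniqueness fixes a solution inside
  \<open>{t..T}\<close>, and extensionality fixes it outside.\<close>

lemma trajectory_integral_solution:
  assumes "t \<le> T" and d: "admissible D t T d"
  shows "integral_solution F t T d x (trajectory F T x t d)"
proof -
  obtain \<phi> where sol: "integral_solution F t T d x \<phi>" using integral_solution_exists[OF assms] .
  let ?\<phi> = "restrict \<phi> {t..T}"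
  have sol': "integral_solution F t T d x ?\<phi>"
    by (rule integral_solution_cong[OF sol, of _ "{}"]) auto
  have "trajectory F T x t d = ?\<phi>"
    unfolding trajectory_def
  proof (rule the_equality)
    show "?\<phi> \<in> extensional {t..T} \<and> is_trajectory F T x t d ?\<phi>"
      using sol' integral_solution_iff_trajectory[OF assms] by auto
    fix \<psi> assume \<psi>: "\<psi> \<in> extensional {t..T} \<and> is_trajectory F T x t d \<psi>"
    then have "integral_solution F t T d x \<psi>" using integral_solution_iff_trajectory[OF assms] by auto
    then show "\<psi> = ?\<phi>" using \<psi> integral_solution_unique[OF _ sol' d]
      by (intro extensionalityI[of _ "{t..T}"]) auto
  qed
  with sol' show ?thesis by simp
qed

end

section \<open>Test functions\<close>

text \<open>\<open>time_deriv\<close> and \<open>space_grad\<close> are defined on slices, while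
  smoothness provides one linear map within \<open>space_time T\<close>. Restricting that map to the
  directions \<open>(0, 1)\<close> and \<open>(v, 0)\<close> identifies the two. With
  \<open>T > 0\<close> the derivative within \<open>{0..T}\<close> is unique even at the end points,
  where it is one-sided.\<close>

lemma test_function_derivative:
  fixes \<psi> :: "(real^'n) \<times> real \<Rightarrow> real"
  assumes "T > 0" "t \<in> {0..T}" and der: "(\<psi> has_derivative \<psi>') (at (x, t) within space_time T)"
  shows "\<psi>' (v, q) = space_grad \<psi> (x, t) \<bullet> v + time_deriv T \<psi> (x, t) * q"
proof -
  have lin: "linear \<psi>'" using der has_derivative_linear by blast
  have time: "time_deriv T \<psi> (x, t) = \<psi>' (0, 1)"
  proof -
    have "((\<lambda>s. \<psi> (x, s)) has_derivative (\<lambda>q. \<psi>' (0, q))) (at t within {0..T})"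
      by (rule has_derivative_in_compose[where f = "\<lambda>s. (x, s)" and g = \<psi>])
        (auto intro!: derivative_eq_intros has_derivative_subset[OF der])
    moreover have "q *\<^sub>R \<psi>' (0, 1) = \<psi>' (0, q)" for q
      using linear_scale[OF lin, of q "(0, 1)"] by simp
    then have "(\<lambda>q. q *\<^sub>R \<psi>' (0, 1)) = (\<lambda>q. \<psi>' (0, q))" by (rule ext)
    ultimately have "((\<lambda>s. \<psi> (x, s)) has_vector_derivative \<psi>' (0, 1)) (at t within {0..T})"
      by (simp only: has_vector_derivative_def)
    then show ?thesis using assms(1,2)
      by (simp add: time_deriv_def vector_derivative_within_cbox[of 0 T t, simplified])
  qed
  have space: "space_grad \<psi> (x, t) \<bullet> v = \<psi>' (v, 0)" for v
  proof -
    define g where "g v = \<psi>' (v, 0)" for v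
    have "linear g" unfolding g_def
      by (rule linear_compose[of "\<lambda>v. (v, 0)" \<psi>', unfolded o_def, OF _ lin]) (auto intro!: linearI)
    \<comment> \<open>\<open>adjoint g 1\<close> is the Riesz representative of the functional
      \<open>g\<close>, hence the gradient.\<close>
    then have gp: "g v = v \<bullet> adjoint g 1" for v using adjoint_works[of g v 1] by simp
    have "((\<lambda>y. \<psi> (y, t)) has_derivative g) (at x)"
      unfolding g_def using assms(2)
      by (intro has_derivative_in_compose[where f = "\<lambda>y. (y, t)" and g = \<psi> and s = UNIV])
        (auto intro!: derivative_eq_intros has_derivative_subset[OF der])
    then have G: "GDERIV (\<lambda>y. \<psi> (y, t)) x :> adjoint g 1"
      by (simp add: gderiv_def gp[symmetric])
    have "space_grad \<psi> (x, t) = adjoint g 1"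
      unfolding space_grad_def prod.case
    proof (rule the_equality[where P = "\<lambda>p. GDERIV (\<lambda>y. \<psi> (y, t)) x :> p", OF G])
      fix p assume "GDERIV (\<lambda>y. \<psi> (y, t)) x :> p"
      then have "(\<lambda>h. h \<bullet> p) = (\<lambda>h. h \<bullet> adjoint g 1)"
        using G unfolding gderiv_def by (rule has_derivative_unique)
      then show "p = adjoint g 1" using vector_eq_ldot[of p "adjoint g 1"] by metis
    qed
    then show ?thesis using gp[of v] by (simp add: g_def inner_commute)
  qed
  have "\<psi>' (v, q) = \<psi>' (v, 0) + q *\<^sub>R \<psi>' (0, 1)"
    using linear_add[OF lin, of "(v, 0)" "(0, q)"] linear_scale[OF lin, of q "(0, 1)"] by simp
  then show ?thesis by (simp add: space time)
qed

lemma C_infinity_on_expansion: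
  fixes \<psi> :: "(real^'n) \<times> real \<Rightarrow> real"
  assumes "C_infinity_on (space_time T) \<psi>" "T > 0" "t \<in> {0..T}" "e > 0"
  obtains \<delta> where "\<delta> > 0" "\<And>y s. s \<in> {0..T} \<Longrightarrow> norm (y - x, s - t) < \<delta> \<Longrightarrow>
    \<bar>\<psi> (y, s) - \<psi> (x, t) - (space_grad \<psi> (x, t) \<bullet> (y - x) + time_deriv T \<psi> (x, t) * (s - t))\<bar>
      \<le> e * norm (y - x, s - t)"
proof -
  have "C_k_on (Suc 0) (space_time T) \<psi>" using assms(1) by (simp add: C_infinity_on_def)
  then obtain \<psi>' where "\<forall>z\<in>space_time T. (\<psi> has_derivative \<psi>' z) (at z within space_time T)" by auto
  then have der: "(\<psi> has_derivative \<psi>' (x, t)) (at (x, t) within space_time T)" using assms(3) by auto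
  then obtain \<delta> where \<delta>: "\<delta> > 0" "\<And>z. z \<in> space_time T \<Longrightarrow> norm (z - (x, t)) < \<delta> \<Longrightarrow>
     norm (\<psi> z - \<psi> (x, t) - \<psi>' (x, t) (z - (x, t))) \<le> e * norm (z - (x, t))"
    unfolding has_derivative_within_alt using \<open>e > 0\<close> by blast
  show thesis
  proof (rule that[OF \<delta>(1)])
    fix y s assume "s \<in> {0..T}" "norm (y - x, s - t) < \<delta>"
    then show "\<bar>\<psi> (y, s) - \<psi> (x, t) - (space_grad \<psi> (x, t) \<bullet> (y - x) + time_deriv T \<psi> (x, t) * (s - t))\<bar>
      \<le> e * norm (y - x, s - t)"
      using \<delta>(2)[of "(y, s)"] test_function_derivative[OF assms(2,3) der, of "y - x" "s - t"] by simp
  qed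
qed

section \<open>Dynamic programming\<close>

lemma concatenation_in_controls:
  fixes d1 d2 :: "real \<Rightarrow> real^'m"
  assumes "d1 \<in> controls D t T" "d2 \<in> controls D t' T" "t \<le> t'"
  shows "(\<lambda>s\<in>{t..T}. if s < t' then d1 s else d2 s) \<in> controls D t T"
proof -
  \<comment> \<open>Both controls are extended by 0 to the line, where a case split at
    \<open>t'\<close> preserves measurability; on \<open>{t..T}\<close> this is the
    concatenation.\<close>
  let ?e = "\<lambda>s. if s < t' then (if s \<in> {t..T} then d1 s else 0) else (if s \<in> {t'..T} then d2 s else 0)"
  have 1: "(\<lambda>s. if s \<in> {t..T} then d1 s else 0) \<in> borel_measurable lebesgue"
    and 2: "(\<lambda>s. if s \<in> {t'..T} then d2 s else 0) \<in> borel_measurable lebesgue"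
    using assms(1,2) by (auto simp only: controls_def mem_Collect_eq intro!: borel_measurable_if_I) auto
  have "{s \<in> space lebesgue. s < t'} = {..<t'}" by auto
  then have "{s \<in> space lebesgue. s < t'} \<in> sets lebesgue" by simp
  from measurable_If[OF 1 2 this] have "?e \<in> borel_measurable lebesgue" .
  then have "?e \<in> borel_measurable (lebesgue_on {t..T})" by (rule measurable_restrict_space1)
  moreover have "?e \<in> borel_measurable (lebesgue_on {t..T}) \<longleftrightarrow>
      (\<lambda>s\<in>{t..T}. if s < t' then d1 s else d2 s) \<in> borel_measurable (lebesgue_on {t..T})"
    by (rule measurable_cong) auto
  ultimately show ?thesis using assms by (auto simp: controls_def PiE_iff)
qed

lemma restrict_in_controls:
  assumes "d \<in> controls D t T" "t \<le> t'"
  shows "restrict d {t'..T} \<in> controls D t' T"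
proof -
  have "d \<in> borel_measurable (lebesgue_on {t'..T})"
    using admissible_mono[OF controls_admissible[OF assms(1)], of t' T] assms(2) by (auto simp: admissible_def)
  moreover have "d \<in> borel_measurable (lebesgue_on {t'..T}) \<longleftrightarrow>
     restrict d {t'..T} \<in> borel_measurable (lebesgue_on {t'..T})"
    by (rule measurable_cong) auto
  ultimately show ?thesis using assms by (auto simp: controls_def PiE_iff)
qed

lemma constant_in_controls: "d0 \<in> D \<Longrightarrow> (\<lambda>s\<in>{t..T}. d0) \<in> controls D t T"
proof -
  assume "d0 \<in> D"
  moreover have "(\<lambda>s. d0) \<in> borel_measurable (lebesgue_on {t..T}) \<longleftrightarrow>
     (\<lambda>s\<in>{t..T}. d0) \<in> borel_measurable (lebesgue_on {t..T})"
    by (rule measurable_cong) auto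
  ultimately show ?thesis by (auto simp: controls_def)
qed

section \<open>Restriction and concatenation of trajectories\<close>

context control_system begin

lemma controls_nonempty: "controls D t T \<noteq> {}"
  using constant_in_controls D_nonempty by blast

lemma trajectory_solution:
  assumes "t \<le> T" "d \<in> controls D t T"
  shows "integral_solution F t T d x (trajectory F T x t d)"
  by (rule trajectory_integral_solution[OF assms(1) controls_admissible[OF assms(2)]])

lemma trajectory_start:
  assumes "t \<le> T" "d \<in> controls D t T"
  shows "trajectory F T x t d t = x"
  using integral_solution_start[OF trajectory_solution[OF assms]] assms by simp

lemma trajectory_restrict:
  assumes "t \<le> t'" "t' \<le> T" and d: "d \<in> controls D t T" and s: "s \<in> {t'..T}"
  shows "trajectory F T (trajectory F T x t d t') t' (restrict d {t'..T}) s = trajectory F T x t d s"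
proof (rule integral_solution_unique[OF _ _ _ s])
  show "integral_solution F t' T (restrict d {t'..T}) (trajectory F T x t d t')
      (trajectory F T (trajectory F T x t d t') t' (restrict d {t'..T}))"
    by (rule trajectory_solution[OF assms(2) restrict_in_controls[OF d assms(1)]])
  have "integral_solution F t' T d (trajectory F T x t d t') (trajectory F T x t d)"
    using assms by (intro integral_solution_tail[OF trajectory_solution controls_admissible]) auto
  then show "integral_solution F t' T (restrict d {t'..T}) (trajectory F T x t d t') (trajectory F T x t d)"
    by (rule integral_solution_cong[of _ _ _ _ _ _ _ "{}"]) auto
  show "admissible D t' T (restrict d {t'..T})"
    by (rule controls_admissible[OF restrict_in_controls[OF d assms(1)]])
qed

lemma trajectory_concatenation:
  fixes d1 d2
  assumes t: "t \<le> t'" "t' \<le> T" and d1: "d1 \<in> controls D t T" and d2: "d2 \<in> controls D t' T"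
  defines "e \<equiv> (\<lambda>s\<in>{t..T}. if s < t' then d1 s else d2 s)"
  shows "s \<in> {t..t'} \<Longrightarrow> trajectory F T x t e s = trajectory F T x t d1 s"
    and "s \<in> {t'..T} \<Longrightarrow> trajectory F T x t e s = trajectory F T (trajectory F T x t d1 t') t' d2 s"
proof -
  have e: "e \<in> controls D t T" unfolding e_def by (rule concatenation_in_controls[OF d1 d2 t(1)])
  have tT: "t \<le> T" using t by simp
  have hd: "trajectory F T x t e s = trajectory F T x t d1 s" if s: "s \<in> {t..t'}" for s
  proof (rule integral_solution_unique[OF _ _ _ s])
    show "integral_solution F t t' d1 x (trajectory F T x t d1)"
      by (rule integral_solution_head[OF trajectory_solution[OF tT d1] t(2)])
    have "integral_solution F t t' e x (trajectory F T x t e)"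
      by (rule integral_solution_head[OF trajectory_solution[OF tT e] t(2)])
    \<comment> \<open>At the instant \<open>t'\<close> the concatenation already takes the value of
      \<open>d2\<close>, so it agrees with \<open>d1\<close> on \<open>{t..t'}\<close> only off the
      null set \<open>{t'}\<close>.\<close>
    then show "integral_solution F t t' d1 x (trajectory F T x t e)"
      by (rule integral_solution_cong[of _ _ _ _ _ _ _ "{t'}"]) (use t in \<open>auto simp: e_def\<close>)
    show "admissible D t t' d1"
      by (rule admissible_mono[OF controls_admissible[OF d1]]) (use t in auto)
  qed
  then show "s \<in> {t..t'} \<Longrightarrow> trajectory F T x t e s = trajectory F T x t d1 s" .
  assume s: "s \<in> {t'..T}"
  \<comment> \<open>An equality of total functions, since members of \<open>controls\<close> are
    extensional; it lets the trajectory of \<open>d2\<close> be replaced literally.\<close>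
  have "restrict e {t'..T} = d2"
    using d2 t by (auto simp: e_def controls_def PiE_iff extensional_def fun_eq_iff restrict_def)
  then have "trajectory F T (trajectory F T x t e t') t' d2 s = trajectory F T x t e s"
    using trajectory_restrict[OF t e s, of x] by simp
  then show "trajectory F T x t e s = trajectory F T (trajectory F T x t d1 t') t' d2 s"
    using hd[of t'] t by simp
qed

lemma hamiltonian_upper: "d \<in> D \<Longrightarrow> p \<bullet> F (x, d) \<le> hamiltonian F D x p"
  unfolding hamiltonian_def
proof (rule cSUP_upper)
  show "bdd_above ((\<lambda>d. p \<bullet> F (x, d)) ` D)"
  proof (rule bdd_aboveI2)
    fix d assume "d \<in> D"
    then have "norm p * norm (F (x, d)) \<le> norm p * (K + L * norm x)"
      by (intro mult_left_mono F_growth) auto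
    then show "p \<bullet> F (x, d) \<le> norm p * (K + L * norm x)"
      using norm_cauchy_schwarz[of p "F (x, d)"] by linarith
  qed
qed

lemma hamiltonian_least: "(\<And>d. d \<in> D \<Longrightarrow> p \<bullet> F (x, d) \<le> c) \<Longrightarrow> hamiltonian F D x p \<le> c"
  unfolding hamiltonian_def by (rule cSUP_least[OF D_nonempty]) blast

end

text \<open>\<open>\<beta>\<close> is the terminal cost and \<open>\<gamma>\<close> the obstacle,
  later the maxima of the \<open>l i\<close> and of the \<open>g i\<close>. The last assumption says
  which numbers are upper bounds of the costs. It determines \<open>u\<close> on
  \<open>space_time T\<close> and removes both suprema, over controls and over times.\<close>

locale value_problem = control_system F D L K
  for F :: "(real^'n) \<times> (real^'m) \<Rightarrow> (real^'n)" and D :: "(real^'m) set" and L K :: real +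
  fixes T :: real and \<beta> :: "(real^'n) \<Rightarrow> real" and \<gamma> u :: "(real^'n) \<times> real \<Rightarrow> real"
  assumes T_pos: "T > 0"
    and \<beta>_lipschitz: "\<And>B. bounded B \<Longrightarrow> \<exists>M. M-lipschitz_on B \<beta>"
    and \<gamma>_lipschitz: "\<And>B. bounded B \<Longrightarrow> \<exists>M. M-lipschitz_on B \<gamma>"
    and u_le_iff: "\<And>x t c. t \<in> {0..T} \<Longrightarrow> u (x, t) \<le> c \<longleftrightarrow> (\<forall>d\<in>controls D t T.
      \<beta> (trajectory F T x t d T) \<le> c \<and> (\<forall>s\<in>{t..T}. \<gamma> (trajectory F T x t d s, s) \<le> c))"
begin

lemma u_ge:
  assumes "t \<in> {0..T}" "d \<in> controls D t T"
  shows "\<beta> (trajectory F T x t d T) \<le> u (x, t)"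
    and "s \<in> {t..T} \<Longrightarrow> \<gamma> (trajectory F T x t d s, s) \<le> u (x, t)"
  using u_le_iff[OF assms(1), of x "u (x, t)"] assms(2) by blast+

lemma u_ge_obstacle: "t \<in> {0..T} \<Longrightarrow> \<gamma> (x, t) \<le> u (x, t)"
proof -
  assume t: "t \<in> {0..T}"
  obtain d where d: "d \<in> controls D t T" using controls_nonempty by blast
  show ?thesis using u_ge(2)[OF t d, of t x] trajectory_start[OF _ d] t by simp
qed

text \<open>Any control available at the later point, preceded by \<open>d\<close>, is a control at
  \<open>(x, t)\<close> with the same costs from \<open>t'\<close> on. So the bound
  \<open>u (x, t)\<close> covers all costs at the later point.\<close>

lemma u_antimono_trajectory:
  assumes t: "t \<in> {0..T}" and d: "d \<in> controls D t T" and t': "t' \<in> {t..T}"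
  shows "u (trajectory F T x t d t', t') \<le> u (x, t)"
proof -
  have tt: "t' \<in> {0..T}" "t \<le> t'" "t' \<le> T" using t t' by auto
  show ?thesis
    unfolding u_le_iff[OF tt(1)]
  proof (intro ballI conjI)
    fix d2 assume d2: "d2 \<in> controls D t' T"
    note c = concatenation_in_controls[OF d d2 tt(2)]
    note eq = trajectory_concatenation(2)[OF tt(2,3) d d2, of _ x]
    show "\<beta> (trajectory F T (trajectory F T x t d t') t' d2 T) \<le> u (x, t)"
      using u_ge(1)[OF t c, of x] eq[of T] tt by simp
    show "\<gamma> (trajectory F T (trajectory F T x t d t') t' d2 s, s) \<le> u (x, t)" if "s \<in> {t'..T}" for s
      using u_ge(2)[OF t c, of s x] eq[of s] tt that by simp
  qed
qed

text \<open>Costs up to \<open>t'\<close> are bounded by the hypothesis on \<open>\<gamma>\<close>.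
  Later costs are those of the restricted control, started at the point reached, and are bounded by
  \<open>u\<close> there.\<close>

lemma u_le_dynamic_programming:
  assumes t: "t \<in> {0..T}" and t': "t' \<in> {t..T}"
    and le: "\<And>d s. d \<in> controls D t T \<Longrightarrow> s \<in> {t..t'} \<Longrightarrow> \<gamma> (trajectory F T x t d s, s) \<le> c"
      "\<And>d. d \<in> controls D t T \<Longrightarrow> u (trajectory F T x t d t', t') \<le> c"
  shows "u (x, t) \<le> c"
  unfolding u_le_iff[OF t]
proof (intro ballI conjI)
  fix d assume d: "d \<in> controls D t T"
  have tt: "t' \<in> {0..T}" "t \<le> t'" "t' \<le> T" using t t' by auto
  note r = restrict_in_controls[OF d tt(2)]
  note eq = trajectory_restrict[OF tt(2,3) d, of _ x]
  show "\<beta> (trajectory F T x t d T) \<le> c"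
    using u_ge(1)[OF tt(1) r, of "trajectory F T x t d t'"] eq[of T] le(2)[OF d] tt by simp
  fix s assume s: "s \<in> {t..T}"
  show "\<gamma> (trajectory F T x t d s, s) \<le> c"
  proof (cases "s \<le> t'")
    case True then show ?thesis using le(1)[OF d, of s] s by simp
  next
    case False
    then show ?thesis
      using u_ge(2)[OF tt(1) r, of s "trajectory F T x t d t'"] eq[of s] le(2)[OF d] s by simp
  qed
qed

text \<open>On \<open>{T..T}\<close> every trajectory is its starting point. The two sides have the
  same upper bounds and hence are equal.\<close>

lemma u_terminal: "u (x, T) = max (\<beta> x) (\<gamma> (x, T))"
proof -
  have "u (x, T) \<le> c \<longleftrightarrow> max (\<beta> x) (\<gamma> (x, T)) \<le> c" for c
  proof -
    have "u (x, T) \<le> c \<longleftrightarrow> (\<forall>d\<in>controls D T T. \<beta> x \<le> c \<and> \<gamma> (x, T) \<le> c)"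
      using u_le_iff[of T x c] trajectory_start[of T T _ x] T_pos by simp
    then show ?thesis using controls_nonempty by auto
  qed
  then show ?thesis by (meson order_antisym order_refl)
qed

text \<open>The a priori bound for states, with \<open>T\<close> in place of the elapsed times, so
  that it holds for all starting times and all starting points of norm at most
  \<open>r\<close>.\<close>

definition reach_radius :: "real \<Rightarrow> real" where
  "reach_radius r = 2 * (r + K * T) * exp (2 * L * T)"

definition reach_speed :: "real \<Rightarrow> real" where
  "reach_speed r = K + L * reach_radius r"

lemma trajectory_bound:
  assumes t: "t \<in> {0..T}" and d: "d \<in> controls D t T" and x: "norm x \<le> r" and s: "s \<in> {t..T}"
  shows "norm (trajectory F T x t d s) \<le> reach_radius r"
proof -
  have "norm (trajectory F T x t d s) \<le> 2 * (norm x + K * (T - t)) * exp (2 * L * (s - t))"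
    using t s by (intro integral_solution_bound[OF trajectory_solution[OF _ d] controls_admissible[OF d]]) auto
  also have "\<dots> \<le> reach_radius r"
    unfolding reach_radius_def
    using t s x K_nonneg L_pos norm_ge_zero[of x] order_trans[OF norm_ge_zero x]
    by (intro mult_mono add_mono mult_left_mono) (auto intro!: add_nonneg_nonneg mult_nonneg_nonneg)
  finally show ?thesis .
qed

lemma reach_nonneg:
  assumes "r \<ge> 0"
  shows "r \<le> reach_radius r" "0 \<le> reach_radius r" "0 \<le> reach_speed r"
proof -
  have "0 \<le> K * T" using K_nonneg T_pos by simp
  then have 1: "r \<le> r + K * T" "0 \<le> r + K * T" using assms by auto
  then have "2 * (r + K * T) * 1 \<le> reach_radius r"
    unfolding reach_radius_def using L_pos T_pos by (intro mult_left_mono) auto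
  then have "2 * (r + K * T) \<le> reach_radius r" by (simp only: mult_1_right)
  moreover have "r + K * T \<le> 2 * (r + K * T)" using 1(2) by simp
  ultimately show "r \<le> reach_radius r" using 1(1) by (meson order_trans)
  then show "0 \<le> reach_radius r" using assms by simp
  then show "0 \<le> reach_speed r" using K_nonneg L_pos by (simp add: reach_speed_def)
qed

lemma trajectory_speed:
  assumes t: "t \<in> {0..T}" and d: "d \<in> controls D t T" and x: "norm x \<le> r" and s: "s \<in> {t..T}"
  shows "norm (trajectory F T x t d s - x) \<le> reach_speed r * (s - t)"
proof -
  have "norm (trajectory F T x t d s - trajectory F T x t d t) \<le> reach_speed r * (s - t)"
    unfolding reach_speed_def using t s
    by (intro integral_solution_speed[OF trajectory_solution[OF _ d] controls_admissible[OF d]]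
        trajectory_bound[OF t d x]) auto
  then show ?thesis using trajectory_start[OF _ d] t by simp
qed

subsection \<open>Local Lipschitz continuity\<close>

text \<open>Under a common control, trajectories from \<open>x\<close> and \<open>y\<close> stay
  within \<open>2 * exp (2 * L * T)\<close> times their initial distance and inside one ball where
  both costs are Lipschitz. The estimate is uniform in the control, so it passes to
  \<open>u\<close>.\<close>

lemma u_lipschitz_space:
  obtains M where "M \<ge> 0" "\<And>(x :: real^'n) y t. norm x \<le> r \<Longrightarrow> norm y \<le> r \<Longrightarrow> t \<in> {0..T} \<Longrightarrow>
    u (x, t) \<le> u (y, t) + M * norm (x - y)"
proof -
  define \<rho> where "\<rho> = reach_radius r"
  obtain M1 where M1: "M1-lipschitz_on (cball 0 \<rho>) \<beta>" using \<beta>_lipschitz by blast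
  obtain M2 where M2: "M2-lipschitz_on (cball 0 \<rho> \<times> {0..T}) \<gamma>"
    using \<gamma>_lipschitz by (metis bounded_Times bounded_cball bounded_closed_interval)
  define M where "M = max M1 M2 * (2 * exp (2 * L * T))"
  have M0: "M1 \<ge> 0" "M2 \<ge> 0" using M1 M2 lipschitz_on_nonneg by blast+
  show thesis
  proof (rule that[of M])
    show "M \<ge> 0" using M0 by (simp add: M_def)
    fix x y :: "real^'n" and t assume xy: "norm x \<le> r" "norm y \<le> r" and t: "t \<in> {0..T}"
    show "u (x, t) \<le> u (y, t) + M * norm (x - y)"
      unfolding u_le_iff[OF t]
    proof (intro ballI conjI)
      fix d assume d: "d \<in> controls D t T"
      let ?X = "trajectory F T x t d" and ?Y = "trajectory F T y t d"
      have in_ball: "?X s \<in> cball 0 \<rho>" "?Y s \<in> cball 0 \<rho>" if "s \<in> {t..T}" for s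
        using trajectory_bound[OF t d _ that] xy by (auto simp: \<rho>_def)
      have dist: "max M1 M2 * norm (?X s - ?Y s) \<le> M * norm (x - y)" if s: "s \<in> {t..T}" for s
      proof -
        have "norm (?X s - ?Y s) \<le> 2 * norm (x - y) * exp (2 * L * (s - t))"
          using t by (intro integral_solution_dist[OF trajectory_solution[OF _ d] trajectory_solution[OF _ d] controls_admissible[OF d] s]) auto
        also have "\<dots> \<le> 2 * norm (x - y) * exp (2 * L * T)"
          using s t L_pos by (intro mult_left_mono) auto
        finally have "max M1 M2 * norm (?X s - ?Y s) \<le> max M1 M2 * (2 * norm (x - y) * exp (2 * L * T))"
          using M0 by (intro mult_left_mono) auto
        then show ?thesis by (simp add: M_def mult_ac)
      qed
      have T: "T \<in> {t..T}" using t by simp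
      have "\<beta> (?X T) \<le> \<beta> (?Y T) + M1 * norm (?X T - ?Y T)"
        using lipschitz_onD[OF M1 in_ball[OF T]] by (simp add: dist_norm)
      moreover have "M1 * norm (?X T - ?Y T) \<le> max M1 M2 * norm (?X T - ?Y T)"
        by (intro mult_right_mono) auto
      ultimately show "\<beta> (?X T) \<le> u (y, t) + M * norm (x - y)"
        using u_ge(1)[OF t d, of y] dist[OF T] by linarith
      fix s assume s: "s \<in> {t..T}"
      have "\<gamma> (?X s, s) \<le> \<gamma> (?Y s, s) + M2 * norm (?X s - ?Y s)"
        using lipschitz_onD[OF M2, of "(?X s, s)" "(?Y s, s)"] in_ball[OF s] s t
        by (simp add: dist_norm norm_Pair)
      moreover have "M2 * norm (?X s - ?Y s) \<le> max M1 M2 * norm (?X s - ?Y s)"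
        by (intro mult_right_mono) auto
      ultimately show "\<gamma> (?X s, s) \<le> u (y, t) + M * norm (x - y)"
        using u_ge(2)[OF t d s, of y] dist[OF s] by linarith
    qed
  qed
qed

text \<open>The two inequalities have different sources. A single trajectory along which
  \<open>u\<close> decreases bounds \<open>u (x, t')\<close>. Dynamic programming bounds
  \<open>u (x, t)\<close>, because the costs met before \<open>t'\<close> are close to
  \<open>\<gamma> (x, t')\<close>, which lies below \<open>u (x, t')\<close>.\<close>

lemma u_lipschitz_time:
  assumes "r \<ge> 0"
  obtains M where "M \<ge> 0" "\<And>(x :: real^'n) t t'. norm x \<le> r \<Longrightarrow> t \<in> {0..T} \<Longrightarrow> t' \<in> {t..T} \<Longrightarrow>
    \<bar>u (x, t) - u (x, t')\<bar> \<le> M * (t' - t)"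
proof -
  define \<rho> where "\<rho> = reach_radius r"
  define C where "C = reach_speed r"
  have C: "C \<ge> 0" "r \<le> \<rho>" using reach_nonneg[OF assms] by (auto simp: C_def \<rho>_def)
  obtain M1 where M1: "M1 \<ge> 0" "\<And>(x :: real^'n) y t. norm x \<le> \<rho> \<Longrightarrow> norm y \<le> \<rho> \<Longrightarrow> t \<in> {0..T} \<Longrightarrow>
    u (x, t) \<le> u (y, t) + M1 * norm (x - y)" using u_lipschitz_space by blast
  obtain M2 where M2: "M2-lipschitz_on (cball 0 \<rho> \<times> {0..T}) \<gamma>"
    using \<gamma>_lipschitz by (metis bounded_Times bounded_cball bounded_closed_interval)
  have M20: "M2 \<ge> 0" using M2 lipschitz_on_nonneg by blast
  \<comment> \<open>\<open>M1 * C\<close> pays for moving the state back to \<open>x\<close>;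
    \<open>M2 * (C + 1)\<close> pays for the obstacle, whose argument moves both in state and in
    time.\<close>
  define M where "M = M1 * C + M2 * (C + 1)"
  show thesis
  proof (rule that[of M])
    show "M \<ge> 0" using M1 M20 C by (simp add: M_def)
    fix x :: "real^'n" and t t' assume x: "norm x \<le> r" and t: "t \<in> {0..T}" and t': "t' \<in> {t..T}"
    have tt: "t' \<in> {0..T}" "t \<le> t'" using t t' by auto
    have x\<rho>: "norm x \<le> \<rho>" using x C by simp
    have sp: "norm (trajectory F T x t d s - x) \<le> C * (t' - t)" "norm (trajectory F T x t d s) \<le> \<rho>"
      if d: "d \<in> controls D t T" and s: "s \<in> {t..t'}" for d s
    proof -
      have s': "s \<in> {t..T}" using s t' by auto
      have "C * (s - t) \<le> C * (t' - t)" using C s by (intro mult_left_mono) auto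
      then show "norm (trajectory F T x t d s - x) \<le> C * (t' - t)"
        using trajectory_speed[OF t d x s'] by (simp add: C_def)
      show "norm (trajectory F T x t d s) \<le> \<rho>" unfolding \<rho>_def by (rule trajectory_bound[OF t d x s'])
    qed
    have pos: "M1 * C * (t' - t) \<ge> 0" "M2 * (C + 1) * (t' - t) \<ge> 0" using M1 M20 C tt by auto
    have M_split: "M * (t' - t) = M1 * C * (t' - t) + M2 * (C + 1) * (t' - t)" by (simp add: M_def algebra_simps)
    have step: "M1 * norm (trajectory F T x t d t' - x) \<le> M1 * C * (t' - t)" if "d \<in> controls D t T" for d
      using mult_left_mono[OF sp(1)[OF that, of t'] M1(1)] tt by (simp add: mult_ac)
    have "u (x, t') \<le> u (x, t) + M * (t' - t)"
    proof -
      obtain d where d: "d \<in> controls D t T" using controls_nonempty by blast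
      have "u (x, t') \<le> u (trajectory F T x t d t', t') + M1 * norm (x - trajectory F T x t d t')"
        using M1(2)[OF x\<rho> sp(2)[OF d, of t'] tt(1)] tt by simp
      then show ?thesis
        using u_antimono_trajectory[OF t d t', of x] step[OF d] pos M_split by (simp add: norm_minus_commute)
    qed
    moreover have "u (x, t) \<le> u (x, t') + M * (t' - t)"
    proof (rule u_le_dynamic_programming[OF t t'])
      fix d assume d: "d \<in> controls D t T"
      show "u (trajectory F T x t d t', t') \<le> u (x, t') + M * (t' - t)"
        using M1(2)[OF sp(2)[OF d, of t'] x\<rho> tt(1)] step[OF d] pos M_split tt by simp
      fix s assume s: "s \<in> {t..t'}"
      have "dist (trajectory F T x t d s, s) (x, t') \<le> norm (trajectory F T x t d s - x) + \<bar>s - t'\<bar>"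
        using norm_Pair_le[of "trajectory F T x t d s - x" "s - t'"] by (simp add: dist_norm)
      also have "\<dots> \<le> (C + 1) * (t' - t)" using sp(1)[OF d s] s by (simp add: algebra_simps)
      finally have "M2 * dist (trajectory F T x t d s, s) (x, t') \<le> M2 * (C + 1) * (t' - t)"
        using mult_left_mono[OF _ M20] by (simp add: mult.assoc)
      moreover have "dist (\<gamma> (trajectory F T x t d s, s)) (\<gamma> (x, t')) \<le> M2 * dist (trajectory F T x t d s, s) (x, t')"
        using s t tt t' x\<rho> sp(2)[OF d s] by (intro lipschitz_onD[OF M2]) auto
      ultimately show "\<gamma> (trajectory F T x t d s, s) \<le> u (x, t') + M * (t' - t)"
        using u_ge_obstacle[OF tt(1), of x] pos M_split by (simp add: dist_real_def)
    qed
    ultimately show "\<bar>u (x, t) - u (x, t')\<bar> \<le> M * (t' - t)" by linarith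
  qed
qed

lemma u_lipschitz_on_bounded: "lipschitz_on_bounded (space_time T) u"
  unfolding lipschitz_on_bounded_def
proof (intro allI impI)
  fix B :: "((real^'n) \<times> real) set" assume B: "B \<subseteq> space_time T" "bounded B"
  then obtain r where "r > 0" and r: "\<And>z. z \<in> B \<Longrightarrow> norm z \<le> r" by (meson bounded_pos)
  then have r0: "r \<ge> 0" by simp
  have rx: "norm (fst z) \<le> r" if "z \<in> B" for z using r[OF that] norm_fst_le[of "fst z" "snd z"] by simp
  obtain M1 where M1: "M1 \<ge> 0" "\<And>(x :: real^'n) y t. norm x \<le> r \<Longrightarrow> norm y \<le> r \<Longrightarrow> t \<in> {0..T} \<Longrightarrow>
    u (x, t) \<le> u (y, t) + M1 * norm (x - y)" using u_lipschitz_space by blast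
  obtain M2 where M2: "M2 \<ge> 0" "\<And>(x :: real^'n) t t'. norm x \<le> r \<Longrightarrow> t \<in> {0..T} \<Longrightarrow> t' \<in> {t..T} \<Longrightarrow>
    \<bar>u (x, t) - u (x, t')\<bar> \<le> M2 * (t' - t)" using u_lipschitz_time[OF r0] by blast
  have "(M1 + M2)-lipschitz_on B u"
  proof (rule lipschitz_onI)
    show "0 \<le> M1 + M2" using M1 M2 by simp
    fix z z' assume z: "z \<in> B" "z' \<in> B"
    obtain x t where zx: "z = (x, t)" by fastforce
    obtain y s where zy: "z' = (y, s)" by fastforce
    note zz = zx zy
    have ts: "t \<in> {0..T}" "s \<in> {0..T}" using z B zz by auto
    have xy: "norm x \<le> r" "norm y \<le> r" using rx z zz by auto
    have "\<bar>u (x, t) - u (y, t)\<bar> \<le> M1 * norm (x - y)"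
      using M1(2)[OF xy ts(1)] M1(2)[OF xy(2,1) ts(1)] by (simp add: norm_minus_commute abs_le_iff)
    also have "\<dots> \<le> M1 * dist z z'"
      using M1(1) norm_fst_le[of "x - y" "t - s"] zz by (intro mult_left_mono) (auto simp: dist_norm)
    finally have 1: "\<bar>u (x, t) - u (y, t)\<bar> \<le> M1 * dist z z'" .
    have "\<bar>u (y, t) - u (y, s)\<bar> \<le> M2 * \<bar>t - s\<bar>"
    proof (cases "t \<le> s")
      case True then show ?thesis using M2(2)[OF xy(2) ts(1), of s] ts by simp
    next
      case False then show ?thesis using M2(2)[OF xy(2) ts(2), of t] ts by (simp add: abs_minus_commute)
    qed
    also have "\<dots> \<le> M2 * dist z z'"
      using M2(1) norm_snd_le[of "t - s" "x - y"] zz by (intro mult_left_mono) (auto simp: dist_norm)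
    finally show "dist (u z) (u z') \<le> (M1 + M2) * dist z z'"
      using 1 zz by (simp add: dist_real_def distrib_right)
  qed
  then show "\<exists>M. M-lipschitz_on B u" by blast
qed

subsection \<open>Viscosity inequalities\<close>

text \<open>Freezing the state at \<open>x\<close> changes the velocity by at most
  \<open>L * reach_speed r * (s - t)\<close>, so the error is of second order in
  \<open>s - t\<close>. The bound \<open>c\<close> concerns only values taken by the control: it
  serves a constant control with reversed \<open>p\<close> as well as the Hamiltonian for arbitrary
  controls.\<close>

lemma trajectory_inner_le:
  assumes t: "t \<in> {0..T}" and d: "d \<in> controls D t T" and s: "s \<in> {t..T}" and x: "norm x \<le> r"
    and c: "\<And>e. e \<in> d ` {t..T} \<Longrightarrow> p \<bullet> F (x, e) \<le> c"
  shows "p \<bullet> (trajectory F T x t d s - x) \<le> (s - t) * (c + norm p * L * reach_speed r * (s - t))"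
proof -
  let ?X = "trajectory F T x t d"
  have sol: "integral_solution F t T d x ?X" using t by (intro trajectory_solution[OF _ d]) simp
  have X: "continuous_on {t..T} ?X" using sol by (simp add: integral_solution_def)
  have int: "(\<lambda>r. F (?X r, d r)) integrable_on {t..s}"
    using F_integrable_sub[OF X controls_admissible[OF d], of t s] s by simp
  have C: "reach_speed r \<ge> 0" using order_trans[OF norm_ge_zero x] by (rule reach_nonneg)
  have "?X s - x = integral {t..s} (\<lambda>r. F (?X r, d r))"
    using integral_solution_increment[OF sol controls_admissible[OF d], of t s] s trajectory_start[OF _ d] by simp
  then have "p \<bullet> (?X s - x) = integral {t..s} (\<lambda>r. p \<bullet> F (?X r, d r))"
    using integral_linear[OF int bounded_linear_inner_right[of p]] by (simp add: o_def)
  also have "\<dots> \<le> integral {t..s} (\<lambda>_. c + norm p * L * reach_speed r * (s - t))"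
  proof (rule integral_le)
    show "(\<lambda>r. p \<bullet> F (?X r, d r)) integrable_on {t..s}"
      using integrable_linear[OF int bounded_linear_inner_right[of p]] by (simp add: o_def)
    fix \<tau> assume \<tau>: "\<tau> \<in> {t..s}"
    then have \<tau>': "\<tau> \<in> {t..T}" using s by auto
    have dD: "d \<tau> \<in> D" using admissibleD[OF controls_admissible[OF d] \<tau>'] .
    have "norm (F (?X \<tau>, d \<tau>) - F (x, d \<tau>)) \<le> L * norm (?X \<tau> - x)" by (rule F_lipschitz[OF dD])
    also have "\<dots> \<le> L * (reach_speed r * (\<tau> - t))"
      using trajectory_speed[OF t d x \<tau>'] L_pos by (intro mult_left_mono) auto
    also have "\<dots> \<le> L * (reach_speed r * (s - t))"
      using \<tau> C L_pos by (intro mult_left_mono) auto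
    finally have "norm p * norm (F (?X \<tau>, d \<tau>) - F (x, d \<tau>)) \<le> norm p * (L * (reach_speed r * (s - t)))"
      by (intro mult_left_mono) auto
    then have "p \<bullet> (F (?X \<tau>, d \<tau>) - F (x, d \<tau>)) \<le> norm p * L * reach_speed r * (s - t)"
      using norm_cauchy_schwarz[of p "F (?X \<tau>, d \<tau>) - F (x, d \<tau>)"] by (simp add: mult.assoc)
    then show "p \<bullet> F (?X \<tau>, d \<tau>) \<le> c + norm p * L * reach_speed r * (s - t)"
      using c[of "d \<tau>"] \<tau>' by (simp add: inner_diff_right)
  qed auto
  also have "\<dots> = (s - t) * (c + norm p * L * reach_speed r * (s - t))" using s by simp
  finally show ?thesis .
qed

text \<open>If some \<open>d0\<close> violated the inequality, \<open>\<psi>\<close> would increase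
  along the trajectory of the constant control \<open>d0\<close>. But \<open>u\<close> does not
  increase along trajectories, so \<open>u - \<psi>\<close> would fall below its local
  minimum.\<close>

lemma u_supersolution_test:
  assumes \<psi>: "C_infinity_on (space_time T) \<psi>" and t: "t \<in> {0..<T}"
    and min: "local_min_on (space_time T) (\<lambda>z. u z - \<psi> z) (x, t)"
  shows "time_deriv T \<psi> (x, t) + hamiltonian F D x (space_grad \<psi> (x, t)) \<le> 0"
proof -
  define p q where "p = space_grad \<psi> (x, t)" and "q = time_deriv T \<psi> (x, t)"
  have t': "t \<in> {0..T}" using t by auto
  have "p \<bullet> F (x, d0) \<le> - q" if d0: "d0 \<in> D" for d0
  proof (rule ccontr)
    assume "\<not> p \<bullet> F (x, d0) \<le> - q"
    \<comment> \<open>One third of the excess is spent on freezing the state, one third on the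
      Taylor remainder, and one third survives.\<close>
    define \<theta> where "\<theta> = (p \<bullet> F (x, d0) + q) / 3"
    have \<theta>: "\<theta> > 0" "p \<bullet> F (x, d0) + q = 3 * \<theta>" using \<open>\<not> p \<bullet> F (x, d0) \<le> - q\<close> by (auto simp: \<theta>_def)
    define C where "C = reach_speed (norm x)"
    have C: "C \<ge> 0" using reach_nonneg[of "norm x"] by (simp add: C_def)
    obtain \<delta>1 where \<delta>1: "\<delta>1 > 0" "\<And>y s. s \<in> {0..T} \<Longrightarrow> norm (y - x, s - t) < \<delta>1 \<Longrightarrow>
      \<bar>\<psi> (y, s) - \<psi> (x, t) - (p \<bullet> (y - x) + q * (s - t))\<bar> \<le> \<theta> / (C + 1) * norm (y - x, s - t)"
      using C_infinity_on_expansion[OF \<psi> T_pos t', of "\<theta> / (C + 1)" x] C \<theta> unfolding p_def q_def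
      by (metis add_nonneg_pos divide_pos_pos zero_less_one)
    obtain \<delta>2 where \<delta>2: "\<delta>2 > 0" "\<And>z. z \<in> space_time T \<Longrightarrow> z \<noteq> (x, t) \<Longrightarrow> dist z (x, t) < \<delta>2 \<Longrightarrow>
        u (x, t) - \<psi> (x, t) \<le> u z - \<psi> z"
      using min unfolding local_min_on_def eventually_at by blast
    \<comment> \<open>Over time \<open>h\<close> the space-time displacement is at most
      \<open>(C + 1) * h\<close>; the divisor \<open>C + 2\<close> makes the resulting inequality
      strict.\<close>
    define \<delta> where "\<delta> = min \<delta>1 \<delta>2 / (C + 2)"
    have "\<delta> > 0" using C \<delta>1 \<delta>2 by (simp add: \<delta>_def)
    \<comment> \<open>\<open>T - t\<close> keeps the motion within the horizon; the last bound makes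
      the freezing error at most \<open>\<theta>\<close>, with \<open>+ 1\<close> excluding a zero
      denominator.\<close>
    define h where "h = min (min \<delta> (T - t)) (\<theta> / (norm p * L * C + 1))"
    have pLC: "norm p * L * C \<ge> 0" using C L_pos by simp
    have h: "h > 0" "h \<le> \<delta>" "h \<le> T - t" "h \<le> \<theta> / (norm p * L * C + 1)"
      using \<open>\<delta> > 0\<close> t \<theta> pLC by (auto simp: h_def intro!: divide_pos_pos)
    have "norm p * L * C * h \<le> (norm p * L * C + 1) * h" using h by (intro mult_right_mono) auto
    also have "\<dots> \<le> \<theta>" using h(4) pLC by (simp add: pos_le_divide_eq mult.commute)
    finally have small: "norm p * L * C * h \<le> \<theta>" .
    define d where "d = (\<lambda>s\<in>{t..T}. d0)"
    have d: "d \<in> controls D t T" unfolding d_def by (rule constant_in_controls[OF d0])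
    let ?y = "trajectory F T x t d (t + h)"
    have s: "t + h \<in> {t..T}" "t + h \<in> {0..T}" using h t by auto
    have nz: "norm (?y - x, h) \<le> (C + 1) * h"
      using norm_Pair_le[of "?y - x" h] trajectory_speed[OF t' d order_refl[of "norm x"] s(1)] h
      by (simp add: C_def distrib_right)
    also have "\<dots> < (C + 2) * h" using h by (intro mult_strict_right_mono) auto
    also have "\<dots> \<le> (C + 2) * \<delta>" using h C by (intro mult_left_mono) auto
    also have "\<dots> = min \<delta>1 \<delta>2" using C by (simp add: \<delta>_def)
    finally have near: "norm (?y - x, h) < \<delta>1" "norm (?y - x, h) < \<delta>2" by auto
    \<comment> \<open>The upper estimate applied to \<open>- p\<close> is the lower estimate needed
      here.\<close>
    have "- p \<bullet> (?y - x) \<le> (t + h - t) * (- (p \<bullet> F (x, d0)) + norm (- p) * L * reach_speed (norm x) * (t + h - t))"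
      by (rule trajectory_inner_le[OF t' d s(1) order_refl]) (auto simp: d_def)
    then have "p \<bullet> (?y - x) \<ge> h * (p \<bullet> F (x, d0) - norm p * L * C * h)" by (simp add: C_def algebra_simps)
    moreover have "h * (p \<bullet> F (x, d0) - norm p * L * C * h) \<ge> h * (p \<bullet> F (x, d0) - \<theta>)"
      using h small by (intro mult_left_mono) auto
    moreover have "\<psi> (?y, t + h) - \<psi> (x, t) \<ge> p \<bullet> (?y - x) + q * h - \<theta> / (C + 1) * norm (?y - x, h)"
      using \<delta>1(2)[OF s(2), of ?y] near by (simp add: abs_le_iff)
    moreover have "\<theta> / (C + 1) * norm (?y - x, h) \<le> \<theta> / (C + 1) * ((C + 1) * h)"
      using nz \<theta> C by (intro mult_left_mono) auto
    moreover have "\<theta> / (C + 1) * ((C + 1) * h) = \<theta> * h" using C by simp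
    moreover have "h * (p \<bullet> F (x, d0) - \<theta>) + q * h - \<theta> * h = h * \<theta>"
    proof -
      have "h * (p \<bullet> F (x, d0) - \<theta>) + q * h - \<theta> * h = h * ((p \<bullet> F (x, d0) + q) - 2 * \<theta>)" by (simp add: algebra_simps)
      then show ?thesis using \<theta>(2) by simp
    qed
    ultimately have "\<psi> (?y, t + h) - \<psi> (x, t) \<ge> h * \<theta>" by linarith
    moreover have "h * \<theta> > 0" using h \<theta> by simp
    moreover have "u (x, t) - \<psi> (x, t) \<le> u (?y, t + h) - \<psi> (?y, t + h)"
      using near s h by (intro \<delta>2(2)) (auto simp: dist_norm)
    moreover have "u (?y, t + h) \<le> u (x, t)" by (rule u_antimono_trajectory[OF t' d s(1)])
    ultimately show False by linarith
  qed
  then have "hamiltonian F D x p \<le> - q" by (rule hamiltonian_least)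
  then show ?thesis by (simp add: p_def q_def)
qed

text \<open>Were the inequality false, every control would lower \<open>\<psi>\<close>, and by the
  local maximum also \<open>u\<close>, by at least \<open>h * \<theta>\<close> over one common time
  \<open>h\<close>. The obstacle costs met meanwhile stay \<open>\<kappa>\<close> below
  \<open>u (x, t)\<close>. Dynamic programming would then push \<open>u (x, t)\<close> below itself.
  The uniform speed bound makes \<open>h\<close> independent of the control.\<close>

lemma u_subsolution_test:
  assumes \<psi>: "C_infinity_on (space_time T) \<psi>" and t: "t \<in> {0..<T}"
    and max: "local_max_on (space_time T) (\<lambda>z. u z - \<psi> z) (x, t)" and obst: "\<gamma> (x, t) < u (x, t)"
  shows "time_deriv T \<psi> (x, t) + hamiltonian F D x (space_grad \<psi> (x, t)) \<ge> 0"
proof (rule ccontr)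
  assume neg: "\<not> ?thesis"
  define p q where "p = space_grad \<psi> (x, t)" and "q = time_deriv T \<psi> (x, t)"
  have t': "t \<in> {0..T}" using t by auto
  define H where "H = hamiltonian F D x p"
  define \<theta> where "\<theta> = - (q + H) / 3"
  have "q + H < 0" using neg by (simp add: H_def p_def q_def)
  moreover have "3 * \<theta> = - (q + H)" by (simp add: \<theta>_def)
  ultimately have \<theta>: "\<theta> > 0" "H + q = - (3 * \<theta>)" by auto
  define C where "C = reach_speed (norm x)"
  have C: "C \<ge> 0" using reach_nonneg[of "norm x"] by (simp add: C_def)
  obtain \<delta>1 where \<delta>1: "\<delta>1 > 0" "\<And>y s. s \<in> {0..T} \<Longrightarrow> norm (y - x, s - t) < \<delta>1 \<Longrightarrow>
    \<bar>\<psi> (y, s) - \<psi> (x, t) - (p \<bullet> (y - x) + q * (s - t))\<bar> \<le> \<theta> / (C + 1) * norm (y - x, s - t)"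
    using C_infinity_on_expansion[OF \<psi> T_pos t', of "\<theta> / (C + 1)" x] C \<theta> unfolding p_def q_def
    by (metis add_nonneg_pos divide_pos_pos zero_less_one)
  obtain \<delta>2 where \<delta>2: "\<delta>2 > 0" "\<And>z. z \<in> space_time T \<Longrightarrow> z \<noteq> (x, t) \<Longrightarrow> dist z (x, t) < \<delta>2 \<Longrightarrow>
      u z - \<psi> z \<le> u (x, t) - \<psi> (x, t)"
    using max unfolding local_max_on_def eventually_at by blast
  \<comment> \<open>Half of the gap to the obstacle: the other half is allowed for the variation of
    \<open>\<gamma>\<close> near \<open>(x, t)\<close>.\<close>
  define \<kappa> where "\<kappa> = (u (x, t) - \<gamma> (x, t)) / 2"
  have \<kappa>: "\<kappa> > 0" using obst by (simp add: \<kappa>_def)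
  obtain M where M: "M-lipschitz_on (cball (x, t) 1) \<gamma>" using \<gamma>_lipschitz bounded_cball by blast
  have M0: "M \<ge> 0" using M lipschitz_on_nonneg by blast
  \<comment> \<open>The 1 stays in the unit ball where \<open>M\<close> is valid;
    \<open>\<kappa> / (M + 1)\<close> limits the variation of \<open>\<gamma>\<close> to
    \<open>\<kappa>\<close>.\<close>
  define \<delta> where "\<delta> = min (min \<delta>1 \<delta>2) (min 1 (\<kappa> / (M + 1))) / (C + 2)"
  have \<delta>: "\<delta> > 0" using C \<delta>1 \<delta>2 \<kappa> M0 by (auto simp: \<delta>_def intro!: divide_pos_pos)
  have pLC: "norm p * L * C \<ge> 0" using C L_pos by simp
  define h where "h = min (min \<delta> (T - t)) (\<theta> / (norm p * L * C + 1))"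
  have h: "h > 0" "h \<le> \<delta>" "h \<le> T - t" "h \<le> \<theta> / (norm p * L * C + 1)"
    using \<delta> t \<theta> pLC by (auto simp: h_def intro!: divide_pos_pos)
  have "norm p * L * C * h \<le> (norm p * L * C + 1) * h" using h by (intro mult_right_mono) auto
  also have "\<dots> \<le> \<theta>" using h(4) pLC by (simp add: pos_le_divide_eq mult.commute)
  finally have small: "norm p * L * C * h \<le> \<theta>" .
  have near: "norm (trajectory F T x t d s - x, s - t) \<le> (C + 1) * (s - t)"
      "norm (trajectory F T x t d s - x, s - t) < min (min \<delta>1 \<delta>2) (min 1 (\<kappa> / (M + 1)))"
    if d: "d \<in> controls D t T" and s: "s \<in> {t..t + h}" for d s
  proof -
    have s': "s \<in> {t..T}" using s h by auto
    show 1: "norm (trajectory F T x t d s - x, s - t) \<le> (C + 1) * (s - t)"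
      using norm_Pair_le[of "trajectory F T x t d s - x" "s - t"] trajectory_speed[OF t' d order_refl[of "norm x"] s'] s
      by (simp add: C_def distrib_right)
    also have "\<dots> \<le> (C + 1) * h" using s C by (intro mult_left_mono) auto
    also have "\<dots> < (C + 2) * h" using h by (intro mult_strict_right_mono) auto
    also have "\<dots> \<le> (C + 2) * \<delta>" using h C by (intro mult_left_mono) auto
    also have "\<dots> = min (min \<delta>1 \<delta>2) (min 1 (\<kappa> / (M + 1)))" using C by (simp add: \<delta>_def)
    finally show "norm (trajectory F T x t d s - x, s - t) < min (min \<delta>1 \<delta>2) (min 1 (\<kappa> / (M + 1)))" .
  qed
  have s: "t + h \<in> {t..T}" "t + h \<in> {0..T}" "t + h \<in> {t..t+h}" using h t by auto
  have "u (x, t) \<le> u (x, t) - min (h * \<theta>) \<kappa>"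
  proof (rule u_le_dynamic_programming[OF t' s(1)])
    fix d assume d: "d \<in> controls D t T"
    let ?y = "trajectory F T x t d (t + h)"
    have nz: "norm (?y - x, h) \<le> (C + 1) * h" "norm (?y - x, h) < \<delta>1" "norm (?y - x, h) < \<delta>2"
      using near[OF d s(3)] by auto
    have "p \<bullet> (?y - x) \<le> (t + h - t) * (H + norm p * L * reach_speed (norm x) * (t + h - t))"
      using admissibleD[OF controls_admissible[OF d]] unfolding H_def
      by (intro trajectory_inner_le[OF t' d s(1) order_refl] hamiltonian_upper) auto
    then have "p \<bullet> (?y - x) \<le> h * (H + norm p * L * C * h)" by (simp add: C_def)
    moreover have "h * (H + norm p * L * C * h) \<le> h * (H + \<theta>)"
      using h small by (intro mult_left_mono) auto
    moreover have "\<psi> (?y, t + h) - \<psi> (x, t) \<le> p \<bullet> (?y - x) + q * h + \<theta> / (C + 1) * norm (?y - x, h)"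
      using \<delta>1(2)[OF s(2), of ?y] nz by (simp add: abs_le_iff)
    moreover have "\<theta> / (C + 1) * norm (?y - x, h) \<le> \<theta> / (C + 1) * ((C + 1) * h)"
      using nz \<theta> C by (intro mult_left_mono) auto
    moreover have "\<theta> / (C + 1) * ((C + 1) * h) = \<theta> * h" using C by simp
    moreover have "h * (H + \<theta>) + q * h + \<theta> * h = - (h * \<theta>)"
    proof -
      have "h * (H + \<theta>) + q * h + \<theta> * h = h * ((H + q) + 2 * \<theta>)" by (simp add: algebra_simps)
      then show ?thesis using \<theta>(2) by simp
    qed
    ultimately have "\<psi> (?y, t + h) - \<psi> (x, t) \<le> - (h * \<theta>)" by linarith
    moreover have "u (?y, t + h) - \<psi> (?y, t + h) \<le> u (x, t) - \<psi> (x, t)"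
      using nz s h by (intro \<delta>2(2)) (auto simp: dist_norm)
    ultimately show "u (?y, t + h) \<le> u (x, t) - min (h * \<theta>) \<kappa>" by linarith
    fix s assume s: "s \<in> {t..t + h}"
    let ?z = "(trajectory F T x t d s, s)"
    have n: "dist ?z (x, t) < 1" "dist ?z (x, t) < \<kappa> / (M + 1)"
      using near(2)[OF d s] by (auto simp: dist_norm)
    have "dist (\<gamma> ?z) (\<gamma> (x, t)) \<le> M * dist ?z (x, t)"
      using n by (intro lipschitz_onD[OF M]) (auto simp: dist_commute)
    also have "\<dots> \<le> (M + 1) * dist ?z (x, t)" by (intro mult_right_mono) auto
    also have "\<dots> \<le> \<kappa>" using n(2) M0 by (simp add: pos_less_divide_eq mult.commute)
    finally show "\<gamma> ?z \<le> u (x, t) - min (h * \<theta>) \<kappa>" by (simp add: dist_real_def \<kappa>_def field_simps min_def abs_if split: if_splits)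
  qed
  moreover have "min (h * \<theta>) \<kappa> > 0" using h \<theta> \<kappa> by simp
  ultimately show False by linarith
qed

end

section \<open>Polynomials\<close>

text \<open>The derivative is polynomial for each fixed direction \<open>v\<close>, which is the
  shape of the recursion in \<open>C_k_on\<close>; smoothness of every order follows by
  induction.\<close>

lemma real_polynomial_function_has_derivative:
  assumes "real_polynomial_function p"
  shows "\<exists>p'. (\<forall>z. (p has_derivative p' z) (at z)) \<and> (\<forall>v. real_polynomial_function (\<lambda>z. p' z v))"
  using assms
proof induction
  case (linear f)
  then show ?case
    by (intro exI[of _ "\<lambda>_. f"]) (auto intro: bounded_linear_imp_has_derivative)
next
  case (const c)
  then show ?case by (intro exI[of _ "\<lambda>_ _. 0"]) auto
next
  case (add f g)
  then obtain f' g' where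
    "\<And>z. (f has_derivative f' z) (at z)" "\<And>v. real_polynomial_function (\<lambda>z. f' z v)"
    "\<And>z. (g has_derivative g' z) (at z)" "\<And>v. real_polynomial_function (\<lambda>z. g' z v)" by blast
  then show ?case by (intro exI[of _ "\<lambda>z v. f' z v + g' z v"]) (auto intro: has_derivative_add)
next
  case (mult f g)
  then obtain f' g' where
    "\<And>z. (f has_derivative f' z) (at z)" "\<And>v. real_polynomial_function (\<lambda>z. f' z v)"
    "\<And>z. (g has_derivative g' z) (at z)" "\<And>v. real_polynomial_function (\<lambda>z. g' z v)" by blast
  then show ?case using mult(1,2)
    by (intro exI[of _ "\<lambda>z v. f z * g' z v + f' z v * g z"] conjI allI has_derivative_mult
        real_polynomial_function.intros(3,4)) auto
qed

lemma real_polynomial_function_C_infinity_on: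
  assumes "real_polynomial_function p"
  shows "C_infinity_on S p"
proof -
  have "C_k_on k S p" if "real_polynomial_function p" for k p
    using that
  proof (induction k arbitrary: p)
    case 0
    then show ?case by (simp add: continuous_on_polymonial_function real_polynomial_function_eq)
  next
    case (Suc k)
    then obtain p' where "\<And>z. (p has_derivative p' z) (at z)" "\<And>v. real_polynomial_function (\<lambda>z. p' z v)"
      using real_polynomial_function_has_derivative[OF Suc.prems] by blast
    then show ?case using Suc.IH by (auto intro!: exI[of _ p'] intro: has_derivative_at_withinI)
  qed
  then show ?thesis using assms by (simp add: C_infinity_on_def)
qed

lemma lipschitz_on_imp_bounded_image:
  fixes f :: "'a::euclidean_space \<Rightarrow> real"
  assumes "M-lipschitz_on B f" "bounded B"
  obtains c where "c \<ge> 0" "\<And>x. x \<in> B \<Longrightarrow> \<bar>f x\<bar> \<le> c"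
proof -
  have "bounded (f ` B)"
    by (rule bounded_uniformly_continuous_image[OF lipschitz_on_uniformly_continuous[OF assms(1)] assms(2)])
  then obtain c where "c > 0" "\<And>y. y \<in> f ` B \<Longrightarrow> norm y \<le> c" unfolding bounded_pos by blast
  then show thesis using that[of c] by auto
qed

text \<open>Products are the critical case: in \<open>f x * (g x - g y) + g y * (f x - f y)\<close>
  the Lipschitz factors are multiplied by values of \<open>f\<close> and \<open>g\<close>, which are
  bounded because \<open>B\<close> is.\<close>

lemma real_polynomial_function_lipschitz_on_bounded:
  fixes p :: "'a::euclidean_space \<Rightarrow> real"
  assumes "real_polynomial_function p" and B: "bounded B"
  shows "\<exists>M. M-lipschitz_on B p"
  using assms(1)
proof induction
  case (linear f)
  then obtain K where K: "K > 0" "\<And>x. norm (f x) \<le> norm x * K"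
    using bounded_linear.pos_bounded by blast
  have "K-lipschitz_on B f"
  proof (rule lipschitz_onI)
    fix x y
    show "dist (f x) (f y) \<le> K * dist x y"
      using K(2)[of "x - y"] linear by (simp add: dist_norm linear_diff bounded_linear.linear mult.commute)
  qed (use K in simp)
  then show ?case by blast
next
  case (const c)
  then show ?case using lipschitz_on_constant by blast
next
  case (add f g)
  then show ?case using lipschitz_on_add by blast
next
  case (mult f g)
  then obtain M1 M2 where M: "M1-lipschitz_on B f" "M2-lipschitz_on B g" by blast
  obtain c1 where c1: "c1 \<ge> 0" "\<And>x. x \<in> B \<Longrightarrow> \<bar>f x\<bar> \<le> c1" using lipschitz_on_imp_bounded_image[OF M(1) B] by blast
  obtain c2 where c2: "c2 \<ge> 0" "\<And>x. x \<in> B \<Longrightarrow> \<bar>g x\<bar> \<le> c2" using lipschitz_on_imp_bounded_image[OF M(2) B] by blast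
  have M0: "M1 \<ge> 0" "M2 \<ge> 0" using M lipschitz_on_nonneg by blast+
  have "(c1 * M2 + c2 * M1)-lipschitz_on B (\<lambda>x. f x * g x)"
  proof (rule lipschitz_onI)
    show "0 \<le> c1 * M2 + c2 * M1" using c1 c2 M0 by simp
    fix x y assume xy: "x \<in> B" "y \<in> B"
    have "\<bar>f x * g x - f y * g y\<bar> = \<bar>f x * (g x - g y) + g y * (f x - f y)\<bar>" by (simp add: algebra_simps)
    also have "\<dots> \<le> \<bar>f x\<bar> * \<bar>g x - g y\<bar> + \<bar>g y\<bar> * \<bar>f x - f y\<bar>"
      using abs_triangle_ineq[of "f x * (g x - g y)" "g y * (f x - f y)"] by (simp only: abs_mult)
    also have "\<dots> \<le> c1 * (M2 * dist x y) + c2 * (M1 * dist x y)"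
      using c1 c2 xy lipschitz_onD[OF M(1) xy] lipschitz_onD[OF M(2) xy]
      by (intro add_mono mult_mono) (auto simp: dist_real_def)
    finally show "dist (f x * g x) (f y * g y) \<le> (c1 * M2 + c2 * M1) * dist x y"
      by (simp add: dist_real_def algebra_simps)
  qed
  then show ?case by blast
qed

lemma lipschitz_on_Max:
  fixes f :: "'i \<Rightarrow> 'a::metric_space \<Rightarrow> real"
  assumes I: "finite I" "I \<noteq> {}" and f: "\<And>i. i \<in> I \<Longrightarrow> \<exists>M. M-lipschitz_on B (f i)"
  shows "\<exists>M. M-lipschitz_on B (\<lambda>x. MAX i\<in>I. f i x)"
proof -
  obtain M where M: "\<And>i. i \<in> I \<Longrightarrow> (M i)-lipschitz_on B (f i)" using f by metis
  have M0: "i \<in> I \<Longrightarrow> M i \<ge> 0" for i using M lipschitz_on_nonneg by blast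
  have le: "(MAX i\<in>I. f i x) \<le> (MAX i\<in>I. f i y) + sum M I * dist x y" if "x \<in> B" "y \<in> B" for x y
  proof (subst Max_le_iff)
    show "\<forall>a\<in>(\<lambda>i. f i x) ` I. a \<le> (MAX i\<in>I. f i y) + sum M I * dist x y"
    proof
      fix a assume "a \<in> (\<lambda>i. f i x) ` I"
      then obtain i where i: "i \<in> I" "a = f i x" by blast
      have "f i x \<le> f i y + M i * dist x y"
        using lipschitz_onD[OF M[OF i(1)] that] by (simp add: dist_real_def)
      moreover have "f i y \<le> (MAX i\<in>I. f i y)" using I i by (intro Max_ge) auto
      moreover have "M i * dist x y \<le> sum M I * dist x y"
        using I i M0 by (intro mult_right_mono member_le_sum) auto
      ultimately show "a \<le> (MAX i\<in>I. f i y) + sum M I * dist x y" using i by linarith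
    qed
  qed (use I in auto)
  have "(sum M I)-lipschitz_on B (\<lambda>x. MAX i\<in>I. f i x)"
  proof (rule lipschitz_onI)
    show "0 \<le> sum M I" using M0 by (rule sum_nonneg)
    fix x y assume "x \<in> B" "y \<in> B"
    then show "dist (MAX i\<in>I. f i x) (MAX i\<in>I. f i y) \<le> sum M I * dist x y"
      using le[of x y] le[of y x] by (simp add: dist_real_def dist_commute abs_le_iff)
  qed
  then show ?thesis by blast
qed

text \<open>Expanding the inner product in the standard basis shows that the doubling term and the
  growth penalty qualify as polynomial test functions.\<close>

lemma real_polynomial_function_inner_self:
  fixes a :: "'b::euclidean_space" and f :: "'a::real_normed_vector \<Rightarrow> 'b"
  assumes "bounded_linear f"
  shows "real_polynomial_function (\<lambda>z. (f z - a) \<bullet> (f z - a))"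
proof -
  have "real_polynomial_function (\<lambda>z. f z \<bullet> b)" for b
    by (rule real_polynomial_function.intros(1)) (rule bounded_linear_inner_left_comp[OF assms])
  then have "real_polynomial_function (\<lambda>z. \<Sum>b\<in>Basis. (f z \<bullet> b - a \<bullet> b) * (f z \<bullet> b - a \<bullet> b))"
    by (intro real_polynomial_function_sum real_polynomial_function.intros(4) real_polynomial_function_diff) auto
  moreover have "(f z - a) \<bullet> (f z - a) = (\<Sum>b\<in>Basis. (f z \<bullet> b - a \<bullet> b) * (f z \<bullet> b - a \<bullet> b))" for z
    by (subst euclidean_inner) (simp only: inner_diff_left)
  ultimately show ?thesis by simp
qed

lemma test_function_gradient:
  fixes \<psi> :: "(real^'n) \<times> real \<Rightarrow> real"
  assumes "T > 0" "t \<in> {0..T}" "(\<psi> has_derivative (\<lambda>h. p \<bullet> fst h + q * snd h)) (at (x, t))"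
  shows "space_grad \<psi> (x, t) = p" "time_deriv T \<psi> (x, t) = q"
proof -
  have *: "p \<bullet> v + q * r = space_grad \<psi> (x, t) \<bullet> v + time_deriv T \<psi> (x, t) * r" for v r
    using test_function_derivative[OF assms(1,2) has_derivative_at_withinI[OF assms(3)], of v r] by simp
  show "time_deriv T \<psi> (x, t) = q" using *[of 0 1] by simp
  have "space_grad \<psi> (x, t) \<bullet> v = p \<bullet> v" for v using *[of v 0] by simp
  then show "space_grad \<psi> (x, t) = p" using vector_eq_rdot by blast
qed

section \<open>Comparison of sub- and super-solutions\<close>

context control_system begin

text \<open>\<open>P\<close> and \<open>Q\<close> are the space gradient and the time derivative of
  \<open>\<zeta>\<close>. Since \<open>norm (F (x, d)) \<le> K + L * norm x\<close>, the last clause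
  makes \<open>\<zeta>\<close> decrease at rate at least \<open>\<kappa>\<close> under every
  control. The other bounds keep it below \<open>\<eta>\<close> over \<open>x0\<close> and above
  \<open>B\<close> on the sphere of radius \<open>\<rho>\<close>.\<close>

definition penalty :: "real \<Rightarrow> (real^'n) \<Rightarrow> real \<Rightarrow> real \<Rightarrow> real \<Rightarrow> ((real^'n) \<times> real \<Rightarrow> real) \<Rightarrow>
    ((real^'n) \<times> real \<Rightarrow> (real^'n)) \<Rightarrow> ((real^'n) \<times> real \<Rightarrow> real) \<Rightarrow> real \<Rightarrow> bool" where
  "penalty T x0 \<rho> \<eta> B \<zeta> P Q \<kappa> \<longleftrightarrow> real_polynomial_function \<zeta> \<and> \<kappa> > 0 \<and>
    (\<forall>z. (\<zeta> has_derivative (\<lambda>h. P z \<bullet> fst h + Q z * snd h)) (at z)) \<and>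
    (\<forall>z\<in>space_time T. \<zeta> z \<ge> 0) \<and> (\<forall>t\<in>{0..T}. \<zeta> (x0, t) \<le> \<eta>) \<and>
    (\<forall>x. \<forall>t\<in>{0..T}. norm x = \<rho> \<longrightarrow> \<zeta> (x, t) \<ge> B) \<and>
    (\<forall>x. \<forall>t\<in>{0..T}. Q (x, t) + norm (P (x, t)) * (K + L * norm x) \<le> - \<kappa>)"

text \<open>Along every trajectory \<open>(T + 1 - t) ^ M * (1 + x \<bullet> x)\<close> decreases once \<open>M\<close> is large, because
  \<open>F\<close> grows at most linearly. A high power of it is small at \<open>x0\<close> and large on a far sphere, so
  subtracting it keeps maxima away from that sphere.\<close>

lemma penalty_exists:
  fixes x0 :: "real^'n"
  assumes T: "T > 0"
  obtains \<rho> where "\<rho> > norm x0" "\<And>\<eta> B. \<eta> > 0 \<Longrightarrow> \<exists>\<zeta> P Q \<kappa>. penalty T x0 \<rho> \<eta> B \<zeta> P Q \<kappa>"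
proof -
  \<comment> \<open>With \<open>X = 1 + x \<bullet> x\<close> and \<open>b = T + 1 - t\<close>, the
    time derivative contributes \<open>M * X\<close> against
    \<open>b * 2 * norm x * (K + L * norm x)\<close> from space. The latter is at most
    \<open>(T + 1) * (K + 2 * L) * X\<close>; the extra 1 leaves a surplus of at least 1.\<close>
  obtain M0 :: nat where M0: "(T + 1) * (K + 2 * L) + 1 \<le> real M0" using real_arch_simple by blast
  define M where "M = Suc M0"
  have M: "(T + 1) * (K + 2 * L) + 1 \<le> real M" using M0 by (simp add: M_def)
  define G where "G = (T + 1) ^ M * (1 + x0 \<bullet> x0)"
  have "1 * 1 \<le> G" unfolding G_def using T by (intro mult_mono one_le_power) auto
  then have G1: "1 \<le> G" by simp
  \<comment> \<open>Since \<open>G \<ge> 1\<close>, the base function is at least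
    \<open>\<rho> * \<rho> \<ge> 2 * G\<close> on this sphere and at most \<open>G\<close> over
    \<open>x0\<close>. Its \<open>N\<close>-th powers thus differ by a factor of at least
    \<open>2 ^ N\<close>, and \<open>\<rho>\<close> involves neither \<open>\<eta>\<close> nor
    \<open>B\<close>.\<close>
  define \<rho> where "\<rho> = 2 * G"
  have "1 * (1 + x0 \<bullet> x0) \<le> G" unfolding G_def using T by (intro mult_right_mono one_le_power) auto
  moreover have "2 * norm x0 \<le> 1 + x0 \<bullet> x0"
    using power2_norm_eq_inner[of x0] sum_power2_ge_zero[of "norm x0 - 1" 0] by (simp add: power2_diff)
  then have "norm x0 \<le> 1 + x0 \<bullet> x0" using norm_ge_zero[of x0] by linarith
  ultimately have \<rho>: "norm x0 < \<rho>" using G1 by (simp add: \<rho>_def)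
  show thesis
  proof (rule that[OF \<rho>])
    fix \<eta> B :: real assume \<eta>: "\<eta> > 0"
    obtain N0 :: nat where N0: "B / \<eta> < 2 ^ N0" using real_arch_pow[of 2 "B / \<eta>"] by auto
    define N where "N = Suc N0"
    have "B \<le> \<eta> * 2 ^ N0" using N0 \<eta> by (simp add: pos_divide_less_eq mult.commute)
    also have "\<dots> \<le> \<eta> * 2 ^ N" using \<eta> by (simp add: N_def)
    finally have N: "B \<le> \<eta> * 2 ^ N" .
    \<comment> \<open>This scaling brings the \<open>N\<close>-th power down to at most
      \<open>\<eta>\<close> over \<open>x0\<close>; \<open>A\<close> also turns out to be the rate
      of decrease.\<close>
    define A where "A = \<eta> / G ^ N"
    have A: "A > 0" "A * G ^ N = \<eta>" using \<eta> G1 by (auto simp: A_def)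
    define g where "g z = (T + 1 - snd z) ^ M * (1 + fst z \<bullet> fst z)" for z :: "(real^'n) \<times> real"
    define \<zeta> where "\<zeta> z = A * g z ^ N" for z
    define c where "c z = A * (real N * g z ^ (N - 1))" for z
    define P where "P z = (c z * ((T + 1 - snd z) ^ M * 2)) *\<^sub>R fst z" for z :: "(real^'n) \<times> real"
    define Q where "Q z = - (c z * (real M * (T + 1 - snd z) ^ (M - 1) * (1 + fst z \<bullet> fst z)))" for z :: "(real^'n) \<times> real"
    have "real_polynomial_function (\<lambda>z :: (real^'n) \<times> real. fst z \<bullet> fst z)"
      using real_polynomial_function_inner_self[OF bounded_linear_fst, of 0] by simp
    then have poly: "real_polynomial_function \<zeta>"
      unfolding \<zeta>_def[abs_def] g_def[abs_def]
      by (intro real_polynomial_function.intros(4) real_polynomial_function_power real_polynomial_function.intros(2)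
          real_polynomial_function_diff real_polynomial_function.intros(3) real_polynomial_function.intros(1)[OF bounded_linear_snd])
    have der: "(\<zeta> has_derivative (\<lambda>h. P z \<bullet> fst h + Q z * snd h)) (at z)" for z
    proof -
      have "(g has_derivative (\<lambda>h. - (real M * (T + 1 - snd z) ^ (M - 1) * (1 + fst z \<bullet> fst z)) * snd h
          + (T + 1 - snd z) ^ M * 2 * (fst z \<bullet> fst h))) (at z)"
        unfolding g_def[abs_def]
        by (auto intro!: derivative_eq_intros simp: algebra_simps inner_commute)
      then have "(\<zeta> has_derivative (\<lambda>h. A * (real N * (- (real M * (T + 1 - snd z) ^ (M - 1) * (1 + fst z \<bullet> fst z)) * snd h
          + (T + 1 - snd z) ^ M * 2 * (fst z \<bullet> fst h)) * g z ^ (N - 1)))) (at z)"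
        unfolding \<zeta>_def[abs_def] by (intro has_derivative_mult_right has_derivative_power)
      moreover have "A * (real N * (- (real M * (T + 1 - snd z) ^ (M - 1) * (1 + fst z \<bullet> fst z)) * snd h
          + (T + 1 - snd z) ^ M * 2 * (fst z \<bullet> fst h)) * g z ^ (N - 1)) = P z \<bullet> fst h + Q z * snd h" for h
        by (simp add: P_def Q_def c_def algebra_simps)
      ultimately show ?thesis by simp
    qed
    have g1: "g (x, t) \<ge> 1 + x \<bullet> x" "g (x, t) \<ge> 1" if "t \<in> {0..T}" for x t
    proof -
      have "1 * (1 + x \<bullet> x) \<le> g (x, t)"
        unfolding g_def fst_conv snd_conv using that
        by (intro mult_right_mono one_le_power) (auto simp: add_nonneg_nonneg)
      then show "g (x, t) \<ge> 1 + x \<bullet> x" by (simp only: mult_1)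
      then show "g (x, t) \<ge> 1" using inner_ge_zero[of x] by linarith
    qed
    have nonneg: "\<zeta> z \<ge> 0" if "z \<in> space_time T" for z
      using g1(2)[of "snd z" "fst z"] that A by (auto simp: \<zeta>_def)
    have small: "\<zeta> (x0, t) \<le> \<eta>" if t: "t \<in> {0..T}" for t
    proof -
      have "g (x0, t) \<le> G"
        unfolding g_def G_def fst_conv snd_conv using t T by (intro mult_right_mono power_mono) auto
      then have "A * g (x0, t) ^ N \<le> A * G ^ N"
        using A g1(2)[OF t, of x0] by (intro mult_left_mono power_mono) auto
      then show ?thesis by (simp add: \<zeta>_def A)
    qed
    have large: "\<zeta> (x, t) \<ge> B" if t: "t \<in> {0..T}" and x: "norm x = \<rho>" for x t
    proof -
      have "2 * G \<le> \<rho> * \<rho>" using G1 mult_mono[of 1 "2 * G" "2 * G" "2 * G"] by (simp add: \<rho>_def)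
      also have "\<rho> * \<rho> \<le> g (x, t)" using g1(1)[OF t, of x] x power2_norm_eq_inner[of x] by (simp add: power2_eq_square)
      finally have "A * (2 * G) ^ N \<le> A * g (x, t) ^ N"
        using A G1 by (intro mult_left_mono power_mono) auto
      moreover have "A * (2 * G) ^ N = \<eta> * 2 ^ N" using A(2) by (simp add: power_mult_distrib mult_ac)
      ultimately show ?thesis unfolding \<zeta>_def using N by linarith
    qed
    have decr: "Q (x, t) + norm (P (x, t)) * (K + L * norm x) \<le> - A" if t: "t \<in> {0..T}" for x t
    proof -
      define b where "b = T + 1 - t"
      define X where "X = 1 + x \<bullet> x"
      have b: "1 \<le> b" "b \<le> T + 1" using t by (auto simp: b_def)
      have X: "X \<ge> 1" by (simp add: X_def)
      have nx: "x \<bullet> x = norm x * norm x" using power2_norm_eq_inner[of x] by (simp add: power2_eq_square)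
      have c: "c (x, t) \<ge> A"
      proof -
        have "1 * 1 \<le> real N * g (x, t) ^ (N - 1)"
          using g1(2)[OF t] by (intro mult_mono one_le_power) (auto simp: N_def)
        then show ?thesis using A by (simp add: c_def)
      qed
      have "2 * norm x \<le> X" using sum_power2_ge_zero[of "norm x - 1" 0] by (simp add: X_def nx power2_eq_square algebra_simps)
      then have "K * (2 * norm x) \<le> K * X" using K_nonneg by (intro mult_left_mono) auto
      moreover have "L * (2 * (norm x * norm x)) \<le> L * (2 * X)" using L_pos by (simp add: X_def nx)
      ultimately have growth: "2 * norm x * (K + L * norm x) \<le> (K + 2 * L) * X" by (simp add: algebra_simps)
      have "b * (2 * norm x * (K + L * norm x)) \<le> (T + 1) * ((K + 2 * L) * X)"
        by (rule mult_mono) (use growth b K_nonneg L_pos T in auto)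
      also have "\<dots> = ((T + 1) * (K + 2 * L)) * X" by simp
      also have "\<dots> \<le> (real M - 1) * X" using M X by (intro mult_right_mono) auto
      finally have "real M * X - b * (2 * norm x * (K + L * norm x)) \<ge> 1" using X by (simp add: left_diff_distrib)
      moreover have "c (x, t) * b ^ (M - 1) \<ge> A * 1"
        using c A b by (intro mult_mono one_le_power) auto
      ultimately have "A * 1 \<le> (c (x, t) * b ^ (M - 1)) * (real M * X - b * (2 * norm x * (K + L * norm x)))"
        using A by (intro mult_mono) auto
      also have "\<dots> = - (Q (x, t) + norm (P (x, t)) * (K + L * norm x))"
      proof -
        have "norm (P (x, t)) = c (x, t) * (b ^ (M - 1) * b * 2) * norm x"
          using c A b by (simp add: P_def b_def[symmetric] M_def abs_mult power_Suc2 del: power_Suc)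
        moreover have "Q (x, t) = - (c (x, t) * (real M * b ^ (M - 1) * X))"
          by (simp add: Q_def b_def X_def)
        ultimately show ?thesis by (simp add: algebra_simps)
      qed
      finally show ?thesis by simp
    qed
    have "penalty T x0 \<rho> \<eta> B \<zeta> P Q A"
      unfolding penalty_def using poly A(1) der nonneg small large decr by blast
    then show "\<exists>\<zeta> P Q \<kappa>. penalty T x0 \<rho> \<eta> B \<zeta> P Q \<kappa>" by blast
  qed
qed

text \<open>Moving the base point from \<open>x\<close> to \<open>y\<close> costs the Lipschitz
  term. The extra gradient \<open>P\<close> costs a growth term, of exactly the form that the
  decrease of the penalty offsets.\<close>

lemma hamiltonian_perturbation:
  "hamiltonian F D x (p + P) \<le> hamiltonian F D y p + L * norm (x - y) * norm p + norm P * (K + L * norm x)"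
proof (rule hamiltonian_least)
  fix d assume d: "d \<in> D"
  have "p \<bullet> (F (x, d) - F (y, d)) \<le> norm p * (L * norm (x - y))"
    by (rule order_trans[OF norm_cauchy_schwarz]) (intro mult_left_mono F_lipschitz[OF d] norm_ge_zero)
  moreover have "P \<bullet> F (x, d) \<le> norm P * (K + L * norm x)"
    by (rule order_trans[OF norm_cauchy_schwarz]) (intro mult_left_mono F_growth[OF d] norm_ge_zero)
  moreover have "(p + P) \<bullet> F (x, d) = p \<bullet> F (y, d) + p \<bullet> (F (x, d) - F (y, d)) + P \<bullet> F (x, d)"
    by (simp add: inner_diff_right inner_add_left)
  ultimately show "(p + P) \<bullet> F (x, d) \<le> hamiltonian F D y p + L * norm (x - y) * norm p + norm P * (K + L * norm x)"
    using hamiltonian_upper[OF d, of p y] by (simp add: mult_ac)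
qed

text \<open>At a maximum of the doubled function both solutions are tested with the same quadratic
  part. The sub-solution additionally carries the penalty. Subtracting the two inequalities leaves
  \<open>- \<kappa>\<close> plus an error of order \<open>\<epsilon>\<close>, unless the obstacle is
  active, in which case it orders the two values directly.\<close>

lemma comparison:
  fixes v w \<gamma> :: "(real^'n) \<times> real \<Rightarrow> real"
  assumes T: "T > 0"
    and v_lip: "lipschitz_on_bounded (space_time T) v"
    and w_lip: "lipschitz_on_bounded (space_time T) w"
    and \<gamma>_lip: "\<And>B. bounded B \<Longrightarrow> \<exists>M. M-lipschitz_on B \<gamma>"
    and sub: "\<And>\<psi> z. real_polynomial_function \<psi> \<Longrightarrow> z \<in> UNIV \<times> {0..<T} \<Longrightarrow>
      local_max_on (space_time T) (\<lambda>z. v z - \<psi> z) z \<Longrightarrow>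
      0 \<le> max (time_deriv T \<psi> z + hamiltonian F D (fst z) (space_grad \<psi> z)) (\<gamma> z - v z)"
    and super: "\<And>\<psi> z. real_polynomial_function \<psi> \<Longrightarrow> z \<in> UNIV \<times> {0..<T} \<Longrightarrow>
      local_min_on (space_time T) (\<lambda>z. w z - \<psi> z) z \<Longrightarrow>
      max (time_deriv T \<psi> z + hamiltonian F D (fst z) (space_grad \<psi> z)) (\<gamma> z - w z) \<le> 0"
    and terminal: "\<And>x. v (x, T) \<le> w (x, T)"
    and z0: "z0 \<in> space_time T"
  shows "v z0 \<le> w z0"
proof (rule ccontr)
  assume "\<not> v z0 \<le> w z0"
  define \<sigma> where "\<sigma> = v z0 - w z0"
  have \<sigma>: "\<sigma> > 0" using \<open>\<not> v z0 \<le> w z0\<close> by (simp add: \<sigma>_def)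
  obtain \<rho> where \<rho>: "\<rho> > norm (fst z0)"
    and penalty: "\<And>\<eta> B. \<eta> > 0 \<Longrightarrow> \<exists>\<zeta> P Q \<kappa>. penalty T (fst z0) \<rho> \<eta> B \<zeta> P Q \<kappa>"
    using penalty_exists[OF T, of "fst z0"] by blast
  \<comment> \<open>The penalty acts on the first variable only and keeps it inside radius
    \<open>\<rho>\<close>. The second variable gets one unit more room, so that it too is a spatial
    interior point once the two are less than 1 apart.\<close>
  define S S' where "S = cball (0::real^'n) (\<rho> + 1) \<times> {0..T}" and "S' = cball (0::real^'n) \<rho> \<times> {0..T}"
  have S: "bounded S" "S \<subseteq> space_time T" "S' \<subseteq> S" "compact S" "compact S'" "z0 \<in> S'"
    using \<rho> z0 by (auto simp: S_def S'_def intro!: bounded_Times compact_Times)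
  obtain \<Lambda>1 where \<Lambda>1: "\<Lambda>1-lipschitz_on S v" using v_lip S unfolding lipschitz_on_bounded_def by blast
  obtain \<Lambda>2 where \<Lambda>2: "\<Lambda>2-lipschitz_on S w" using w_lip S unfolding lipschitz_on_bounded_def by blast
  obtain \<Lambda>3 where \<Lambda>3: "\<Lambda>3-lipschitz_on S \<gamma>" using \<gamma>_lip S by blast
  define \<Lambda> where "\<Lambda> = max (max \<Lambda>1 \<Lambda>2) (max \<Lambda>3 1)"
  have \<Lambda>: "\<Lambda> > 0" "\<Lambda>-lipschitz_on S v" "\<Lambda>-lipschitz_on S w" "\<Lambda>-lipschitz_on S \<gamma>"
    using \<Lambda>1 \<Lambda>2 \<Lambda>3 by (auto simp: \<Lambda>_def intro: lipschitz_on_le)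
  obtain cv where cv: "\<And>z. z \<in> S \<Longrightarrow> \<bar>v z\<bar> \<le> cv" using lipschitz_on_imp_bounded_image[OF \<Lambda>(2) S(1)] by blast
  obtain cw where cw: "\<And>z. z \<in> S \<Longrightarrow> \<bar>w z\<bar> \<le> cw" using lipschitz_on_imp_bounded_image[OF \<Lambda>(3) S(1)] by blast
  obtain \<zeta> P Q \<kappa> where pen: "penalty T (fst z0) \<rho> (\<sigma> / 2) (cv + cw) \<zeta> P Q \<kappa>"
    using penalty[OF half_gt_zero[OF \<sigma>]] by blast
  have \<zeta>: "real_polynomial_function \<zeta>" "\<kappa> > 0"
    and \<zeta>_der: "\<And>z. (\<zeta> has_derivative (\<lambda>h. P z \<bullet> fst h + Q z * snd h)) (at z)"
    and \<zeta>_nonneg: "\<And>z. z \<in> space_time T \<Longrightarrow> \<zeta> z \<ge> 0"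
    and \<zeta>_small: "\<And>t. t \<in> {0..T} \<Longrightarrow> \<zeta> (fst z0, t) \<le> \<sigma> / 2"
    and \<zeta>_large: "\<And>x t. t \<in> {0..T} \<Longrightarrow> norm x = \<rho> \<Longrightarrow> \<zeta> (x, t) \<ge> cv + cw"
    and \<zeta>_decr: "\<And>x t. t \<in> {0..T} \<Longrightarrow> Q (x, t) + norm (P (x, t)) * (K + L * norm x) \<le> - \<kappa>"
    using pen unfolding penalty_def by blast+
  \<comment> \<open>The three bounds serve different ends: the doubled points are less than 1 apart,
    Lipschitz functions vary between them by less than \<open>\<sigma> / 2\<close>, and the final
    Hamiltonian error is below \<open>\<kappa>\<close>.\<close>
  define \<epsilon> where "\<epsilon> = min (1 / (4 * \<Lambda>)) (min (\<sigma> / (8 * \<Lambda>\<^sup>2)) (\<kappa> / (8 * L * \<Lambda>\<^sup>2)))"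
  have \<epsilon>: "\<epsilon> > 0" "2 * \<Lambda> * \<epsilon> < 1" "2 * \<Lambda>\<^sup>2 * \<epsilon> < \<sigma> / 2" "4 * L * \<Lambda>\<^sup>2 * \<epsilon> < \<kappa>"
  proof -
    show "\<epsilon> > 0" using \<Lambda>(1) \<sigma> \<zeta>(2) L_pos by (simp add: \<epsilon>_def)
    have "\<epsilon> \<le> 1 / (4 * \<Lambda>)" "\<epsilon> \<le> \<sigma> / (8 * \<Lambda>\<^sup>2)" "\<epsilon> \<le> \<kappa> / (8 * L * \<Lambda>\<^sup>2)" by (auto simp: \<epsilon>_def)
    then have "\<epsilon> * (4 * \<Lambda>) \<le> 1" "\<epsilon> * (8 * \<Lambda>\<^sup>2) \<le> \<sigma>" "\<epsilon> * (8 * L * \<Lambda>\<^sup>2) \<le> \<kappa>"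
      using \<Lambda>(1) L_pos by (simp_all add: pos_le_divide_eq)
    then show "2 * \<Lambda> * \<epsilon> < 1" "2 * \<Lambda>\<^sup>2 * \<epsilon> < \<sigma> / 2" "4 * L * \<Lambda>\<^sup>2 * \<epsilon> < \<kappa>"
      using \<sigma> \<zeta>(2) by (simp_all add: mult_ac)
  qed
  define \<Phi> where "\<Phi> a = v (fst a) - w (snd a) - (fst a - snd a) \<bullet> (fst a - snd a) / (2 * \<epsilon>) - \<zeta> (fst a)"
    for a :: "((real^'n) \<times> real) \<times> ((real^'n) \<times> real)"
  have \<zeta>_cont: "continuous_on UNIV \<zeta>" using \<zeta>(1) by (simp add: continuous_on_polymonial_function real_polynomial_function_eq)
  have "continuous_on (S' \<times> S) \<Phi>"
  proof -
    have c: "continuous_on S v" "continuous_on S w" using \<Lambda> lipschitz_on_continuous_on by blast+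
    have "continuous_on (S' \<times> S) (\<lambda>a. v (fst a))"
      by (rule continuous_on_compose2[OF c(1)]) (use S(3) in \<open>auto intro: continuous_on_fst continuous_on_id\<close>)
    moreover have "continuous_on (S' \<times> S) (\<lambda>a. w (snd a))"
      by (rule continuous_on_compose2[OF c(2)]) (auto intro: continuous_on_snd continuous_on_id)
    moreover have "continuous_on (S' \<times> S) (\<lambda>a. \<zeta> (fst a))"
      by (rule continuous_on_compose2[OF \<zeta>_cont]) (auto intro: continuous_on_fst continuous_on_id)
    moreover have "continuous_on (S' \<times> S) (\<lambda>a. (fst a - snd a) \<bullet> (fst a - snd a) / (2 * \<epsilon>))"
      using \<epsilon>(1) by (intro continuous_intros) auto
    ultimately show ?thesis unfolding \<Phi>_def[abs_def] by (intro continuous_on_diff)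
  qed
  moreover have "compact (S' \<times> S)" using S(4,5) by (intro compact_Times)
  moreover have "S' \<times> S \<noteq> {}" using S(3,6) by blast
  ultimately obtain a where a: "a \<in> S' \<times> S" "\<And>b. b \<in> S' \<times> S \<Longrightarrow> \<Phi> b \<le> \<Phi> a"
    using continuous_attains_sup[of "S' \<times> S" \<Phi>] by blast
  obtain x t y s where zz: "a = ((x, t), (y, s))" by (metis surj_pair)
  define z z' where "z = (x, t)" and "z' = (y, s)"
  have mem: "z \<in> S'" "z \<in> S" "z' \<in> S" using a zz S(3) by (auto simp: z_def z'_def)
  have ts: "t \<in> {0..T}" "s \<in> {0..T}" using mem by (auto simp: z_def z'_def S_def S'_def)
  have \<Phi>_max: "v z1 - w z2 - (z1 - z2) \<bullet> (z1 - z2) / (2 * \<epsilon>) - \<zeta> z1 \<le>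
      v z - w z' - (z - z') \<bullet> (z - z') / (2 * \<epsilon>) - \<zeta> z" if "z1 \<in> S'" "z2 \<in> S" for z1 z2
    using a(2)[of "(z1, z2)"] that zz by (simp add: \<Phi>_def z_def z'_def)
  have pen0: "(z - z') \<bullet> (z - z') / (2 * \<epsilon>) \<ge> 0" using \<epsilon>(1) by simp
  have \<zeta>z: "\<zeta> z \<ge> 0" using \<zeta>_nonneg mem S by blast
  have "\<zeta> z0 \<le> \<sigma> / 2" using \<zeta>_small[of "snd z0"] z0 by auto
  then have \<Phi>_ge: "\<sigma> / 2 \<le> v z - w z' - (z - z') \<bullet> (z - z') / (2 * \<epsilon>) - \<zeta> z"
    using \<Phi>_max[OF S(6) subsetD[OF S(3,6)]] by (simp add: \<sigma>_def)
  have lip: "\<bar>f z - f z'\<bar> \<le> \<Lambda> * norm (z - z')" if "\<Lambda>-lipschitz_on S f" for f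
    using lipschitz_onD[OF that mem(2,3)] by (simp add: dist_norm)
  \<comment> \<open>Comparing the maximum with the diagonal pair \<open>(z, z)\<close> leaves only
    the variation of \<open>w\<close>, so the quadratic term is at most linear in the
    distance.\<close>
  have near: "norm (z - z') \<le> 2 * \<Lambda> * \<epsilon>"
  proof -
    have "(z - z') \<bullet> (z - z') / (2 * \<epsilon>) \<le> w z - w z'"
      using \<Phi>_max[OF mem(1,2)] by simp
    also have "\<dots> \<le> \<Lambda> * norm (z - z')" using lip[OF \<Lambda>(3)] by simp
    finally have "norm (z - z') * norm (z - z') \<le> (2 * \<Lambda> * \<epsilon>) * norm (z - z')"
      using \<epsilon>(1) by (simp add: pos_divide_le_eq mult_ac flip: power2_norm_eq_inner power2_eq_square)
    then show ?thesis using \<Lambda>(1) \<epsilon>(1) by (cases "z = z'") auto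
  qed
  have lip': "\<bar>f z - f z'\<bar> < \<sigma> / 2" if "\<Lambda>-lipschitz_on S f" for f
  proof -
    have "\<Lambda> * norm (z - z') \<le> \<Lambda> * (2 * \<Lambda> * \<epsilon>)" using near \<Lambda>(1) by (intro mult_left_mono) auto
    also have "\<dots> = 2 * \<Lambda>\<^sup>2 * \<epsilon>" by (simp add: power2_eq_square)
    finally show ?thesis using lip[OF that] \<epsilon>(3) by linarith
  qed
  \<comment> \<open>At the final time the terminal inequality and the small variation of
    \<open>w\<close> would keep the doubled maximum below \<open>\<sigma> / 2\<close>. The same
    argument for \<open>s\<close> uses the variation of \<open>v\<close>.\<close>
  have tT: "t < T"
  proof (rule ccontr)
    assume "\<not> t < T"
    then have "v z \<le> w z" using ts terminal by (simp add: z_def)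
    then show False using \<Phi>_ge lip'[OF \<Lambda>(3)] pen0 \<zeta>z by linarith
  qed
  have sT: "s < T"
  proof (rule ccontr)
    assume "\<not> s < T"
    then have "v z' \<le> w z'" using ts terminal by (simp add: z'_def)
    then show False using \<Phi>_ge lip'[OF \<Lambda>(2)] pen0 \<zeta>z by linarith
  qed
  \<comment> \<open>On the sphere the penalty reaches \<open>cv + cw\<close>, which is at least
    \<open>v z - w z'\<close>, so the doubled value could not be positive.\<close>
  have nx: "norm x < \<rho>"
  proof (rule ccontr)
    assume "\<not> norm x < \<rho>"
    then have "norm x = \<rho>" using mem(1) by (auto simp: z_def S'_def)
    then have "\<zeta> z \<ge> cv + cw" using \<zeta>_large[OF ts(1)] by (simp add: z_def)
    then show False using \<Phi>_ge pen0 cv[OF mem(2)] cw[OF mem(3)] \<sigma> by linarith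
  qed
  have xy: "norm (x - y) \<le> 2 * \<Lambda> * \<epsilon>"
    using norm_fst_le[of "x - y" "t - s"] near by (simp add: z_def z'_def)
  have ny: "norm y < \<rho> + 1" using nx xy \<epsilon>(2) norm_triangle_sub[of y x] by (simp add: norm_minus_commute)
  \<comment> \<open>The quadratic term has gradient \<open>(p, q)\<close> in the first variable and
    the opposite one in the second. The test function for \<open>w\<close> is its negative, so both
    tests share \<open>(p, q)\<close>.\<close>
  define p q where "p = (x - y) /\<^sub>R \<epsilon>" and "q = (t - s) / \<epsilon>"
  have dist_der: "((\<lambda>z. (z - c) \<bullet> (z - c) / (2 * \<epsilon>)) has_derivative (\<lambda>h. (z - c) \<bullet> h / \<epsilon>)) (at z)"
    for z c :: "(real^'n) \<times> real"
    using \<epsilon>(1) by (auto intro!: derivative_eq_intros simp: inner_commute)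
  have dist_poly: "real_polynomial_function (\<lambda>z. (z - c) \<bullet> (z - c) / (2 * \<epsilon>))" for c :: "(real^'n) \<times> real"
    by (intro real_polynomial_function_divide real_polynomial_function_inner_self bounded_linear_ident)
  have pq: "(z - z') \<bullet> h / \<epsilon> = p \<bullet> fst h + q * snd h" for h
    by (cases h) (simp add: z_def z'_def p_def q_def inner_Pair divide_inverse algebra_simps)

  define \<psi>1 where "\<psi>1 z1 = (z1 - z') \<bullet> (z1 - z') / (2 * \<epsilon>) + \<zeta> z1" for z1
  have \<psi>1_poly: "real_polynomial_function \<psi>1"
    unfolding \<psi>1_def[abs_def] by (intro real_polynomial_function.intros(3) dist_poly \<zeta>(1))
  have \<psi>1_grad: "space_grad \<psi>1 (x, t) = p + P z" "time_deriv T \<psi>1 (x, t) = q + Q z"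
  proof -
    have "(\<psi>1 has_derivative (\<lambda>h. (z - z') \<bullet> h / \<epsilon> + (P z \<bullet> fst h + Q z * snd h))) (at z)"
      unfolding \<psi>1_def[abs_def] by (intro has_derivative_add dist_der \<zeta>_der)
    then have "(\<psi>1 has_derivative (\<lambda>h. (p + P z) \<bullet> fst h + (q + Q z) * snd h)) (at (x, t))"
      unfolding pq by (simp add: algebra_simps flip: z_def)
    from test_function_gradient[OF T ts(1) this]
    show "space_grad \<psi>1 (x, t) = p + P z" "time_deriv T \<psi>1 (x, t) = q + Q z" .
  qed
  \<comment> \<open>The neighbourhood restricts space only. Times are confined by
    \<open>space_time T\<close> itself, so a maximum on the initial face is a valid test
    point.\<close>
  have max: "local_max_on (space_time T) (\<lambda>z. v z - \<psi>1 z) z"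
    unfolding local_max_on_def
  proof (rule eventually_at_topological[THEN iffD2], intro exI conjI ballI impI)
    show "open (ball (0::real^'n) \<rho> \<times> (UNIV::real set))" by (intro open_Times) auto
    show "z \<in> ball 0 \<rho> \<times> UNIV" using nx by (simp add: z_def)
    fix z1 assume "z1 \<in> ball (0::real^'n) \<rho> \<times> (UNIV::real set)" "z1 \<in> space_time T"
    then have "z1 \<in> S'" by (auto simp: S'_def)
    from \<Phi>_max[OF this mem(3)] show "v z1 - \<psi>1 z1 \<le> v z - \<psi>1 z" by (simp add: \<psi>1_def)
  qed
  have sub_ineq: "0 \<le> max (q + Q z + hamiltonian F D x (p + P z)) (\<gamma> z - v z)"
    using sub[OF \<psi>1_poly _ max] tT ts \<psi>1_grad by (simp add: z_def)

  define \<psi>2 where "\<psi>2 z1 = - ((z1 - z) \<bullet> (z1 - z) / (2 * \<epsilon>))" for z1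
  have \<psi>2_poly: "real_polynomial_function \<psi>2"
    unfolding \<psi>2_def[abs_def] by (intro real_polynomial_function_minus dist_poly)
  have \<psi>2_grad: "space_grad \<psi>2 (y, s) = p" "time_deriv T \<psi>2 (y, s) = q"
  proof -
    have "(\<psi>2 has_derivative (\<lambda>h. - ((z' - z) \<bullet> h / \<epsilon>))) (at z')"
      unfolding \<psi>2_def[abs_def] by (intro has_derivative_minus dist_der)
    moreover have "- ((z' - z) \<bullet> h / \<epsilon>) = p \<bullet> fst h + q * snd h" for h
      unfolding pq[symmetric] by (simp add: inner_diff_left diff_divide_distrib)
    ultimately have "(\<psi>2 has_derivative (\<lambda>h. p \<bullet> fst h + q * snd h)) (at (y, s))"
      by (simp add: z'_def)
    from test_function_gradient[OF T ts(2) this]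
    show "space_grad \<psi>2 (y, s) = p" "time_deriv T \<psi>2 (y, s) = q" .
  qed
  have min: "local_min_on (space_time T) (\<lambda>z. w z - \<psi>2 z) z'"
    unfolding local_min_on_def
  proof (rule eventually_at_topological[THEN iffD2], intro exI conjI ballI impI)
    show "open (ball (0::real^'n) (\<rho> + 1) \<times> (UNIV::real set))" by (intro open_Times) auto
    show "z' \<in> ball 0 (\<rho> + 1) \<times> UNIV" using ny by (simp add: z'_def)
    fix z1 assume "z1 \<in> ball (0::real^'n) (\<rho> + 1) \<times> (UNIV::real set)" "z1 \<in> space_time T"
    then have "z1 \<in> S" by (auto simp: S_def)
    moreover have "(z - c) \<bullet> (z - c) = (c - z) \<bullet> (c - z)" for c
      by (simp add: inner_diff_left inner_diff_right inner_commute)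
    ultimately show "w z' - \<psi>2 z' \<le> w z1 - \<psi>2 z1"
      using \<Phi>_max[OF mem(1), of z1] by (simp add: \<psi>2_def)
  qed
  have super_ineq: "q + hamiltonian F D y p \<le> 0" "\<gamma> z' \<le> w z'"
    using super[OF \<psi>2_poly _ min] sT ts \<psi>2_grad by (auto simp: z'_def)

  show False
  proof (cases "\<gamma> z < v z")
    case False
    \<comment> \<open>The chain \<open>v z \<le> \<gamma> z < \<gamma> z' + \<sigma> / 2 \<le> w z'
      + \<sigma> / 2\<close> contradicts the lower bound on the doubled maximum.\<close>
    then show False using super_ineq(2) lip'[OF \<Lambda>(4)] \<Phi>_ge pen0 \<zeta>z by linarith
  next
    case True
    then have "0 \<le> q + Q z + hamiltonian F D x (p + P z)" using sub_ineq by (simp add: max_def split: if_splits)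
    also have "\<dots> \<le> q + Q z + (hamiltonian F D y p + L * norm (x - y) * norm p + norm (P z) * (K + L * norm x))"
      using hamiltonian_perturbation[of x p "P z" y] by simp
    also have "\<dots> \<le> L * norm (x - y) * norm p - \<kappa>"
      using super_ineq(1) \<zeta>_decr[OF ts(1), of x] by (simp add: z_def)
    \<comment> \<open>The Lipschitz bound keeps \<open>p\<close> below \<open>2 * \<Lambda>\<close>
      however small \<open>\<epsilon>\<close> is, so the product is of order
      \<open>\<epsilon>\<close>.\<close>
    also have "L * norm (x - y) * norm p \<le> L * (2 * \<Lambda> * \<epsilon>) * (2 * \<Lambda>)"
    proof (intro mult_mono)
      have "norm p = norm (x - y) / \<epsilon>" using \<epsilon>(1) by (simp add: p_def divide_inverse mult.commute)
      then show "norm p \<le> 2 * \<Lambda>" using xy \<epsilon>(1) by (simp add: pos_divide_le_eq)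
    qed (use xy L_pos \<Lambda>(1) \<epsilon>(1) in auto)
    also have "L * (2 * \<Lambda> * \<epsilon>) * (2 * \<Lambda>) = 4 * L * \<Lambda>\<^sup>2 * \<epsilon>" by (simp add: power2_eq_square)
    finally show False using \<epsilon>(4) by simp
  qed
qed

end

text \<open>Real suprema carry information only for bounded families. The a priori radius confines
  all trajectories from \<open>(x, t)\<close>, and polynomials are bounded there; both suprema then
  become universal quantifiers, which commute with the finite maxima.\<close>

lemma value_function_le_iff:
  fixes F :: "(real^'n) \<times> (real^'m) \<Rightarrow> (real^'n)"
  assumes sys: "control_system F D L K" and t: "t \<in> {0..T}"
    and g_poly: "\<And>i. i \<in> {1..nX} \<Longrightarrow> real_polynomial_function (g i)"
    and l_poly: "\<And>i. i \<in> {1..nTR} \<Longrightarrow> real_polynomial_function (l i)"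
    and n_pos: "nX \<ge> 1" "nTR \<ge> 1"
  shows "value_function F D T l nTR g nX (x, t) \<le> c \<longleftrightarrow> (\<forall>d\<in>controls D t T.
     (MAX i\<in>{1..nTR}. l i (trajectory F T x t d T)) \<le> c \<and>
     (\<forall>s\<in>{t..T}. (MAX i\<in>{1..nX}. g i (trajectory F T x t d s, s)) \<le> c))"
proof -
  interpret control_system F D L K by fact
  define J where "J d = max (MAX i\<in>{1..nTR}. l i (trajectory F T x t d T))
      (MAX i\<in>{1..nX}. SUP s\<in>{t..T}. g i (trajectory F T x t d s, s))" for d
  define r where "r = 2 * (norm x + K * (T - t)) * exp (2 * L * T)"
  have bound: "norm (trajectory F T x t d s) \<le> r" if d: "d \<in> controls D t T" and s: "s \<in> {t..T}" for d s
  proof -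
    have "norm (trajectory F T x t d s) \<le> 2 * (norm x + K * (T - t)) * exp (2 * L * (s - t))"
      using t by (intro integral_solution_bound[OF trajectory_solution[OF _ d] controls_admissible[OF d] s]) auto
    also have "\<dots> \<le> r"
      unfolding r_def using s t L_pos K_nonneg by (intro mult_left_mono) auto
    finally show ?thesis .
  qed
  have in_ball: "trajectory F T x t d s \<in> cball 0 r" "(trajectory F T x t d s, s) \<in> cball 0 r \<times> {0..T}"
    if "d \<in> controls D t T" "s \<in> {t..T}" for d s
    using bound[OF that] that t by auto
  have cball_bounded: "bounded (cball (0::real^'n) r \<times> {0..T})" by (simp add: bounded_Times)
  have ne: "{1..nX} \<noteq> {}" "{1..nTR} \<noteq> {}" using n_pos by auto
  have "\<exists>b. \<forall>z\<in>cball 0 r \<times> {0..T}. g i z \<le> b" if i: "i \<in> {1..nX}" for i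
  proof -
    obtain M where "M-lipschitz_on (cball 0 r \<times> {0..T}) (g i)"
      using real_polynomial_function_lipschitz_on_bounded[OF g_poly[OF i] cball_bounded] by blast
    from lipschitz_on_imp_bounded_image[OF this cball_bounded] show ?thesis by (meson abs_le_D1)
  qed
  then obtain bg where bg: "\<And>i z. i \<in> {1..nX} \<Longrightarrow> z \<in> cball 0 r \<times> {0..T} \<Longrightarrow> g i z \<le> bg i" by metis
  have "\<exists>b. \<forall>z\<in>cball 0 r. l i z \<le> b" if i: "i \<in> {1..nTR}" for i
  proof -
    obtain M where "M-lipschitz_on (cball 0 r) (l i)"
      using real_polynomial_function_lipschitz_on_bounded[OF l_poly[OF i] bounded_cball] by blast
    from lipschitz_on_imp_bounded_image[OF this bounded_cball] show ?thesis by (meson abs_le_D1)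
  qed
  then obtain bl where bl: "\<And>i z. i \<in> {1..nTR} \<Longrightarrow> z \<in> cball 0 r \<Longrightarrow> l i z \<le> bl i" by metis
  have J_le: "J d \<le> b \<longleftrightarrow> (\<forall>i\<in>{1..nTR}. l i (trajectory F T x t d T) \<le> b) \<and>
      (\<forall>i\<in>{1..nX}. \<forall>s\<in>{t..T}. g i (trajectory F T x t d s, s) \<le> b)" if d: "d \<in> controls D t T" for d b
  proof -
    have "(SUP s\<in>{t..T}. g i (trajectory F T x t d s, s)) \<le> b \<longleftrightarrow>
        (\<forall>s\<in>{t..T}. g i (trajectory F T x t d s, s) \<le> b)" if i: "i \<in> {1..nX}" for i
      using t bg[OF i in_ball(2)[OF d]] by (intro cSUP_le_iff bdd_aboveI2) auto
    then show ?thesis unfolding J_def using ne by (simp add: ball_simps)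
  qed
  have "bdd_above (J ` controls D t T)"
  proof (rule bdd_aboveI2)
    fix d assume d: "d \<in> controls D t T"
    have T: "T \<in> {t..T}" using t by simp
    let ?b = "max (MAX i\<in>{1..nTR}. bl i) (MAX i\<in>{1..nX}. bg i)"
    show "J d \<le> ?b"
      unfolding J_le[OF d]
    proof (intro conjI ballI)
      fix i assume i: "i \<in> {1..nTR}"
      have "bl i \<le> (MAX i\<in>{1..nTR}. bl i)" using i by (intro Max_ge) auto
      then show "l i (trajectory F T x t d T) \<le> ?b" using bl[OF i in_ball(1)[OF d T]] by linarith
    next
      fix i s assume i: "i \<in> {1..nX}" and s: "s \<in> {t..T}"
      have "bg i \<le> (MAX i\<in>{1..nX}. bg i)" using i by (intro Max_ge) auto
      then show "g i (trajectory F T x t d s, s) \<le> ?b" using bg[OF i in_ball(2)[OF d s]] by linarith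
    qed
  qed
  moreover have "value_function F D T l nTR g nX (x, t) = (SUP d\<in>controls D t T. J d)"
    by (simp add: value_function_def J_def)
  ultimately have "value_function F D T l nTR g nX (x, t) \<le> c \<longleftrightarrow> (\<forall>d\<in>controls D t T. J d \<le> c)"
    using cSUP_le_iff[where f = J and u = c, OF controls_nonempty] by simp
  also have "\<dots> \<longleftrightarrow> (\<forall>d\<in>controls D t T. (MAX i\<in>{1..nTR}. l i (trajectory F T x t d T)) \<le> c \<and>
     (\<forall>s\<in>{t..T}. (MAX i\<in>{1..nX}. g i (trajectory F T x t d s, s)) \<le> c))"
    using J_le ne by (intro ball_cong) auto
  finally show ?thesis .
qed

section \<open>Existence and uniqueness for the semialgebraic data\<close>

lemma continuous_imp_semicontinuous_on:
  assumes "continuous_on S w"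
  shows "lower_semicontinuous_on S w" "upper_semicontinuous_on S w"
  using assms unfolding lower_semicontinuous_on_def upper_semicontinuous_on_def continuous_on_def
  by (auto dest: order_tendstoD)

theorem theorem2:
  fixes f F :: "(real^'n) \<times> (real^'m) \<Rightarrow> (real^'n)"
    and h :: "nat \<Rightarrow> (real^'m) \<Rightarrow> real"
    and g :: "nat \<Rightarrow> (real^'n) \<times> real \<Rightarrow> real"
    and l :: "nat \<Rightarrow> (real^'n) \<Rightarrow> real"
    and nD nX nTR :: nat
    and T R :: real
    and D :: "(real^'m) set"
    and u :: "(real^'n) \<times> real \<Rightarrow> real"
  defines "D \<equiv> disturbance_set h nD"
    and "u \<equiv> value_function F D T l nTR g nX"
  assumes T_pos: "T > 0"
    and R_pos: "R > 0"
    and f_poly: "\<And>i. real_polynomial_function (\<lambda>z. f z $ i)"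
    and h_poly: "\<And>i. i \<in> {1..nD} \<Longrightarrow> real_polynomial_function (h i)"
    and g_poly: "\<And>i. i \<in> {1..nX} \<Longrightarrow> real_polynomial_function (g i)"
    and l_poly: "\<And>i. i \<in> {1..nTR} \<Longrightarrow> real_polynomial_function (l i)"
    and nX_pos: "nX \<ge> 1"
    and nTR_pos: "nTR \<ge> 1"
    and D_compact: "compact D"
    and D_nonempty: "D \<noteq> {}"
    and X_compact: "\<And>t. t \<in> {0..T} \<Longrightarrow> compact (state_set g nX t)"
    and X_frontier: "\<And>t. t \<in> {0..T} \<Longrightarrow>
      frontier (state_set g nX t) = (\<Union>i\<in>{1..nX}. {x \<in> state_set g nX t. g i (x, t) = 0})"
    and TR_frontier:
      "frontier (target_set l nTR) = (\<Union>i\<in>{1..nTR}. {x \<in> target_set l nTR. l i x = 0})"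
    and X_in_ball: "\<And>t. t \<in> {0..T} \<Longrightarrow> state_set g nX t \<subseteq> bounding_ball R"
    and X_ball_frontier: "\<And>t. t \<in> {0..T} \<Longrightarrow>
      frontier (state_set g nX t) \<inter> frontier (bounding_ball R) = {}"
    and F_continuous: "continuous_on (UNIV \<times> D) F"
    and F_lipschitz: "\<exists>L. \<forall>d\<in>D. L-lipschitz_on UNIV (\<lambda>x. F (x, d))"
    and F_eq_f: "\<And>z. z \<in> bounding_ball R \<times> D \<Longrightarrow> F z = f z"
  shows "lipschitz_on_bounded (space_time T) u \<and>
         viscosity_solution F D T g nX u \<and>
         terminal_condition T l nTR g nX u \<and>
         (\<forall>w. lipschitz_on_bounded (space_time T) w \<and>
              viscosity_solution F D T g nX w \<and>
              terminal_condition T l nTR g nX w \<longrightarrow>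
              (\<forall>z \<in> space_time T. w z = u z))"
proof -
  obtain L0 where L0: "\<And>d. d \<in> D \<Longrightarrow> L0-lipschitz_on UNIV (\<lambda>x. F (x, d))" using F_lipschitz by blast
  \<comment> \<open>The given constant may be 0; the shift makes it strictly positive.\<close>
  define L where "L = \<bar>L0\<bar> + 1"
  have "compact ((\<lambda>d. F (0, d)) ` D)"
    using F_continuous D_compact
    by (intro compact_continuous_image continuous_on_compose2[OF F_continuous] continuous_intros) auto
  then have "bounded ((\<lambda>d. F (0, d)) ` D)" by (rule compact_imp_bounded)
  then obtain K where K: "K > 0" "\<And>d. d \<in> D \<Longrightarrow> norm (F (0, d)) \<le> K"
    unfolding bounded_pos by blast
  have sys: "control_system F D L K"
  proof
    fix d x y assume d: "d \<in> D"
    have "norm (F (x, d) - F (y, d)) \<le> L0 * norm (x - y)"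
      using lipschitz_onD[OF L0[OF d], of x y] by (simp add: dist_norm)
    also have "\<dots> \<le> L * norm (x - y)" by (intro mult_right_mono) (auto simp: L_def)
    finally show "norm (F (x, d) - F (y, d)) \<le> L * norm (x - y)" .
  qed (use D_compact D_nonempty F_continuous K in \<open>auto simp: L_def\<close>)
  let ?\<beta> = "\<lambda>x. MAX i\<in>{1..nTR}. l i x" and ?\<gamma> = "\<lambda>z. MAX i\<in>{1..nX}. g i z"
  have \<beta>: "\<exists>M. M-lipschitz_on B ?\<beta>" if "bounded B" for B
    using nTR_pos by (intro lipschitz_on_Max real_polynomial_function_lipschitz_on_bounded l_poly that) auto
  have \<gamma>: "\<exists>M. M-lipschitz_on B ?\<gamma>" if "bounded B" for B
    using nX_pos by (intro lipschitz_on_Max real_polynomial_function_lipschitz_on_bounded g_poly that) auto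
  interpret value_problem F D L K T ?\<beta> ?\<gamma> u
  proof (intro value_problem.intro sys value_problem_axioms.intro T_pos \<beta> \<gamma>)
    fix x t c assume "t \<in> {0..T}"
    then show "u (x, t) \<le> c \<longleftrightarrow> (\<forall>d\<in>controls D t T.
      (MAX i\<in>{1..nTR}. l i (trajectory F T x t d T)) \<le> c \<and>
      (\<forall>s\<in>{t..T}. (MAX i\<in>{1..nX}. g i (trajectory F T x t d s, s)) \<le> c))"
      unfolding u_def by (rule value_function_le_iff[OF sys _ g_poly l_poly nX_pos nTR_pos])
  qed
  have u_cont: "continuous_on (space_time T) u"
    unfolding continuous_on_eq_continuous_within
  proof
    fix z :: "(real^'n) \<times> real" assume z: "z \<in> space_time T"
    \<comment> \<open>Continuity is local, so Lipschitz bounds on unit balls suffice although no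
      global constant is available.\<close>
    obtain M where "M-lipschitz_on (space_time T \<inter> ball z 1) u"
      using u_lipschitz_on_bounded unfolding lipschitz_on_bounded_def
      by (metis Int_lower1 bounded_Int bounded_ball)
    then have "continuous (at z within space_time T \<inter> ball z 1) u"
      using lipschitz_on_continuous_within z by (metis IntI centre_in_ball zero_less_one)
    moreover have "at z within space_time T \<inter> ball z 1 = at z within space_time T"
      by (rule at_within_nhd[of z "ball z 1"]) auto
    ultimately show "continuous (at z within space_time T) u" by simp
  qed
  have super: "viscosity_supersolution F D T g nX u"
    unfolding viscosity_supersolution_def
  proof (intro conjI allI impI ballI continuous_imp_semicontinuous_on[OF u_cont])
    fix \<psi> :: "(real^'n) \<times> real \<Rightarrow> real" and z0 :: "(real^'n) \<times> real"
    assume \<psi>: "C_infinity_on (space_time T) \<psi>" "z0 \<in> UNIV \<times> {0..<T}" "local_min_on (space_time T) (\<lambda>z. u z - \<psi> z) z0"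
    then obtain x t where z0: "z0 = (x, t)" "t \<in> {0..<T}" by auto
    then show "HJ_expr F D T g nX u \<psi> z0 \<le> 0"
      using u_supersolution_test[OF \<psi>(1) z0(2)] \<psi>(3) u_ge_obstacle[of t x] by (auto simp: HJ_expr_def)
  qed
  have sub: "viscosity_subsolution F D T g nX u"
    unfolding viscosity_subsolution_def
  proof (intro conjI allI impI ballI continuous_imp_semicontinuous_on[OF u_cont])
    fix \<psi> :: "(real^'n) \<times> real \<Rightarrow> real" and z0 :: "(real^'n) \<times> real"
    assume \<psi>: "C_infinity_on (space_time T) \<psi>" "z0 \<in> UNIV \<times> {0..<T}" "local_max_on (space_time T) (\<lambda>z. u z - \<psi> z) z0"
    then obtain x t where z0: "z0 = (x, t)" "t \<in> {0..<T}" by auto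
    show "HJ_expr F D T g nX u \<psi> z0 \<ge> 0"
    proof (cases "?\<gamma> (x, t) < u (x, t)")
      case True
      then show ?thesis
        using u_subsolution_test[OF \<psi>(1) z0(2) _ True] \<psi>(3) z0 by (simp add: HJ_expr_def le_max_iff_disj)
    next
      case False
      then show ?thesis using z0 by (simp add: HJ_expr_def le_max_iff_disj)
    qed
  qed
  have visc: "viscosity_solution F D T g nX u"
    using u_cont super sub by (simp add: viscosity_solution_def)
  have term_u: "terminal_condition T l nTR g nX u"
    using u_terminal by (simp add: terminal_condition_def)
  \<comment> \<open>Stated for two arbitrary solutions, so that exchanging their roles gives
    equality with \<open>u\<close>.\<close>
  have comp: "v z \<le> w z"
    if v: "lipschitz_on_bounded (space_time T) v" "viscosity_solution F D T g nX v" "terminal_condition T l nTR g nX v"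
      and w: "lipschitz_on_bounded (space_time T) w" "viscosity_solution F D T g nX w" "terminal_condition T l nTR g nX w"
      and z: "z \<in> space_time T" for v w :: "(real^'n) \<times> real \<Rightarrow> real" and z
  proof (rule comparison[OF T_pos v(1) w(1) \<gamma> _ _ _ z])
    fix \<psi> :: "(real^'n) \<times> real \<Rightarrow> real" and z :: "(real^'n) \<times> real"
    assume \<psi>: "real_polynomial_function \<psi>" "z \<in> UNIV \<times> {0..<T}"
    note C = real_polynomial_function_C_infinity_on[OF \<psi>(1)]
    show "0 \<le> max (time_deriv T \<psi> z + hamiltonian F D (fst z) (space_grad \<psi> z)) (?\<gamma> z - v z)"
      if "local_max_on (space_time T) (\<lambda>z. v z - \<psi> z) z"
      using v(2) C \<psi>(2) that unfolding viscosity_solution_def viscosity_subsolution_def HJ_expr_def by blast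
    show "max (time_deriv T \<psi> z + hamiltonian F D (fst z) (space_grad \<psi> z)) (?\<gamma> z - w z) \<le> 0"
      if "local_min_on (space_time T) (\<lambda>z. w z - \<psi> z) z"
      using w(2) C \<psi>(2) that unfolding viscosity_solution_def viscosity_supersolution_def HJ_expr_def by blast
  qed (use v(3) w(3) in \<open>auto simp: terminal_condition_def\<close>)
  show ?thesis
    using u_lipschitz_on_bounded visc term_u comp by (meson order_antisym)
qed

end
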